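(* Let $G$ be a group, $M$ a right $\mathbb Z[G]$-module, $\varphi:G\to Z(G)$ a group homomorphism into the center of $G$, $X=\bigsqcup_{m\in M}(\{m\}\times G)=M\times G$ the $G$-Alexander multiple conjugation biquandle of $(M,\varphi)$, regarded also as an $X$-set with action $*:=\underline{*}$, and $A$ an abelian group. Below, $m_i':=m_i-m_{i+1}$. (1) Let $f:M^3\to A$ be a $G$-invariant multilinear map. The $2$-cocycle $\Phi_f=f\circ\psi_2\circ\gamma_2\circ{\rm proj}_2:C_2(X;\mathbb Z)_X\to A$ of the multiple conjugation biquandle $X$ is given by $$\Phi_f(\langle(m_0,g_0)\rangle\langle(m_1,g_1)\rangle\langle(m_2,g_2)\rangle)=f\bigl(m_0'(1-\varphi(g_1)^{-1}g_1),\;m_1',\;m_2(1-\varphi(g_2)g_2^{-1})\bigr)$$ for all $(m_0,g_0),(m_1,g_1),(m_2,g_2)\in X$. (2) Let $f:M^4\to A$ be a $G$-invariant multilinear map. The $3$-cocycle $\Phi_f=f\circ\psi_3\circ\gamma_3\circ{\rm proj}_3:C_3(X;\mathbb Z)_X\to A$ of the multiple conjugation biquandle $X$ is given by $$\begin{aligned}\Phi_f(\langle(m_0,g_0)\rangle\langle(m_1,g_1)\rangle\langle(m_2,g_2)\rangle\langle(m_3,g_3)\rangle)=\;&f\bigl(m_0'(1-\varphi(g_1)^{-1}g_1),\,m_1',\,m_2',\,m_3(1-\varphi(g_3)g_3^{-1})\bigr)\\&-f\bigl(m_0'(1-\varphi(g_1)^{-1}g_1)g_2,\,m_1'g_2,\,m_2'\varphi(g_2),\,m_3(1-\varphi(g_3)g_3^{-1})\varphi(g_2)\bigr)\end{aligned}$$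 for all $(m_0,g_0),(m_1,g_1),(m_2,g_2),(m_3,g_3)\in X$.
   Context: **$G$-Alexander multiple conjugation biquandle (MCB).** $X=M\times G$ with $(m,g)\,\underline{*}\,(n,h)=(mh+n(\varphi(h)-h),\,h^{-1}gh)$, $(m,g)\,\overline{*}\,(n,h)=(m\varphi(h),\,g)$, decomposed as the disjoint union of the groups $G_m:=\{m\}\times G$ ($m\in M$) with product $(m,g)(m,h)=(m,gh)$. **$G$-invariant multilinear maps.** Multilinear means additive in each variable. $f:M^n\to A$ is $G$-invariant if $f(m_1g,\dots,m_ng)=f(m_1,\dots,m_n)$ for all $g\in G$. Such an $f$ induces a homomorphism $f:C_n^{\rm gp}(M;\mathbb Z)_G\to A$, where $C_n^{\rm gp}(M;\mathbb Z)_G$ is the free abelian group on $M^n$ modulo all $(m_1g,\dots,m_ng)-(m_1,\dots,m_n)$; it is a group cocycle vanishing on tuples having a zero entry. **MCB complex with the $X$-set $X$.** For $n\ge0$, $P_n(X;\mathbb Z)_X$ is the free abelian group on symbols $\langle x_0\rangle\langle\bm x_1\rangle\cdots\langle\bm x_k\rangle$, where $x_0\in X$, $\langle\bm x_i\rangle=\langle x_{i1},\dots,x_{in_i}\rangle$ with $n_i\ge1$, all entries of a given $\bm x_i$ ($i\ge1$) lie in one and the same group $G_m$ ($m$ may depend on $i$), and $n_1+\cdots+n_k=n$. Operations with an element apply entrywise. For $n\ge1$, $$\partial_n(\langle x_0\rangle\langle\bm x_1\rangle\cdots\langle\bm x_k\rangle)=\sum_{i=1}^k(-1)^{n_1+\cdots+n_{i-1}}\Bigl\{\langle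 x_0\underline{*}x_{i1}\rangle\langle\bm x_1\underline{*}x_{i1}\rangle\cdots\langle\bm x_{i-1}\underline{*}x_{i1}\rangle\langle\widetilde{\bm x}_i\overline{*}x_{i1}\rangle\langle\bm x_{i+1}\overline{*}x_{i1}\rangle\cdots\langle\bm x_k\overline{*}x_{i1}\rangle+\sum_{j=1}^{n_i}(-1)^j\langle x_0\rangle\langle\bm x_1\rangle\cdots\langle x_{i1},\dots,x_{i(j-1)},x_{i(j+1)},\dots,x_{in_i}\rangle\cdots\langle\bm x_k\rangle\Bigr\},$$ with $\langle\widetilde{\bm x}_i\overline{*}x_{i1}\rangle=\langle(x_{i1}^{-1}x_{i2})\overline{*}x_{i1},\dots,(x_{i1}^{-1}x_{in_i})\overline{*}x_{i1}\rangle$; factors that become empty are omitted. For $\langle\bm a\rangle=\langle a_1,\dots,a_s\rangle$, $\langle\bm b\rangle=\langle b_1,\dots,b_t\rangle$ with all entries in one group $G_m$, put $$\langle\langle\bm a\rangle\langle\bm b\rangle\rangle=\sum_\mu(-1)^{\sum_{l=1}^s(\mu(l)-l)}\langle c_1,\dots,c_{s+t}\rangle,\qquad c_j=a_{\lfloor j;\mu\rfloor}\,b_{j-\lfloor j;\mu\rfloor},$$ over strictly increasing $\mu:\{1,\dots,s\}\to\{1,\dots,s+t\}$, where $\lfloor j;\mu\rfloor$ is the number of $l$ with $\mu(l)\le j$ and $a_0=b_0$ is the identity of $G_m$. $D_n(X;\mathbb Z)_X\subset P_n(X;\mathbb Z)_X$ is generated by all $\langle x_0\rangle\langle\bm a_1\rangle\cdots\langle\bm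 a\rangle\langle\bm b\rangle\cdots\langle\bm a_k\rangle-\langle x_0\rangle\langle\bm a_1\rangle\cdots\langle\langle\bm a\rangle\langle\bm b\rangle\rangle\cdots\langle\bm a_k\rangle$ (with $\bm a,\bm b$ having all entries in one $G_m$) for $n\ge2$, and $D_n=0$ for $n\le1$. It is known that $D_*$ is a subcomplex of the chain complex $P_*$; $C_*(X;\mathbb Z)_X=P_*/D_*$. An $n$-cocycle with values in an abelian group $B$ is a homomorphism $\Phi:C_n(X;\mathbb Z)_X\to B$ with $\Phi\circ\partial_{n+1}=0$. **The maps ($n\ge2$).** $C_n^{\rm BR}(X;\mathbb Z)_X$ is the free abelian group on $X\times X^n$, and $C_n^{\rm BR_U}(X;\mathbb Z)_X$ is the free abelian group on $G^{n+1}\times M^{n+1}$. - ${\rm proj}_n:P_n(X;\mathbb Z)_X\to C_n^{\rm BR}(X;\mathbb Z)_X$ sends $\langle x_0\rangle\langle\bm x_1\rangle\cdots\langle\bm x_k\rangle$ to $(x_0,x_{11},\dots,x_{k1})$ if $k=n$ and to $0$ otherwise. - $\gamma_n((m_0,g_0),\dots,(m_n,g_n))=(g_0,\dots,g_n;\,m_0-m_1,\dots,m_{n-1}-m_n,\,m_n)$. - $\psi_n(g_0,\dots,g_n;m_0,\dots,m_n)=\sum_{k\in\{0,1\}^n}(-1)^{k_1+\cdots+k_n}(m_0\bm g_{k,0},\dots,m_n\bm g_{k,n})\in C_{n+1}^{\rm gp}(M;\mathbb Z)_G$, where $\bm g_{k,0}=g_1^{k_1}\cdots g_n^{k_n}$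 and $\bm g_{k,i}=\varphi(g_1^{k_1}\cdots g_i^{k_i})g_{i+1}^{k_{i+1}}\cdots g_n^{k_n}$ for $1\le i\le n$. The composite $f\circ\psi_n\circ\gamma_n\circ{\rm proj}_n$ is formed on $P_n(X;\mathbb Z)_X$ and then regarded on the quotient $C_n(X;\mathbb Z)_X$. *)

theory Defs
  imports "HOL-Algebra.Algebra"
begin

section \<open>Right modules over integral group rings\<close>

text \<open>Elements of the free abelian group on a set are finitely supported integer functions;
  the basis element of \<open>s\<close> is \<^term>\<open>frag_of s\<close>, integer multiples are \<^const>\<open>frag_cmul\<close>, and
  \<^const>\<open>frag_extend\<close> extends a map on basis elements additively.\<close>

definition int_group_ring :: "('g, 'e) monoid_scheme \<Rightarrow> ('g \<Rightarrow>\<^sub>0 int) ring"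
  where "int_group_ring G =
    \<lparr>carrier = {p. Poly_Mapping.keys p \<subseteq> carrier G},
     monoid.mult = (\<lambda>p q. frag_extend (\<lambda>g. frag_extend (\<lambda>h. frag_of (g \<otimes>\<^bsub>G\<^esub> h)) q) p),
     one = frag_of \<one>\<^bsub>G\<^esub>,
     ring.zero = 0,
     add = (+)\<rparr>"

lemma keys_frag_extend_subset:
  assumes "Poly_Mapping.keys p \<subseteq> S" "\<And>x. x \<in> S \<Longrightarrow> Poly_Mapping.keys (f x) \<subseteq> T"
  shows "Poly_Mapping.keys (frag_extend f p) \<subseteq> T"
  using keys_frag_extend[of f p] assms by blast

lemma frag_extend_add_fun:
  "frag_extend (\<lambda>x. f x + g x) p = frag_extend f p + frag_extend g p"
  by (simp add: frag_extend_def frag_cmul_distrib2 sum.distrib)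

lemma ring_int_group_ring:
  assumes "Group.group G"
  shows "ring (int_group_ring G)"
proof -
  interpret G: Group.group G by fact
  let ?m = "\<lambda>p q. frag_extend (\<lambda>g. frag_extend (\<lambda>h. frag_of (g \<otimes>\<^bsub>G\<^esub> h)) q) p"
  have closed: "Poly_Mapping.keys (?m p q) \<subseteq> carrier G"
    if "Poly_Mapping.keys p \<subseteq> carrier G" "Poly_Mapping.keys q \<subseteq> carrier G" for p q
    by (intro keys_frag_extend_subset[OF that(1)] keys_frag_extend_subset[OF that(2)])
       (auto simp: keys_frag_of)
  have l: "?m (p + p') q = ?m p q + ?m p' q" for p p' q
    by (rule frag_extend_add)
  have r: "?m p (q + q') = ?m p q + ?m p q'" for p q q'
    by (simp add: frag_extend_add frag_extend_add_fun)
  have ld: "?m (p - p') q = ?m p q - ?m p' q" for p p' q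
    by (rule frag_extend_diff)
  have rd: "?m p (q - q') = ?m p q - ?m p q'" for p q q'
    using r[where p = p and q = "q - q'" and q' = q'] by simp
  have assoc: "?m (?m p q) s = ?m p (?m q s)"
    if p: "Poly_Mapping.keys p \<subseteq> carrier G" and q: "Poly_Mapping.keys q \<subseteq> carrier G"
      and s: "Poly_Mapping.keys s \<subseteq> carrier G" for p q s
    using p
  proof (induction p rule: frag_induction)
    case (one x)
    show ?case using q
    proof (induction q rule: frag_induction)
      case (one y)
      show ?case using s
      proof (induction s rule: frag_induction)
        case (one z)
        then show ?case
          using \<open>x \<in> carrier G\<close> \<open>y \<in> carrier G\<close> by (simp add: G.m_assoc)
      next
        case (diff a b)
        then show ?case by (simp only: rd)
      qed simp
    next
      case (diff a b)
      then show ?case by (simp only: ld rd)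
    qed simp
  next
    case (diff a b)
    then show ?case by (simp only: ld)
  qed simp
  have l1: "?m (frag_of \<one>\<^bsub>G\<^esub>) p = p" if "Poly_Mapping.keys p \<subseteq> carrier G" for p
    using that by (induction p rule: frag_induction) (simp_all only: rd, simp_all)
  have r1: "?m p (frag_of \<one>\<^bsub>G\<^esub>) = p" if "Poly_Mapping.keys p \<subseteq> carrier G" for p
    using that by (induction p rule: frag_induction) (simp_all only: ld, simp_all)
  show ?thesis
  proof (rule ringI)
    show "abelian_group (int_group_ring G)"
    proof (rule abelian_groupI)
      fix x assume x: "x \<in> carrier (int_group_ring G)"
      then have "- x \<in> carrier (int_group_ring G)"
        by (simp add: int_group_ring_def)
      moreover have "- x \<oplus>\<^bsub>int_group_ring G\<^esub> x = \<zero>\<^bsub>int_group_ring G\<^esub>"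
        by (simp add: int_group_ring_def)
      ultimately show "\<exists>y\<in>carrier (int_group_ring G).
        y \<oplus>\<^bsub>int_group_ring G\<^esub> x = \<zero>\<^bsub>int_group_ring G\<^esub>" by blast
    qed (use keys_add in \<open>fastforce simp: int_group_ring_def add_ac\<close>)+
    show "monoid (int_group_ring G)"
      by (rule monoidI)
         (simp_all add: int_group_ring_def closed assoc l1[simplified] r1[simplified] keys_frag_of)
  qed (simp_all add: int_group_ring_def l r)
qed

record ('r, 'm) right_mod = "'m ring" +
  ract :: "['m, 'r] \<Rightarrow> 'm" (infixl \<open>\<triangleleft>\<index>\<close> 70)

locale right_module = R?: ring R + M?: abelian_group M
  for R :: "('r, 'k) ring_scheme" (structure)
    and M :: "('r, 'm, 'f) right_mod_scheme" (structure) +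
  assumes ract_closed:
      "\<lbrakk>x \<in> carrier M; a \<in> carrier R\<rbrakk> \<Longrightarrow> x \<triangleleft>\<^bsub>M\<^esub> a \<in> carrier M"
    and ract_add_left:
      "\<lbrakk>x \<in> carrier M; y \<in> carrier M; a \<in> carrier R\<rbrakk> \<Longrightarrow>
        (x \<oplus>\<^bsub>M\<^esub> y) \<triangleleft>\<^bsub>M\<^esub> a = x \<triangleleft>\<^bsub>M\<^esub> a \<oplus>\<^bsub>M\<^esub> y \<triangleleft>\<^bsub>M\<^esub> a"
    and ract_add_right:
      "\<lbrakk>x \<in> carrier M; a \<in> carrier R; b \<in> carrier R\<rbrakk> \<Longrightarrow>
        x \<triangleleft>\<^bsub>M\<^esub> (a \<oplus>\<^bsub>R\<^esub> b) = x \<triangleleft>\<^bsub>M\<^esub> a \<oplus>\<^bsub>M\<^esub> x \<triangleleft>\<^bsub>M\<^esub> b"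
    and ract_mult:
      "\<lbrakk>x \<in> carrier M; a \<in> carrier R; b \<in> carrier R\<rbrakk> \<Longrightarrow>
        x \<triangleleft>\<^bsub>M\<^esub> (a \<otimes>\<^bsub>R\<^esub> b) = (x \<triangleleft>\<^bsub>M\<^esub> a) \<triangleleft>\<^bsub>M\<^esub> b"
    and ract_one:
      "x \<in> carrier M \<Longrightarrow> x \<triangleleft>\<^bsub>M\<^esub> \<one>\<^bsub>R\<^esub> = x"

definition group_center :: "('g, 'e) monoid_scheme \<Rightarrow> 'g set"
  where "group_center G = {z \<in> carrier G. \<forall>g\<in>carrier G. z \<otimes>\<^bsub>G\<^esub> g = g \<otimes>\<^bsub>G\<^esub> z}"


section \<open>The \<open>G\<close>-Alexander multiple conjugation biquandle\<close>

definition mcb_carrier ::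
    "('g, 'e) monoid_scheme \<Rightarrow> ('g \<Rightarrow>\<^sub>0 int, 'm, 'f) right_mod_scheme \<Rightarrow> ('m \<times> 'g) set"
  where "mcb_carrier G M = carrier M \<times> carrier G"

definition mcb_under ::
    "('g, 'e) monoid_scheme \<Rightarrow> ('g \<Rightarrow>\<^sub>0 int, 'm, 'f) right_mod_scheme \<Rightarrow> ('g \<Rightarrow> 'g)
      \<Rightarrow> 'm \<times> 'g \<Rightarrow> 'm \<times> 'g \<Rightarrow> 'm \<times> 'g"
  where "mcb_under G M \<phi> = (\<lambda>(m, g) (n, h).
    (m \<triangleleft>\<^bsub>M\<^esub> frag_of h \<oplus>\<^bsub>M\<^esub> n \<triangleleft>\<^bsub>M\<^esub> (frag_of (\<phi> h) - frag_of h), inv\<^bsub>G\<^esub> h \<otimes>\<^bsub>G\<^esub> g \<otimes>\<^bsub>G\<^esub> h))"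

definition mcb_over ::
    "('g \<Rightarrow>\<^sub>0 int, 'm, 'f) right_mod_scheme \<Rightarrow> ('g \<Rightarrow> 'g)
      \<Rightarrow> 'm \<times> 'g \<Rightarrow> 'm \<times> 'g \<Rightarrow> 'm \<times> 'g"
  where "mcb_over M \<phi> = (\<lambda>(m, g) (n, h). (m \<triangleleft>\<^bsub>M\<^esub> frag_of (\<phi> h), g))"

definition mcb_fibre :: "('g, 'e) monoid_scheme \<Rightarrow> 'm \<Rightarrow> ('m \<times> 'g) monoid"
  where "mcb_fibre G m =
    \<lparr>carrier = {m} \<times> carrier G,
     monoid.mult = (\<lambda>x y. (m, snd x \<otimes>\<^bsub>G\<^esub> snd y)),
     one = (m, \<one>\<^bsub>G\<^esub>)\<rparr>"


section \<open>The chain complex with coefficients in the \<open>X\<close>-set \<open>X\<close>\<close>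

text \<open>The symbol \<open>\<langle>x0\<rangle>\<langle>\<bar>x1\<rangle>...\<langle>\<bar>xk\<rangle>\<close> is encoded as \<open>(x0, [\<bar>x1, ..., \<bar>xk])\<close>.  The indices of
  the blocks and of the entries of a block are shifted to start from 0.\<close>

type_synonym 'x symb = "'x \<times> 'x list list"

definition mcb_symbols ::
    "('g, 'e) monoid_scheme \<Rightarrow> ('g \<Rightarrow>\<^sub>0 int, 'm, 'f) right_mod_scheme \<Rightarrow> nat \<Rightarrow> ('m \<times> 'g) symb set"
  where "mcb_symbols G M n = {(x0, xs). x0 \<in> mcb_carrier G M \<and>
    (\<forall>ys\<in>set xs. ys \<noteq> [] \<and> (\<exists>m\<in>carrier M. set ys \<subseteq> carrier (mcb_fibre G m))) \<and>
    sum_list (map length xs) = n}"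

definition mcb_P ::
    "('g, 'e) monoid_scheme \<Rightarrow> ('g \<Rightarrow>\<^sub>0 int, 'm, 'f) right_mod_scheme \<Rightarrow> nat
      \<Rightarrow> (('m \<times> 'g) symb \<Rightarrow>\<^sub>0 int) monoid"
  where "mcb_P G M n = free_Abelian_group (mcb_symbols G M n)"

definition symb_omit :: "'x \<Rightarrow> 'x list list \<Rightarrow> 'x symb \<Rightarrow>\<^sub>0 int"
  where "symb_omit x0 xs = frag_of (x0, filter (\<lambda>ys. ys \<noteq> []) xs)"

definition mcb_tilde ::
    "('g, 'e) monoid_scheme \<Rightarrow> ('g \<Rightarrow>\<^sub>0 int, 'm, 'f) right_mod_scheme \<Rightarrow> ('g \<Rightarrow> 'g)
      \<Rightarrow> ('m \<times> 'g) list \<Rightarrow> ('m \<times> 'g) list"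
  where "mcb_tilde G M \<phi> ys =
    (let a = hd ys; H = mcb_fibre G (fst a)
     in map (\<lambda>y. mcb_over M \<phi> (inv\<^bsub>H\<^esub> a \<otimes>\<^bsub>H\<^esub> y) a) (tl ys))"

definition mcb_boundary_symb ::
    "('g, 'e) monoid_scheme \<Rightarrow> ('g \<Rightarrow>\<^sub>0 int, 'm, 'f) right_mod_scheme \<Rightarrow> ('g \<Rightarrow> 'g)
      \<Rightarrow> ('m \<times> 'g) symb \<Rightarrow> ('m \<times> 'g) symb \<Rightarrow>\<^sub>0 int"
  where "mcb_boundary_symb G M \<phi> = (\<lambda>(x0, xs).
    \<Sum>i<length xs. frag_cmul ((-1) ^ sum_list (map length (take i xs)))
      (let a = hd (xs ! i) in
       symb_omit (mcb_under G M \<phi> x0 a)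
         (map (map (\<lambda>y. mcb_under G M \<phi> y a)) (take i xs) @
          [mcb_tilde G M \<phi> (xs ! i)] @
          map (map (\<lambda>y. mcb_over M \<phi> y a)) (drop (Suc i) xs))
       + (\<Sum>j<length (xs ! i). frag_cmul ((-1) ^ Suc j)
           (symb_omit x0 (xs[i := take j (xs ! i) @ drop (Suc j) (xs ! i)])))))"

text \<open>This is \<open>\<partial>\<^sub>n\<close> for every \<open>n\<close>; the degree is determined by the symbol.\<close>

definition mcb_boundary ::
    "('g, 'e) monoid_scheme \<Rightarrow> ('g \<Rightarrow>\<^sub>0 int, 'm, 'f) right_mod_scheme \<Rightarrow> ('g \<Rightarrow> 'g)
      \<Rightarrow> (('m \<times> 'g) symb \<Rightarrow>\<^sub>0 int) \<Rightarrow> (('m \<times> 'g) symb \<Rightarrow>\<^sub>0 int)"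
  where "mcb_boundary G M \<phi> = frag_extend (mcb_boundary_symb G M \<phi>)"

definition shuffle_maps :: "nat \<Rightarrow> nat \<Rightarrow> (nat \<Rightarrow> nat) set"
  where "shuffle_maps s t = {\<mu> \<in> {1..s} \<rightarrow>\<^sub>E {1..s + t}. strict_mono_on {1..s} \<mu>}"

definition shuffle_floor :: "nat \<Rightarrow> (nat \<Rightarrow> nat) \<Rightarrow> nat \<Rightarrow> nat"
  where "shuffle_floor s \<mu> j = card {l \<in> {1..s}. \<mu> l \<le> j}"

text \<open>Consing \<open>\<one>\<^bsub>H\<^esub>\<close> realises the convention that \<open>a\<^sub>0 = b\<^sub>0\<close> is the identity of the group \<open>H\<close>.\<close>

definition shuffle_block ::
    "('x, 'e) monoid_scheme \<Rightarrow> 'x list \<Rightarrow> 'x list \<Rightarrow> (nat \<Rightarrow> nat) \<Rightarrow> 'x list"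
  where "shuffle_block H as bs \<mu> =
    map (\<lambda>j. (\<one>\<^bsub>H\<^esub> # as) ! shuffle_floor (length as) \<mu> j
             \<otimes>\<^bsub>H\<^esub> (\<one>\<^bsub>H\<^esub> # bs) ! (j - shuffle_floor (length as) \<mu> j))
        [1..<Suc (length as + length bs)]"

text \<open>The chain \<open>\<langle>x0\<rangle>\<langle>us\<rangle>\<langle>\<langle>as\<rangle>\<langle>bs\<rangle>\<rangle>\<langle>vs\<rangle>\<close>, where \<open>us\<close> and \<open>vs\<close> are lists of blocks.  In the
  exponent \<open>\<mu> l \<ge> l\<close>, so that the subtraction does not truncate.\<close>

definition shuffle_chain ::
    "('x, 'e) monoid_scheme \<Rightarrow> 'x \<Rightarrow> 'x list list \<Rightarrow> 'x list \<Rightarrow> 'x list \<Rightarrow> 'x list list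
      \<Rightarrow> 'x symb \<Rightarrow>\<^sub>0 int"
  where "shuffle_chain H x0 us as bs vs =
    (\<Sum>\<mu>\<in>shuffle_maps (length as) (length bs).
      frag_cmul ((-1) ^ (\<Sum>l=1..length as. \<mu> l - l))
        (frag_of (x0, us @ [shuffle_block H as bs \<mu>] @ vs)))"

definition mcb_D ::
    "('g, 'e) monoid_scheme \<Rightarrow> ('g \<Rightarrow>\<^sub>0 int, 'm, 'f) right_mod_scheme \<Rightarrow> nat
      \<Rightarrow> (('m \<times> 'g) symb \<Rightarrow>\<^sub>0 int) set"
  where "mcb_D G M n =
    (if n \<ge> 2 then generate (mcb_P G M n)
      {frag_of (x0, us @ [as, bs] @ vs) - shuffle_chain (mcb_fibre G m) x0 us as bs vs
       | x0 us as bs vs m. m \<in> carrier M \<and>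
         set as \<subseteq> carrier (mcb_fibre G m) \<and> set bs \<subseteq> carrier (mcb_fibre G m) \<and>
         (x0, us @ [as, bs] @ vs) \<in> mcb_symbols G M n}
     else {0})"

definition mcb_C ::
    "('g, 'e) monoid_scheme \<Rightarrow> ('g \<Rightarrow>\<^sub>0 int, 'm, 'f) right_mod_scheme \<Rightarrow> nat
      \<Rightarrow> (('m \<times> 'g) symb \<Rightarrow>\<^sub>0 int) set monoid"
  where "mcb_C G M n = mcb_P G M n Mod mcb_D G M n"

definition mcb_class ::
    "('g, 'e) monoid_scheme \<Rightarrow> ('g \<Rightarrow>\<^sub>0 int, 'm, 'f) right_mod_scheme \<Rightarrow> nat
      \<Rightarrow> (('m \<times> 'g) symb \<Rightarrow>\<^sub>0 int) \<Rightarrow> (('m \<times> 'g) symb \<Rightarrow>\<^sub>0 int) set"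
  where "mcb_class G M n c = mcb_D G M n #>\<^bsub>mcb_P G M n\<^esub> c"

text \<open>The boundary map of the quotient complex sends the class of \<open>c\<close> to the class of \<open>\<partial>c\<close>.
  The condition \<open>\<Phi> \<circ> \<partial>\<^sub>n\<^sub>+\<^sub>1 = 0\<close> is imposed on every representative \<open>c\<close> of every class.\<close>

definition mcb_cocycle ::
    "('g, 'e) monoid_scheme \<Rightarrow> ('g \<Rightarrow>\<^sub>0 int, 'm, 'f) right_mod_scheme \<Rightarrow> ('g \<Rightarrow> 'g)
      \<Rightarrow> nat \<Rightarrow> ('a, 'h) ring_scheme \<Rightarrow> ((('m \<times> 'g) symb \<Rightarrow>\<^sub>0 int) set \<Rightarrow> 'a) \<Rightarrow> bool"
  where "mcb_cocycle G M \<phi> n B \<Phi> \<longleftrightarrow>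
    \<Phi> \<in> hom (mcb_C G M n) (add_monoid B) \<and>
    (\<forall>c\<in>carrier (mcb_P G M (n + 1)).
      \<Phi> (mcb_class G M n (mcb_boundary G M \<phi> c)) = \<zero>\<^bsub>B\<^esub>)"


section \<open>\<open>G\<close>-invariant multilinear maps\<close>

definition tuples :: "'x set \<Rightarrow> nat \<Rightarrow> 'x list set"
  where "tuples S n = {xs. length xs = n \<and> set xs \<subseteq> S}"

definition multilinear_map ::
    "nat \<Rightarrow> ('m, 'e) ring_scheme \<Rightarrow> ('a, 'h) ring_scheme \<Rightarrow> ('m list \<Rightarrow> 'a) \<Rightarrow> bool"
  where "multilinear_map n M A f \<longleftrightarrow>
    f \<in> tuples (carrier M) n \<rightarrow> carrier A \<and>
    (\<forall>ms\<in>tuples (carrier M) n. \<forall>i<n. \<forall>x\<in>carrier M. \<forall>y\<in>carrier M.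
      f (ms[i := x \<oplus>\<^bsub>M\<^esub> y]) = f (ms[i := x]) \<oplus>\<^bsub>A\<^esub> f (ms[i := y]))"

definition G_invariant ::
    "nat \<Rightarrow> ('g, 'e) monoid_scheme \<Rightarrow> ('g \<Rightarrow>\<^sub>0 int, 'm, 'f) right_mod_scheme
      \<Rightarrow> ('m list \<Rightarrow> 'a) \<Rightarrow> bool"
  where "G_invariant n G M f \<longleftrightarrow>
    (\<forall>g\<in>carrier G. \<forall>ms\<in>tuples (carrier M) n. f (map (\<lambda>m. m \<triangleleft>\<^bsub>M\<^esub> frag_of g) ms) = f ms)"

text \<open>\<open>gp_chains M n\<close> is the free abelian group on \<open>M\<^sup>n\<close> and \<open>gp_coinv G M n\<close> is
  \<open>C\<^sub>n\<^sup>g\<^sup>p(M; \<int>)\<^sub>G\<close>, its quotient by the subgroup \<open>gp_rel G M n\<close>.\<close>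

definition gp_chains ::
    "('g \<Rightarrow>\<^sub>0 int, 'm, 'f) right_mod_scheme \<Rightarrow> nat \<Rightarrow> ('m list \<Rightarrow>\<^sub>0 int) monoid"
  where "gp_chains M n = free_Abelian_group (tuples (carrier M) n)"

definition gp_rel ::
    "('g, 'e) monoid_scheme \<Rightarrow> ('g \<Rightarrow>\<^sub>0 int, 'm, 'f) right_mod_scheme \<Rightarrow> nat
      \<Rightarrow> ('m list \<Rightarrow>\<^sub>0 int) set"
  where "gp_rel G M n = generate (gp_chains M n)
    {frag_of (map (\<lambda>m. m \<triangleleft>\<^bsub>M\<^esub> frag_of g) ms) - frag_of ms
     | g ms. g \<in> carrier G \<and> ms \<in> tuples (carrier M) n}"

definition gp_coinv ::
    "('g, 'e) monoid_scheme \<Rightarrow> ('g \<Rightarrow>\<^sub>0 int, 'm, 'f) right_mod_scheme \<Rightarrow> nat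
      \<Rightarrow> ('m list \<Rightarrow>\<^sub>0 int) set monoid"
  where "gp_coinv G M n = gp_chains M n Mod gp_rel G M n"

text \<open>The additive extension of \<open>f\<close> to formal integer combinations of basis elements.\<close>

definition linear_extension ::
    "('a, 'h) ring_scheme \<Rightarrow> ('s \<Rightarrow> 'a) \<Rightarrow> ('s \<Rightarrow>\<^sub>0 int) \<Rightarrow> 'a"
  where "linear_extension A f c =
    finsum A (\<lambda>s. [Poly_Mapping.lookup c s] \<cdot>\<^bsub>A\<^esub> f s) (Poly_Mapping.keys c)"

text \<open>The map induced by \<open>h\<close> on a quotient group: the value on a coset is the common value of
  \<open>h\<close> on its elements.\<close>

definition on_quotient :: "('c \<Rightarrow> 'a) \<Rightarrow> 'c set \<Rightarrow> 'a"
  where "on_quotient h Y = the_elem (h ` Y)"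


section \<open>The maps \<open>proj\<^sub>n\<close>, \<open>\<gamma>\<^sub>n\<close>, \<open>\<psi>\<^sub>n\<close> and the cochain \<open>\<Phi>\<^sub>f\<close>\<close>

text \<open>The basis of \<open>C\<^sub>n\<^sup>B\<^sup>R\<close> consists of the lists \<open>[x0, ..., xn]\<close>, and that of \<open>C\<^sub>n\<^sup>B\<^sup>R\<^sup>U\<close> of the pairs
  \<open>([g0, ..., gn], [m0, ..., mn])\<close>.\<close>

definition proj_BR :: "nat \<Rightarrow> ('x symb \<Rightarrow>\<^sub>0 int) \<Rightarrow> ('x list \<Rightarrow>\<^sub>0 int)"
  where "proj_BR n = frag_extend (\<lambda>(x0, xs).
    if length xs = n then frag_of (x0 # map hd xs) else 0)"

definition gamma_BR ::
    "('m, 'e) ring_scheme \<Rightarrow> nat \<Rightarrow> (('m \<times> 'g) list \<Rightarrow>\<^sub>0 int) \<Rightarrow> ('g list \<times> 'm list \<Rightarrow>\<^sub>0 int)"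
  where "gamma_BR M n = frag_extend (\<lambda>xs.
    frag_of (map snd xs,
      map (\<lambda>i. fst (xs ! i) \<ominus>\<^bsub>M\<^esub> fst (xs ! Suc i)) [0..<n] @ [fst (xs ! n)]))"

text \<open>\<open>power_word G gs k a b\<close> is \<open>g\<^sub>a\<^bsup>k(a)\<^esup> ... g\<^sub>b\<^bsup>k(b)\<^esup>\<close>, which is the identity for \<open>a > b\<close>.\<close>

definition power_word ::
    "('g, 'e) monoid_scheme \<Rightarrow> 'g list \<Rightarrow> (nat \<Rightarrow> nat) \<Rightarrow> nat \<Rightarrow> nat \<Rightarrow> 'g"
  where "power_word G gs k a b =
    foldr (\<lambda>i w. (gs ! i) [^]\<^bsub>G\<^esub> k i \<otimes>\<^bsub>G\<^esub> w) [a..<Suc b] \<one>\<^bsub>G\<^esub>"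

definition psi_word ::
    "('g, 'e) monoid_scheme \<Rightarrow> ('g \<Rightarrow> 'g) \<Rightarrow> nat \<Rightarrow> 'g list \<Rightarrow> (nat \<Rightarrow> nat) \<Rightarrow> nat \<Rightarrow> 'g"
  where "psi_word G \<phi> n gs k i =
    (if i = 0 then power_word G gs k 1 n
     else \<phi> (power_word G gs k 1 i) \<otimes>\<^bsub>G\<^esub> power_word G gs k (Suc i) n)"

definition psi_basis ::
    "('g, 'e) monoid_scheme \<Rightarrow> ('g \<Rightarrow>\<^sub>0 int, 'm, 'f) right_mod_scheme \<Rightarrow> ('g \<Rightarrow> 'g)
      \<Rightarrow> nat \<Rightarrow> 'g list \<times> 'm list \<Rightarrow> ('m list \<Rightarrow>\<^sub>0 int)"
  where "psi_basis G M \<phi> n = (\<lambda>(gs, ms).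
    \<Sum>k\<in>{1..n} \<rightarrow>\<^sub>E {0, 1::nat}. frag_cmul ((-1) ^ (\<Sum>i=1..n. k i))
      (frag_of (map (\<lambda>i. (ms ! i) \<triangleleft>\<^bsub>M\<^esub> frag_of (psi_word G \<phi> n gs k i)) [0..<Suc n])))"

definition psi_BR ::
    "('g, 'e) monoid_scheme \<Rightarrow> ('g \<Rightarrow>\<^sub>0 int, 'm, 'f) right_mod_scheme \<Rightarrow> ('g \<Rightarrow> 'g)
      \<Rightarrow> nat \<Rightarrow> ('g list \<times> 'm list \<Rightarrow>\<^sub>0 int) \<Rightarrow> ('m list \<Rightarrow>\<^sub>0 int) set"
  where "psi_BR G M \<phi> n c =
    gp_rel G M (n + 1) #>\<^bsub>gp_chains M (n + 1)\<^esub> frag_extend (psi_basis G M \<phi> n) c"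

definition Phi_chain ::
    "('g, 'e) monoid_scheme \<Rightarrow> ('g \<Rightarrow>\<^sub>0 int, 'm, 'f) right_mod_scheme \<Rightarrow> ('g \<Rightarrow> 'g)
      \<Rightarrow> ('a, 'h) ring_scheme \<Rightarrow> nat \<Rightarrow> ('m list \<Rightarrow> 'a) \<Rightarrow> (('m \<times> 'g) symb \<Rightarrow>\<^sub>0 int) \<Rightarrow> 'a"
  where "Phi_chain G M \<phi> A n f =
    on_quotient (linear_extension A f) \<circ> psi_BR G M \<phi> n \<circ> gamma_BR M n \<circ> proj_BR n"

definition Phi ::
    "('g, 'e) monoid_scheme \<Rightarrow> ('g \<Rightarrow>\<^sub>0 int, 'm, 'f) right_mod_scheme \<Rightarrow> ('g \<Rightarrow> 'g)
      \<Rightarrow> ('a, 'h) ring_scheme \<Rightarrow> nat \<Rightarrow> ('m list \<Rightarrow> 'a)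
      \<Rightarrow> (('m \<times> 'g) symb \<Rightarrow>\<^sub>0 int) set \<Rightarrow> 'a"
  where "Phi G M \<phi> A n f = on_quotient (Phi_chain G M \<phi> A n f)"

end

theory Submission
  imports Defs
begin

text \<open>
  For an invariant multilinear \<open>f\<close> of \<open>n + 1\<close> arguments, the cochain \<open>\<Phi>\<^sub>f\<close> on a symbol of singletons is a
  signed sum of values of \<open>f\<close> over the vertices \<open>k\<close> of an \<open>n\<close>-cube: at \<open>k\<close> the letters are \<open>e\<^sub>i = g\<^sub>i\<^bsup>k(i)\<^esup>\<close>,
  and the \<open>j\<close>-th difference coordinate \<open>u\<^sub>j\<close> is multiplied by \<open>\<phi>(e\<^sub>1...e\<^sub>j) e\<^sub>j\<^sub>+\<^sub>1...e\<^sub>n\<close>.  That it is a cocycle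
  on the quotient complex holds in every degree \<open>n \<ge> 2\<close>, for three reasons.

  \<^item> In the coboundary on \<open>n + 1\<close> singletons, the two faces in direction \<open>i\<close> are the two opposite facets of
    the \<open>(n+1)\<close>-cube in direction \<open>i\<close>, with the coordinates \<open>i - 1\<close> and \<open>i\<close> added up (\<open>psi_chain_face\<close>).  By
    multilinearity the alternating sum over \<open>i\<close> telescopes at each vertex (\<open>null_telescope\<close>), and the two
    remaining outer terms cancel between facets by \<open>G\<close>-invariance (\<open>psi_chain_cocycle\<close>).
  \<^item> If the symbol has a longer block, only the faces in a block of two entries of a symbol with \<open>n\<close> blocks survive
    the projection, and they cancel facet by facet (\<open>psi_chain_block\<close>, \<open>Psi_boundary_block\<close>).
  \<^item> A decomposition relation involves two adjacent entries in one group \<open>G\<^sub>m\<close>, whose difference coordinate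
    is \<open>0\<close>, so that \<open>f\<close> vanishes (\<open>Psi_D_generator_null\<close>).

  The explicit formulas come from dividing, at each vertex, by a factor common to all coordinates (\<open>vertex_2_normalized\<close>,
  \<open>vertex_3_normalized\<close>): afterwards the first and the last letter each affect a single argument, and
  the sum over these two directions is the expansion of a product of two differences (\<open>null_bilinear\<close>).
\<close>

section \<open>Homomorphisms out of quotients and free abelian groups\<close>

text \<open>A homomorphism that kills the generators of a subgroup has only one value on each coset, so
  picking "the" element of the image of a coset is legitimate.  Both quotients in the definition of
  \<open>\<Phi>\<^sub>f\<close>, the coinvariants and \<open>P\<^sub>n / D\<^sub>n\<close>, are handled by this.\<close>

lemma (in comm_group) on_quotient_generate:
  assumes S: "S \<subseteq> carrier G" and B: "Group.group B" and h: "h \<in> hom G B"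
    and S0: "\<And>s. s \<in> S \<Longrightarrow> h s = \<one>\<^bsub>B\<^esub>"
  shows on_quotient_coset:
      "c \<in> carrier G \<Longrightarrow> on_quotient h (generate G S #>\<^bsub>G\<^esub> c) = h c"
    and on_quotient_hom: "on_quotient h \<in> hom (G Mod generate G S) B"
proof -
  interpret B: Group.group B by fact
  interpret gh: group_hom G B h
    using h by unfold_locales
  let ?D = "generate G S"
  have D: "subgroup ?D G"
    by (rule generate_is_subgroup[OF S])
  have "?D \<subseteq> kernel G B h"
    by (rule generate_subgroup_incl[OF _ gh.subgroup_kernel]) (use S S0 in \<open>auto simp: kernel_def\<close>)
  then have D0: "d \<in> carrier G" "h d = \<one>\<^bsub>B\<^esub>" if "d \<in> ?D" for d
    using that by (auto simp: kernel_def)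
  have coset: "on_quotient h (?D #>\<^bsub>G\<^esub> c) = h c" if c: "c \<in> carrier G" for c
  proof -
    have "h ` (?D #>\<^bsub>G\<^esub> c) = (\<lambda>d. h c) ` ?D"
      using c D0 by (auto simp: r_coset_def image_iff)
    also have "\<dots> = {h c}"
      using subgroup.one_closed[OF D] by blast
    finally show ?thesis
      by (simp add: on_quotient_def)
  qed
  then show "c \<in> carrier G \<Longrightarrow> on_quotient h (?D #>\<^bsub>G\<^esub> c) = h c" .
  interpret N: normal ?D G
    by (rule subgroup_imp_normal[OF D])
  show "on_quotient h \<in> hom (G Mod ?D) B"
  proof (rule homI)
    fix U assume "U \<in> carrier (G Mod ?D)"
    then obtain c where "c \<in> carrier G" "U = ?D #>\<^bsub>G\<^esub> c"
      by (auto simp: FactGroup_def RCOSETS_def)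
    then show "on_quotient h U \<in> carrier B"
      using coset by simp
  next
    fix U V assume "U \<in> carrier (G Mod ?D)" "V \<in> carrier (G Mod ?D)"
    then obtain c d where cd: "c \<in> carrier G" "U = ?D #>\<^bsub>G\<^esub> c" "d \<in> carrier G" "V = ?D #>\<^bsub>G\<^esub> d"
      by (auto simp: FactGroup_def RCOSETS_def)
    then have "U \<otimes>\<^bsub>G Mod ?D\<^esub> V = ?D #>\<^bsub>G\<^esub> (c \<otimes>\<^bsub>G\<^esub> d)"
      by (simp add: FactGroup_def N.rcos_sum)
    then show "on_quotient h (U \<otimes>\<^bsub>G Mod ?D\<^esub> V) = on_quotient h U \<otimes>\<^bsub>B\<^esub> on_quotient h V"
      using cd coset by simp
  qed
qed

text \<open>Two chains have different supports; additivity is obvious only once both values are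
  written as sums over one common index set.\<close>

lemma linear_extension_superset:
  assumes "abelian_group A" "finite S" "Poly_Mapping.keys c \<subseteq> S" "f \<in> S \<rightarrow> carrier A"
  shows "linear_extension A f c = finsum A (\<lambda>s. [Poly_Mapping.lookup c s] \<cdot>\<^bsub>A\<^esub> f s) S"
proof -
  interpret A: abelian_group A by fact
  show ?thesis
    unfolding linear_extension_def
    by (rule A.add.finprod_mono_neutral_cong_left)
       (use assms in \<open>auto simp: in_keys_iff Pi_def add_pow_def intro!: group.int_pow_closed[OF A.a_group, simplified]\<close>)
qed

lemma linear_extension_frag_of:
  assumes "abelian_group A" "f s \<in> carrier A"
  shows "linear_extension A f (frag_of s) = f s"
proof -
  interpret A: abelian_group A by fact
  show ?thesis
    using assms(2) by (simp add: linear_extension_def keys_frag_of A.add.int_pow_1)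
qed

lemma linear_extension_hom:
  assumes A: "abelian_group A" and f: "f \<in> S \<rightarrow> carrier A"
  shows "linear_extension A f \<in> hom (free_Abelian_group S) (add_monoid A)"
proof (rule homI)
  interpret A: abelian_group A by fact
  fix c assume "c \<in> carrier (free_Abelian_group S)"
  then show "linear_extension A f c \<in> carrier (add_monoid A)"
    using f unfolding linear_extension_def
    by (auto intro!: A.finsum_closed A.add.int_pow_closed)
next
  interpret A: abelian_group A by fact
  fix c d assume "c \<in> carrier (free_Abelian_group S)" "d \<in> carrier (free_Abelian_group S)"
  then have cd: "Poly_Mapping.keys c \<subseteq> S" "Poly_Mapping.keys d \<subseteq> S" by simp_all
  let ?K = "Poly_Mapping.keys c \<union> Poly_Mapping.keys d"
  have fK: "f \<in> ?K \<rightarrow> carrier A" using cd f by auto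
  have "linear_extension A f (c + d)
      = finsum A (\<lambda>s. [Poly_Mapping.lookup (c + d) s] \<cdot>\<^bsub>A\<^esub> f s) ?K"
    by (rule linear_extension_superset[OF A]) (use keys_add[of c d] fK in auto)
  also have "\<dots> = finsum A (\<lambda>s. [Poly_Mapping.lookup c s] \<cdot>\<^bsub>A\<^esub> f s
      \<oplus>\<^bsub>A\<^esub> [Poly_Mapping.lookup d s] \<cdot>\<^bsub>A\<^esub> f s) ?K"
    using fK by (intro A.finsum_cong') (auto simp: lookup_add add_pow_def Pi_iff
        intro!: group.int_pow_mult[OF A.a_group, simplified] A.a_closed
          group.int_pow_closed[OF A.a_group, simplified])
  also have "\<dots> = finsum A (\<lambda>s. [Poly_Mapping.lookup c s] \<cdot>\<^bsub>A\<^esub> f s) ?K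
      \<oplus>\<^bsub>A\<^esub> finsum A (\<lambda>s. [Poly_Mapping.lookup d s] \<cdot>\<^bsub>A\<^esub> f s) ?K"
    using fK by (intro A.finsum_addf) auto
  also have "\<dots> = linear_extension A f c \<oplus>\<^bsub>A\<^esub> linear_extension A f d"
    using fK by (simp add: linear_extension_superset[OF A _ _ fK])
  finally show "linear_extension A f (c \<otimes>\<^bsub>free_Abelian_group S\<^esub> d)
      = linear_extension A f c \<otimes>\<^bsub>add_monoid A\<^esub> linear_extension A f d"
    by simp
qed

section \<open>Signed sums over the vertices of a cube\<close>

definition cube_sum :: "nat \<Rightarrow> ((nat \<Rightarrow> nat) \<Rightarrow> 's \<Rightarrow>\<^sub>0 int) \<Rightarrow> 's \<Rightarrow>\<^sub>0 int"
  where "cube_sum n h =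
    (\<Sum>k\<in>{1..n} \<rightarrow>\<^sub>E {0, 1::nat}. frag_cmul ((-1) ^ (\<Sum>i=1..n. k i)) (h k))"

definition insert_coord :: "nat \<Rightarrow> nat \<Rightarrow> nat \<Rightarrow> (nat \<Rightarrow> nat) \<Rightarrow> nat \<Rightarrow> nat"
  where "insert_coord n i c k =
    (\<lambda>j\<in>{1..Suc n}. if j < i then k j else if j = i then c else k (j - 1))"

lemma frag_cmul_diff_distrib2: "frag_cmul c (x - y) = frag_cmul c x - frag_cmul c y"
  by (metis add_diff_cancel_right' diff_add_cancel frag_cmul_distrib2)

lemma cube_sum_cong:
  "(\<And>k. k \<in> {1..n} \<rightarrow>\<^sub>E {0, 1} \<Longrightarrow> h k = h' k) \<Longrightarrow> cube_sum n h = cube_sum n h'"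
  by (simp add: cube_sum_def cong: sum.cong)

lemma cube_sum_diff: "cube_sum n (\<lambda>k. h k - h' k) = cube_sum n h - cube_sum n h'"
  by (simp add: cube_sum_def frag_cmul_diff_distrib2 sum_subtractf)

lemma cube_sum_cmul: "cube_sum n (\<lambda>k. frag_cmul c (h k)) = frag_cmul c (cube_sum n h)"
  by (simp add: cube_sum_def frag_cmul_sum mult.commute)

lemma cube_sum_sum: "cube_sum n (\<lambda>k. \<Sum>i\<in>I. h i k) = (\<Sum>i\<in>I. cube_sum n (h i))"
  unfolding cube_sum_def by (subst sum.swap) (simp add: frag_cmul_sum)

lemma cube_sum_0: "cube_sum 0 h = h (\<lambda>_. undefined)"
  by (simp add: cube_sum_def)

lemma sum_insert_coord:
  assumes "i \<in> {1..Suc n}"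
  shows "(\<Sum>j=1..Suc n. insert_coord n i c k j) = c + (\<Sum>j=1..n. k j)"
proof -
  have "(\<Sum>j=1..Suc n. insert_coord n i c k j)
      = c + (\<Sum>j\<in>{1..Suc n} - {i}. insert_coord n i c k j)"
    using assms by (subst sum.remove[of _ i]) (auto simp: insert_coord_def)
  also have "(\<Sum>j\<in>{1..Suc n} - {i}. insert_coord n i c k j) = (\<Sum>j=1..n. k j)"
    by (rule sum.reindex_bij_witness[where i = "\<lambda>j. if j < i then j else Suc j"
          and j = "\<lambda>j. if j < i then j else j - 1"])
       (use assms in \<open>auto simp: insert_coord_def\<close>)
  finally show ?thesis .
qed

lemma insert_coord_at [simp]: "i \<in> {1..Suc n} \<Longrightarrow> insert_coord n i c k i = c"
  by (simp add: insert_coord_def)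

text \<open>All cancellations between the \<open>2\<^sup>n\<close> terms of \<open>\<psi>\<^sub>n\<close> happen between the two facets of the cube that
  are opposite in one direction \<open>i\<close>.\<close>

lemma cube_sum_split:
  assumes i: "i \<in> {1..Suc n}"
  shows "cube_sum (Suc n) h
    = cube_sum n (\<lambda>k. h (insert_coord n i 0 k) - h (insert_coord n i 1 k))"
proof -
  let ?K = "\<lambda>n. {1..n} \<rightarrow>\<^sub>E {0, 1::nat}"
  let ?F = "\<lambda>k. frag_cmul ((-1) ^ (\<Sum>i=1..Suc n. k i)) (h k)"
  have "cube_sum (Suc n) h = (\<Sum>(c, k)\<in>{0, 1} \<times> ?K n. ?F (insert_coord n i c k))"
    unfolding cube_sum_def
  proof (rule sum.reindex_bij_witness[where i = "\<lambda>(c, k). insert_coord n i c k"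
        and j = "\<lambda>k. (k i, \<lambda>j\<in>{1..n}. if j < i then k j else k (Suc j))"])
    fix k assume k: "k \<in> ?K (Suc n)"
    show "(case (k i, \<lambda>j\<in>{1..n}. if j < i then k j else k (Suc j))
        of (c, k) \<Rightarrow> insert_coord n i c k) = k"
      using k i by (auto simp: insert_coord_def fun_eq_iff PiE_def extensional_def)
    then show "(case (k i, \<lambda>j\<in>{1..n}. if j < i then k j else k (Suc j))
        of (c, k) \<Rightarrow> ?F (insert_coord n i c k)) = ?F k"
      by simp
    show "(k i, \<lambda>j\<in>{1..n}. if j < i then k j else k (Suc j)) \<in> {0, 1} \<times> ?K n"
      using k i by (auto simp: PiE_iff)
  next
    fix p assume "p \<in> {0, 1::nat} \<times> ?K n"
    then obtain c k where p: "p = (c, k)" "c \<in> {0, 1}" "k \<in> ?K n" by auto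
    show "((case p of (c, k) \<Rightarrow> insert_coord n i c k) i, \<lambda>j\<in>{1..n}.
        if j < i then (case p of (c, k) \<Rightarrow> insert_coord n i c k) j
        else (case p of (c, k) \<Rightarrow> insert_coord n i c k) (Suc j)) = p"
      using p i by (auto simp: insert_coord_def fun_eq_iff PiE_def extensional_def)
    show "(case p of (c, k) \<Rightarrow> insert_coord n i c k) \<in> ?K (Suc n)"
    proof -
      have "k (j - 1) \<in> {0, 1}" if "i < j" "j \<le> Suc n" for j
        using p(3) i that by (intro PiE_mem[OF p(3)]) auto
      then have "insert_coord n i c k j \<in> {0, 1}" if "j \<in> {1..Suc n}" for j
        using p i that PiE_mem[OF p(3), of j] by (auto simp: insert_coord_def)
      then show ?thesis
        using p(1) by (auto simp: PiE_iff insert_coord_def)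
    qed
  qed
  also have "\<dots> = (\<Sum>k\<in>?K n. ?F (insert_coord n i 0 k)) + (\<Sum>k\<in>?K n. ?F (insert_coord n i 1 k))"
    by (simp add: sum.cartesian_product[symmetric])
  also have "\<dots> = cube_sum n (\<lambda>k. h (insert_coord n i 0 k) - h (insert_coord n i 1 k))"
    unfolding sum_insert_coord[OF i] cube_sum_diff by (simp add: cube_sum_def flip: sum_negf)
  finally show ?thesis .
qed

section \<open>Vertices of the cube spanned by group elements and coordinates\<close>

locale alexander_mcb =
  G: Group.group G + Mod: right_module "int_group_ring G" M
  for G :: "('g, 'e) monoid_scheme"
    and M :: "('g \<Rightarrow>\<^sub>0 int, 'm, 'f) right_mod_scheme" +
  fixes \<phi> :: "'g \<Rightarrow> 'g"
  assumes phi_hom: "\<phi> \<in> hom G (G\<lparr>carrier := group_center G\<rparr>)"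
begin

abbreviation group_act :: "'m \<Rightarrow> 'g \<Rightarrow> 'm" (infixl \<open>\<bullet>\<close> 75)
  where "m \<bullet> g \<equiv> m \<triangleleft>\<^bsub>M\<^esub> frag_of g"

abbreviation group_mult :: "'g \<Rightarrow> 'g \<Rightarrow> 'g" (infixl \<open>\<cdot>\<close> 76)
  where "g \<cdot> h \<equiv> g \<otimes>\<^bsub>G\<^esub> h"

lemma frag_of_ring: "g \<in> carrier G \<Longrightarrow> frag_of g \<in> carrier (int_group_ring G)"
  by (simp add: int_group_ring_def keys_frag_of)

lemma act_closed [simp]: "\<lbrakk>m \<in> carrier M; g \<in> carrier G\<rbrakk> \<Longrightarrow> m \<bullet> g \<in> carrier M"
  by (simp add: Mod.ract_closed frag_of_ring)

lemma act_mult: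
  "\<lbrakk>m \<in> carrier M; g \<in> carrier G; h \<in> carrier G\<rbrakk> \<Longrightarrow> m \<bullet> (g \<cdot> h) = (m \<bullet> g) \<bullet> h"
  using Mod.ract_mult[of m "frag_of g" "frag_of h"] frag_of_ring
  by (simp add: int_group_ring_def)

lemma act_one [simp]: "m \<in> carrier M \<Longrightarrow> m \<bullet> \<one>\<^bsub>G\<^esub> = m"
  using Mod.ract_one[of m] by (simp add: int_group_ring_def)

lemma act_add:
  "\<lbrakk>m \<in> carrier M; n \<in> carrier M; g \<in> carrier G\<rbrakk>
    \<Longrightarrow> (m \<oplus>\<^bsub>M\<^esub> n) \<bullet> g = m \<bullet> g \<oplus>\<^bsub>M\<^esub> n \<bullet> g"
  by (simp add: Mod.ract_add_left frag_of_ring)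

lemma act_diff:
  assumes "m \<in> carrier M" "n \<in> carrier M" "g \<in> carrier G"
  shows "(m \<ominus>\<^bsub>M\<^esub> n) \<bullet> g = m \<bullet> g \<ominus>\<^bsub>M\<^esub> n \<bullet> g"
proof -
  have "(m \<ominus>\<^bsub>M\<^esub> n) \<bullet> g \<oplus>\<^bsub>M\<^esub> n \<bullet> g = m \<bullet> g"
    using assms act_add[of "m \<ominus>\<^bsub>M\<^esub> n" n g]
    by (simp add: Mod.M.minus_eq Mod.M.a_assoc Mod.M.l_neg)
  then show ?thesis
    using assms by (metis Mod.M.add.inv_solve_right Mod.M.minus_eq Mod.M.minus_closed act_closed)
qed

lemma act_frag_diff:
  assumes "m \<in> carrier M" "g \<in> carrier G" "h \<in> carrier G"
  shows "m \<triangleleft>\<^bsub>M\<^esub> (frag_of g - frag_of h) = m \<bullet> g \<ominus>\<^bsub>M\<^esub> m \<bullet> h"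
proof -
  have c: "frag_of g - frag_of h \<in> carrier (int_group_ring G)"
    using assms keys_diff[of "frag_of g" "frag_of h"]
    by (auto simp: int_group_ring_def keys_frag_of)
  have "m \<triangleleft>\<^bsub>M\<^esub> (frag_of g - frag_of h) \<oplus>\<^bsub>M\<^esub> m \<bullet> h = m \<bullet> g"
    using assms Mod.ract_add_right[OF _ c, of m "frag_of h"] frag_of_ring
    by (simp add: int_group_ring_def)
  then show ?thesis
    using assms c
    by (metis Mod.M.add.inv_solve_right Mod.M.minus_eq Mod.ract_closed act_closed)
qed

lemma phi_center: "g \<in> carrier G \<Longrightarrow> \<phi> g \<in> group_center G"
  using phi_hom by (auto simp: hom_def)

lemma phi_closed [simp]: "g \<in> carrier G \<Longrightarrow> \<phi> g \<in> carrier G"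
  using phi_center by (simp add: group_center_def)

lemma phi_comm: "\<lbrakk>g \<in> carrier G; h \<in> carrier G\<rbrakk> \<Longrightarrow> \<phi> g \<cdot> h = h \<cdot> \<phi> g"
  using phi_center by (simp add: group_center_def)

lemma phi_mult: "\<lbrakk>g \<in> carrier G; h \<in> carrier G\<rbrakk> \<Longrightarrow> \<phi> (g \<cdot> h) = \<phi> g \<cdot> \<phi> h"
  using phi_hom by (simp add: hom_def)

lemma phi_one [simp]: "\<phi> \<one>\<^bsub>G\<^esub> = \<one>\<^bsub>G\<^esub>"
  using phi_mult[of "\<one>\<^bsub>G\<^esub>" "\<one>\<^bsub>G\<^esub>"] by simp

lemma phi_inv: "g \<in> carrier G \<Longrightarrow> \<phi> (inv\<^bsub>G\<^esub> g) = inv\<^bsub>G\<^esub> (\<phi> g)"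
  using phi_mult[of "inv\<^bsub>G\<^esub> g" g] by (intro G.inv_equality[symmetric]) simp_all

lemma phi_conj:
  assumes "g \<in> carrier G" "h \<in> carrier G"
  shows "\<phi> (inv\<^bsub>G\<^esub> h \<cdot> g \<cdot> h) = \<phi> g"
proof -
  have "\<phi> (inv\<^bsub>G\<^esub> h \<cdot> g \<cdot> h) = \<phi> h \<cdot> (\<phi> (inv\<^bsub>G\<^esub> h) \<cdot> \<phi> g)"
    using assms by (simp add: phi_mult flip: phi_comm[of h])
  then show ?thesis
    using assms by (simp add: phi_inv flip: G.m_assoc)
qed

definition word :: "(nat \<Rightarrow> 'g) \<Rightarrow> nat \<Rightarrow> nat \<Rightarrow> 'g"
  where "word e a b = foldr (\<lambda>i w. e i \<cdot> w) [a..<Suc b] \<one>\<^bsub>G\<^esub>"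

lemma word_empty [simp]: "b < a \<Longrightarrow> word e a b = \<one>\<^bsub>G\<^esub>"
  by (simp add: word_def)

lemma word_Cons: "a \<le> b \<Longrightarrow> word e a b = e a \<cdot> word e (Suc a) b"
  by (simp add: word_def upt_rec[of a "Suc b"] del: upt_Suc)

lemma word_cong:
  "(\<And>i. \<lbrakk>a \<le> i; i \<le> b\<rbrakk> \<Longrightarrow> e i = e' i) \<Longrightarrow> word e a b = word e' a b"
  unfolding word_def by (rule foldr_cong) auto

lemma word_closed [simp]:
  assumes "\<And>i. \<lbrakk>a \<le> i; i \<le> b\<rbrakk> \<Longrightarrow> e i \<in> carrier G"
  shows "word e a b \<in> carrier G"
proof (cases "a \<le> Suc b")
  case True
  then show ?thesis using assms
    by (induction a rule: inc_induct) (simp_all add: word_Cons[of _ b])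
qed simp

lemma word_shift: "word e (Suc a) (Suc b) = word (\<lambda>i. e (Suc i)) a b"
  unfolding word_def map_Suc_upt[symmetric] foldr_map by (simp add: comp_def)

lemma word_snoc:
  assumes "a \<le> Suc b" "\<And>i. \<lbrakk>a \<le> i; i \<le> Suc b\<rbrakk> \<Longrightarrow> e i \<in> carrier G"
  shows "word e a (Suc b) = word e a b \<cdot> e (Suc b)"
  using assms
proof (induction a rule: inc_induct)
  case base
  then show ?case by (simp add: word_Cons[of "Suc b" "Suc b"])
next
  case (step a)
  then show ?case by (simp add: word_Cons[of a] G.m_assoc)
qed

text \<open>In a face of a symbol, the entry at position \<open>i\<close>, with group component \<open>x\<close>, conjugates the
  group components before it, and inside a block it divides the following one from the left.
  Together these two effects divide by \<open>x\<close> from the left any product of consecutive letters that includes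
  the one at \<open>i\<close>, because the inner factors of the conjugates cancel.\<close>

definition twist :: "'g \<Rightarrow> nat \<Rightarrow> (nat \<Rightarrow> 'g) \<Rightarrow> nat \<Rightarrow> 'g"
  where "twist x i e =
    (\<lambda>l. if l < i then inv\<^bsub>G\<^esub> x \<cdot> e l \<cdot> x else if l = i then inv\<^bsub>G\<^esub> x \<cdot> e l else e l)"

lemma twist_closed [simp]: "\<lbrakk>x \<in> carrier G; e l \<in> carrier G\<rbrakk> \<Longrightarrow> twist x i e l \<in> carrier G"
  by (auto simp: twist_def)

lemma mult_word_twist:
  assumes "a \<le> i" "i \<le> b" "x \<in> carrier G" "\<And>l. \<lbrakk>a \<le> l; l \<le> b\<rbrakk> \<Longrightarrow> e l \<in> carrier G"
  shows "x \<cdot> word (twist x i e) a b = word e a b"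
  using assms
proof (induction a rule: inc_induct)
  case base
  have "word (twist x i e) (Suc i) b = word e (Suc i) b"
    by (rule word_cong) (simp add: twist_def)
  with base show ?case
    by (simp add: word_Cons[of i b] twist_def flip: G.m_assoc)
next
  case (step a)
  let ?w = "word (twist x i e) (Suc a) b"
  have w: "?w \<in> carrier G" using step.prems by simp
  have "x \<cdot> word (twist x i e) a b = e a \<cdot> (x \<cdot> ?w)"
    using step.prems step.hyps w by (simp add: word_Cons[of a b] twist_def flip: G.m_assoc)
  then show ?case
    using step by (simp add: word_Cons[of a b])
qed

lemma word_twist_before:
  assumes "b < i" "x \<in> carrier G" "\<And>l. \<lbrakk>a \<le> l; l \<le> b\<rbrakk> \<Longrightarrow> e l \<in> carrier G"
  shows "word (twist x i e) a b = inv\<^bsub>G\<^esub> x \<cdot> word e a b \<cdot> x"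
proof (cases "a \<le> Suc b")
  case True
  then show ?thesis using assms
  proof (induction a rule: inc_induct)
    case (step a)
    let ?w = "word e (Suc a) b"
    have w: "?w \<in> carrier G" using step.prems by simp
    have "x \<cdot> (inv\<^bsub>G\<^esub> x \<cdot> z) = z" if "z \<in> carrier G" for z
      using that step.prems by (simp flip: G.m_assoc)
    then show ?case
      using step w by (simp add: word_Cons[of a b] twist_def G.m_assoc)
  qed simp
qed (use assms in simp)

lemma word_delete_one:
  assumes "a \<le> i" "i \<le> Suc b" "e i = \<one>\<^bsub>G\<^esub>" "\<And>l. \<lbrakk>a \<le> l; l \<le> Suc b\<rbrakk> \<Longrightarrow> e l \<in> carrier G"
  shows "word e a (Suc b) = word (\<lambda>l. if l < i then e l else e (Suc l)) a b"
  using assms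
proof (induction a rule: inc_induct)
  case base
  have "word e (Suc i) (Suc b) = word (\<lambda>l. if l < i then e l else e (Suc l)) i b"
    unfolding word_shift by (rule word_cong) simp
  with base show ?case
    by (simp add: word_Cons[of i "Suc b"])
next
  case (step a)
  then show ?case
    by (simp add: word_Cons[of a "Suc b"] word_Cons[of a b])
qed

text \<open>For the letters \<open>e\<^sub>l = g\<^sub>l\<^bsup>k(l)\<^esup>\<close> these are the group elements \<open>\<^bold>g\<^sub>k\<^sub>,\<^sub>j\<close> in the definition of \<open>\<psi>\<^sub>n\<close>.
  The case \<open>j = 0\<close> is not special, because \<open>\<phi>\<close> of the empty word is the identity.\<close>

definition vertex_word :: "(nat \<Rightarrow> 'g) \<Rightarrow> nat \<Rightarrow> nat \<Rightarrow> 'g"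
  where "vertex_word e n j = \<phi> (word e 1 j) \<cdot> word e (Suc j) n"

definition vertex :: "nat \<Rightarrow> (nat \<Rightarrow> 'g) \<Rightarrow> (nat \<Rightarrow> 'm) \<Rightarrow> 'm list"
  where "vertex n e u = map (\<lambda>j. u j \<bullet> vertex_word e n j) [0..<Suc n]"

lemma vertex_word_closed [simp]:
  "\<lbrakk>j \<le> n; \<And>l. \<lbrakk>1 \<le> l; l \<le> n\<rbrakk> \<Longrightarrow> e l \<in> carrier G\<rbrakk> \<Longrightarrow> vertex_word e n j \<in> carrier G"
  by (simp add: vertex_word_def)

lemma vertex_word_cong:
  "\<lbrakk>j \<le> n; \<And>l. \<lbrakk>1 \<le> l; l \<le> n\<rbrakk> \<Longrightarrow> e l = e' l\<rbrakk> \<Longrightarrow> vertex_word e n j = vertex_word e' n j"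
  unfolding vertex_word_def
  by (intro arg_cong2[where f = "\<lambda>p q. \<phi> p \<cdot> q"] word_cong) auto

lemma vertex_cong:
  "\<lbrakk>\<And>l. \<lbrakk>1 \<le> l; l \<le> n\<rbrakk> \<Longrightarrow> e l = e' l; \<And>j. j \<le> n \<Longrightarrow> u j = u' j\<rbrakk> \<Longrightarrow> vertex n e u = vertex n e' u'"
  unfolding vertex_def using vertex_word_cong[of _ n e e'] by auto

text \<open>Exactly one of the two factors of a vertex word contains the letter at \<open>i\<close>.  If it is the
  second one, the first is unchanged because \<open>\<phi>\<close> does not see conjugation; if it is the first one,
  the division by \<open>x\<close> becomes a division by \<open>\<phi> x\<close>.\<close>

lemma vertex_word_twist:
  assumes i: "1 \<le> i" "i \<le> n" and x: "x \<in> carrier G" and j: "j \<le> n"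
    and e: "\<And>l. \<lbrakk>1 \<le> l; l \<le> n\<rbrakk> \<Longrightarrow> e l \<in> carrier G"
  shows "(if j < i then x else \<phi> x) \<cdot> vertex_word (twist x i e) n j = vertex_word e n j"
proof (cases "j < i")
  case True
  have "\<phi> (word (twist x i e) 1 j) = \<phi> (word e 1 j)"
    using True i x e by (simp add: word_twist_before phi_conj)
  moreover have "x \<cdot> word (twist x i e) (Suc j) n = word e (Suc j) n"
    by (rule mult_word_twist) (use True i x e in auto)
  moreover have "x \<cdot> (\<phi> p \<cdot> q) = \<phi> p \<cdot> (x \<cdot> q)" if "p \<in> carrier G" "q \<in> carrier G" for p q
    using that x by (simp add: phi_comm[of p x] flip: G.m_assoc)
  ultimately show ?thesis
    using True i x e by (simp add: vertex_word_def)
next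
  case False
  have "x \<cdot> word (twist x i e) 1 j = word e 1 j"
    by (rule mult_word_twist) (use False i x e j in auto)
  moreover have "word (twist x i e) (Suc j) n = word e (Suc j) n"
    by (rule word_cong) (use False in \<open>simp add: twist_def\<close>)
  moreover have "\<phi> x \<cdot> \<phi> (word (twist x i e) 1 j) = \<phi> (x \<cdot> word (twist x i e) 1 j)"
    using False i x e j by (simp add: phi_mult)
  ultimately show ?thesis
    using False i x e j by (simp add: vertex_word_def flip: G.m_assoc)
qed

text \<open>How acting with an element whose group component is \<open>x\<close>, at position \<open>i\<close>, changes the
  difference coordinates \<open>m\<^sub>j - m\<^sub>j\<^sub>+\<^sub>1\<close>: the operation \<open>mcb_under\<close> multiplies differences before \<open>i\<close> by \<open>x\<close>,
  and \<open>mcb_over\<close> multiplies those after it by \<open>\<phi> x\<close>.\<close>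

definition scale :: "'g \<Rightarrow> nat \<Rightarrow> (nat \<Rightarrow> 'm) \<Rightarrow> nat \<Rightarrow> 'm"
  where "scale x i u = (\<lambda>j. if j < i then u j \<bullet> x else u j \<bullet> \<phi> x)"

lemma scale_closed [simp]: "\<lbrakk>x \<in> carrier G; u j \<in> carrier M\<rbrakk> \<Longrightarrow> scale x i u j \<in> carrier M"
  by (simp add: scale_def)

lemma scale_vertex_word_twist:
  assumes i: "1 \<le> i" "i \<le> n" and x: "x \<in> carrier G" and j: "j \<le> n"
    and e: "\<And>l. \<lbrakk>1 \<le> l; l \<le> n\<rbrakk> \<Longrightarrow> e l \<in> carrier G" and u: "u j \<in> carrier M"
  shows "scale x i u j \<bullet> vertex_word (twist x i e) n j = u j \<bullet> vertex_word e n j"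
  using vertex_word_twist[OF i x j e] j e u x by (auto simp: scale_def simp flip: act_mult)

text \<open>The factor that the coordinates gain is the factor that the vertex words lose.\<close>

lemma vertex_twist:
  assumes i: "1 \<le> i" "i \<le> n" and x: "x \<in> carrier G"
    and e: "\<And>l. \<lbrakk>1 \<le> l; l \<le> n\<rbrakk> \<Longrightarrow> e l \<in> carrier G"
    and u: "\<And>j. j \<le> n \<Longrightarrow> u j \<in> carrier M"
  shows "vertex n (twist x i e) (scale x i u) = vertex n e u"
  using scale_vertex_word_twist[OF i x _ e u] by (auto simp: vertex_def)

text \<open>When the \<open>i\<close>-th element is left out of a list, the two differences it takes part in are
  replaced by their sum; this is the inner face map of the group complex.\<close>

definition merge :: "nat \<Rightarrow> (nat \<Rightarrow> 'm) \<Rightarrow> nat \<Rightarrow> 'm"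
  where "merge i u =
    (\<lambda>j. if Suc j < i then u j else if Suc j = i then u j \<oplus>\<^bsub>M\<^esub> u i else u (Suc j))"

lemma vertex_word_delete_one:
  assumes i: "1 \<le> i" "i \<le> Suc n" and j: "j \<le> Suc n" and ei: "e i = \<one>\<^bsub>G\<^esub>"
    and e: "\<And>l. \<lbrakk>1 \<le> l; l \<le> Suc n\<rbrakk> \<Longrightarrow> e l \<in> carrier G"
  shows "vertex_word e (Suc n) j
    = vertex_word (\<lambda>l. if l < i then e l else e (Suc l)) n (if j < i then j else j - 1)"
proof (cases "j < i")
  case True
  let ?d = "\<lambda>l. if l < i then e l else e (Suc l)"
  have "word e 1 j = word ?d 1 j"
    by (rule word_cong) (use True in simp)
  moreover have "word e (Suc j) (Suc n) = word ?d (Suc j) n"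
    by (rule word_delete_one) (use True i ei e in auto)
  ultimately show ?thesis using True by (simp add: vertex_word_def)
next
  case False
  let ?d = "\<lambda>l. if l < i then e l else e (Suc l)"
  from False i obtain j' where j': "j = Suc j'" by (cases j) auto
  have "word e 1 (Suc j') = word ?d 1 j'"
    by (rule word_delete_one) (use False i ei e j j' in auto)
  moreover have "word e (Suc (Suc j')) (Suc n) = word ?d (Suc j') n"
    unfolding word_shift by (rule word_cong) (use False j' in auto)
  ultimately show ?thesis using False j' by (simp add: vertex_word_def)
qed

text \<open>If the letter at \<open>i\<close> is the identity, the vertex words at \<open>i - 1\<close> and \<open>i\<close> agree, so acting with
  them commutes with adding the two coordinates.\<close>

lemma vertex_delete_one:
  assumes i: "1 \<le> i" "i \<le> Suc n" and ei: "e i = \<one>\<^bsub>G\<^esub>"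
    and e: "\<And>l. \<lbrakk>1 \<le> l; l \<le> Suc n\<rbrakk> \<Longrightarrow> e l \<in> carrier G"
    and u: "\<And>j. j \<le> Suc n \<Longrightarrow> u j \<in> carrier M"
  shows "vertex n (\<lambda>l. if l < i then e l else e (Suc l)) (merge i u)
    = map (merge i (\<lambda>j. u j \<bullet> vertex_word e (Suc n) j)) [0..<Suc n]"
proof -
  let ?d = "\<lambda>l. if l < i then e l else e (Suc l)"
  have "merge i u j \<bullet> vertex_word ?d n j
      = merge i (\<lambda>j. u j \<bullet> vertex_word e (Suc n) j) j" if j: "j \<le> n" for j
  proof -
    have W: "vertex_word ?d n j \<in> carrier G"
      by (rule vertex_word_closed) (use j i e in auto)
    have 1: "vertex_word e (Suc n) j = vertex_word ?d n j" if "j < i"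
      using vertex_word_delete_one[where e = e and j = j, OF i _ ei e] j that by simp
    have 2: "vertex_word e (Suc n) (Suc j) = vertex_word ?d n j" if "i \<le> Suc j"
      using vertex_word_delete_one[where e = e and j = "Suc j", OF i _ ei e] j that by simp
    show ?thesis
      using 1 2 W i j u by (auto simp: merge_def act_add)
  qed
  then show ?thesis by (auto simp: vertex_def)
qed

definition psi_chain :: "nat \<Rightarrow> (nat \<Rightarrow> 'g) \<Rightarrow> (nat \<Rightarrow> 'm) \<Rightarrow> 'm list \<Rightarrow>\<^sub>0 int"
  where "psi_chain n g u = cube_sum n (\<lambda>k. frag_of (vertex n (\<lambda>l. g l [^]\<^bsub>G\<^esub> k l) u))"

lemma psi_chain_cong:
  "\<lbrakk>\<And>l. \<lbrakk>1 \<le> l; l \<le> n\<rbrakk> \<Longrightarrow> g l = g' l; \<And>j. j \<le> n \<Longrightarrow> u j = u' j\<rbrakk>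
    \<Longrightarrow> psi_chain n g u = psi_chain n g' u'"
  unfolding psi_chain_def
  by (intro cube_sum_cong arg_cong[where f = frag_of] vertex_cong) auto

definition face_group :: "'g \<Rightarrow> nat \<Rightarrow> (nat \<Rightarrow> 'g) \<Rightarrow> nat \<Rightarrow> 'g"
  where "face_group z i g = (\<lambda>l. if l < i then inv\<^bsub>G\<^esub> z \<cdot> g l \<cdot> z else g (Suc l))"

text \<open>The two faces of an \<open>(n+1)\<close>-simplex in direction \<open>i\<close> correspond to the two opposite facets
  \<open>k\<^sub>i = 0\<close> and \<open>k\<^sub>i = 1\<close> of the \<open>(n+1)\<close>-cube: for \<open>z = g\<^sub>i\<^bsup>c\<^esup>\<close> the right-hand side runs over the
  facet \<open>k\<^sub>i = c\<close>.  Twisting by \<open>z\<close> turns the frozen letter \<open>z\<close> at position \<open>i\<close> into the identity, which can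
  then be deleted.\<close>

lemma psi_chain_face:
  assumes i: "1 \<le> i" "i \<le> Suc n" and z: "z \<in> carrier G"
    and g: "\<And>l. \<lbrakk>1 \<le> l; l \<le> Suc n\<rbrakk> \<Longrightarrow> g l \<in> carrier G"
    and u: "\<And>j. j \<le> Suc n \<Longrightarrow> u j \<in> carrier M"
  shows "psi_chain n (face_group z i g) (merge i (scale z i u))
    = cube_sum n (\<lambda>k. frag_of (map (merge i (\<lambda>j. u j \<bullet>
        vertex_word (\<lambda>l. if l = i then z else g l [^]\<^bsub>G\<^esub> insert_coord n i c k l) (Suc n) j))
        [0..<Suc n]))"
  unfolding psi_chain_def
proof (intro cube_sum_cong arg_cong[where f = frag_of])
  fix k assume k: "k \<in> {1..n} \<rightarrow>\<^sub>E {0, 1::nat}"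
  define e where "e = (\<lambda>l. if l = i then z else g l [^]\<^bsub>G\<^esub> insert_coord n i c k l)"
  let ?t = "twist z i e"
  have e: "e l \<in> carrier G" if "1 \<le> l" "l \<le> Suc n" for l
    using that g z by (simp add: e_def)
  have "vertex n (\<lambda>l. face_group z i g l [^]\<^bsub>G\<^esub> k l) (merge i (scale z i u))
      = vertex n (\<lambda>l. if l < i then ?t l else ?t (Suc l)) (merge i (scale z i u))"
  proof (rule vertex_cong[OF _ refl])
    fix l assume l: "1 \<le> l" "l \<le> n"
    then have "k l = 0 \<or> k l = 1" using PiE_mem[OF k, of l] by auto
    then show "face_group z i g l [^]\<^bsub>G\<^esub> k l = (if l < i then ?t l else ?t (Suc l))"
      using l i z g[of l] g[of "Suc l"]
      by (auto simp: face_group_def twist_def e_def insert_coord_def)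
  qed
  also have "\<dots> = map (merge i (\<lambda>j. scale z i u j \<bullet> vertex_word ?t (Suc n) j)) [0..<Suc n]"
    by (rule vertex_delete_one) (use i z g u in \<open>auto simp: twist_def e_def\<close>)
  also have "\<dots> = map (merge i (\<lambda>j. u j \<bullet> vertex_word e (Suc n) j)) [0..<Suc n]"
  proof (rule map_cong[OF refl])
    fix j assume "j \<in> set [0..<Suc n]"
    then have "j \<le> n" by auto
    then show "merge i (\<lambda>j. scale z i u j \<bullet> vertex_word ?t (Suc n) j) j
        = merge i (\<lambda>j. u j \<bullet> vertex_word e (Suc n) j) j"
      using scale_vertex_word_twist[OF i z _ e u] i by (auto simp: merge_def)
  qed
  finally show "vertex n (\<lambda>l. face_group z i g l [^]\<^bsub>G\<^esub> k l) (merge i (scale z i u))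
      = map (merge i (\<lambda>j. u j \<bullet> vertex_word
          (\<lambda>l. if l = i then z else g l [^]\<^bsub>G\<^esub> insert_coord n i c k l) (Suc n) j)) [0..<Suc n]"
    by (simp add: e_def)
qed

text \<open>This is what makes a block \<open>\<langle>a, b\<rangle>\<close> contribute nothing to the coboundary.  Untwisting the left-hand
  side, the letter at \<open>i\<close> is \<open>a\<close> on the facet \<open>k\<^sub>i = 0\<close> and \<open>a (a\<^sup>-\<^sup>1 b) = b\<close> on the facet \<open>k\<^sub>i = 1\<close>.
  On the right-hand side the facets \<open>k\<^sub>i = 0\<close> of the two terms cancel, and the same two facets remain.\<close>

lemma psi_chain_block:
  assumes i: "1 \<le> i" "i \<le> n" and a: "a \<in> carrier G" and b: "b \<in> carrier G"
    and g: "\<And>l. \<lbrakk>1 \<le> l; l \<le> n\<rbrakk> \<Longrightarrow> g l \<in> carrier G"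
    and u: "\<And>j. j \<le> n \<Longrightarrow> u j \<in> carrier M"
  shows "psi_chain n (twist a i (g(i := b))) (scale a i u)
    = psi_chain n (g(i := b)) u - psi_chain n (g(i := a)) u"
proof -
  \<comment> \<open>The contribution of the vertex \<open>k\<close> when its letter at \<open>i\<close> is replaced by \<open>x\<close>.\<close>
  define V where "V x k = frag_of (vertex n (\<lambda>l. if l = i then x else g l [^]\<^bsub>G\<^esub> k l) u)"
    for x and k :: "nat \<Rightarrow> nat"
  have two: "k l = 0 \<or> k l = 1" if "k \<in> {1..n} \<rightarrow>\<^sub>E {0, 1::nat}" "1 \<le> l" "l \<le> n" for k l
    using PiE_mem[OF that(1), of l] that by auto
  have upd: "psi_chain n (g(i := x)) u = cube_sum n (\<lambda>k. if k i = 0 then V \<one>\<^bsub>G\<^esub> k else V x k)"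
    if x: "x \<in> carrier G" for x
    unfolding psi_chain_def
  proof (rule cube_sum_cong)
    fix k assume "k \<in> {1..n} \<rightarrow>\<^sub>E {0, 1::nat}"
    then show "frag_of (vertex n (\<lambda>l. (g(i := x)) l [^]\<^bsub>G\<^esub> k l) u)
        = (if k i = 0 then V \<one>\<^bsub>G\<^esub> k else V x k)"
      using two[of k i] i x
      by (auto simp: V_def intro!: arg_cong[where f = frag_of] vertex_cong)
  qed
  have tw: "psi_chain n (twist a i (g(i := b))) (scale a i u)
      = cube_sum n (\<lambda>k. if k i = 0 then V a k else V b k)"
    unfolding psi_chain_def
  proof (rule cube_sum_cong)
    fix k assume k: "k \<in> {1..n} \<rightarrow>\<^sub>E {0, 1::nat}"
    define e where "e = (\<lambda>l. if l = i then if k i = 0 then a else b else g l [^]\<^bsub>G\<^esub> k l)"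
    have e: "e l \<in> carrier G" if "1 \<le> l" "l \<le> n" for l
      using that g a b by (simp add: e_def)
    have "vertex n (\<lambda>l. twist a i (g(i := b)) l [^]\<^bsub>G\<^esub> k l) (scale a i u)
        = vertex n (twist a i e) (scale a i u)"
    proof (rule vertex_cong[OF _ refl])
      fix l assume l: "1 \<le> l" "l \<le> n"
      show "twist a i (g(i := b)) l [^]\<^bsub>G\<^esub> k l = twist a i e l"
        using two[OF k l] l a b g[OF l] by (auto simp: twist_def e_def)
    qed
    also have "\<dots> = vertex n e u"
      by (rule vertex_twist[OF i a e u])
    finally show "frag_of (vertex n (\<lambda>l. twist a i (g(i := b)) l [^]\<^bsub>G\<^esub> k l) (scale a i u))
        = (if k i = 0 then V a k else V b k)"
      by (auto simp: V_def e_def)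
  qed
  obtain m where n: "n = Suc m" using i by (cases n) auto
  have Vins: "V x (insert_coord m i c k) = V x (insert_coord m i c' k)" for x c c' k
    unfolding V_def using i n
    by (intro arg_cong[where f = frag_of] vertex_cong) (auto simp: insert_coord_def)
  have "cube_sum n (\<lambda>k. (if k i = 0 then V a k else V b k)
      - ((if k i = 0 then V \<one>\<^bsub>G\<^esub> k else V b k) - (if k i = 0 then V \<one>\<^bsub>G\<^esub> k else V a k)))
    = cube_sum m (\<lambda>k. 0)"
    unfolding n
    by (subst cube_sum_split[of i])
       (use i n in \<open>auto simp: Vins[of _ 0 _ 1] intro!: cube_sum_cong\<close>)
  then show ?thesis
    unfolding tw upd[OF a] upd[OF b] by (simp add: cube_sum_diff) (simp add: cube_sum_def)
qed

end

section \<open>Chains killed by an invariant multilinear map\<close>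

lemma tuples_update: "\<lbrakk>ms \<in> tuples S n; x \<in> S\<rbrakk> \<Longrightarrow> ms[i := x] \<in> tuples S n"
  by (auto simp: tuples_def dest: set_update_subset_insert[THEN subsetD])

locale multilinear_cochain =
  alexander_mcb G M \<phi> + A: abelian_group A
  for G :: "('g, 'e) monoid_scheme"
    and M :: "('g \<Rightarrow>\<^sub>0 int, 'm, 'f) right_mod_scheme"
    and \<phi> :: "'g \<Rightarrow> 'g"
    and A :: "('a, 'h) ring_scheme" +
  fixes n :: nat and f :: "'m list \<Rightarrow> 'a"
  assumes multilinear: "multilinear_map (Suc n) M A f"
    and invariant: "G_invariant (Suc n) G M f"
begin

abbreviation "T \<equiv> tuples (carrier M) (Suc n)"

abbreviation "L \<equiv> linear_extension A f"

text \<open>Identities between values of \<open>f\<close> are proved as identities between chains modulo the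
  kernel of the linear extension of \<open>f\<close>.  The kernel is closed under signed sums, so the combinatorics
  takes place in the additive group of chains and not in the carrier of \<open>A\<close>.\<close>

definition null_chains :: "('m list \<Rightarrow>\<^sub>0 int) set"
  where "null_chains = kernel (free_Abelian_group T) (add_monoid A) L"

lemma f_closed: "f \<in> T \<rightarrow> carrier A"
  using multilinear by (simp add: multilinear_map_def)

lemma L_hom: "L \<in> hom (free_Abelian_group T) (add_monoid A)"
  by (rule linear_extension_hom[OF A.abelian_group_axioms f_closed])

lemma L_group_hom: "group_hom (free_Abelian_group T) (add_monoid A) L"
  by (rule group_hom.intro[OF group_free_Abelian_group A.a_group])
     (simp add: group_hom_axioms_def L_hom)

lemma L_frag_of: "ms \<in> T \<Longrightarrow> L (frag_of ms) = f ms"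
  using f_closed by (auto intro: linear_extension_frag_of[OF A.abelian_group_axioms])

lemma L_closed: "Poly_Mapping.keys c \<subseteq> T \<Longrightarrow> L c \<in> carrier A"
  using group_hom.hom_closed[OF L_group_hom, of c] by simp

lemma L_add:
  "\<lbrakk>Poly_Mapping.keys c \<subseteq> T; Poly_Mapping.keys d \<subseteq> T\<rbrakk> \<Longrightarrow> L (c + d) = L c \<oplus>\<^bsub>A\<^esub> L d"
  using hom_mult[OF L_hom, of c d] by simp

lemma L_diff:
  assumes "Poly_Mapping.keys c \<subseteq> T" "Poly_Mapping.keys d \<subseteq> T"
  shows "L (c - d) = L c \<ominus>\<^bsub>A\<^esub> L d"
proof -
  have k: "Poly_Mapping.keys (c - d) \<subseteq> T"
    using assms keys_diff[of c d] by blast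
  have "L c = L (c - d) \<oplus>\<^bsub>A\<^esub> L d"
    using L_add[OF k assms(2)] by simp
  then show ?thesis
    using assms k by (simp add: A.minus_eq A.a_assoc A.r_neg L_closed)
qed

lemma null_subgroup: "subgroup null_chains (free_Abelian_group T)"
  unfolding null_chains_def by (rule group_hom.subgroup_kernel[OF L_group_hom])

lemma null_iff: "c \<in> null_chains \<longleftrightarrow> Poly_Mapping.keys c \<subseteq> T \<and> L c = \<zero>\<^bsub>A\<^esub>"
  by (simp add: null_chains_def kernel_def)

lemma null_zero [simp]: "0 \<in> null_chains"
  using subgroup.one_closed[OF null_subgroup] by simp

lemma null_add: "\<lbrakk>c \<in> null_chains; d \<in> null_chains\<rbrakk> \<Longrightarrow> c + d \<in> null_chains"
  using subgroup.m_closed[OF null_subgroup] by simp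

lemma null_minus: "c \<in> null_chains \<Longrightarrow> - c \<in> null_chains"
  using subgroup.m_inv_closed[OF null_subgroup, of c] by (simp add: null_iff)

lemma null_diff: "\<lbrakk>c \<in> null_chains; d \<in> null_chains\<rbrakk> \<Longrightarrow> c - d \<in> null_chains"
  using null_add[of c "- d"] null_minus[of d] by simp

lemma null_sum: "(\<And>i. i \<in> I \<Longrightarrow> c i \<in> null_chains) \<Longrightarrow> sum c I \<in> null_chains"
  by (induction I rule: infinite_finite_induct) (auto intro: null_add)

lemma null_cmul: "c \<in> null_chains \<Longrightarrow> frag_cmul k c \<in> null_chains"
  using group.subgroup_int_pow_closed[OF group_free_Abelian_group null_subgroup, of c k]
  by (simp add: null_iff)

lemma null_cube_sum:
  "(\<And>k. k \<in> {1..m} \<rightarrow>\<^sub>E {0, 1} \<Longrightarrow> h k \<in> null_chains) \<Longrightarrow> cube_sum m h \<in> null_chains"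
  unfolding cube_sum_def by (intro null_sum null_cmul)

lemma frag_diff_null:
  "\<lbrakk>ms \<in> T; ms' \<in> T; f ms = f ms'\<rbrakk> \<Longrightarrow> frag_of ms - frag_of ms' \<in> null_chains"
  using keys_diff[of "frag_of ms" "frag_of ms'"] funcset_mem[OF f_closed, of ms']
  by (auto simp: null_iff L_diff L_frag_of keys_frag_of A.minus_eq A.r_neg)

lemma null_additive:
  assumes ms: "ms \<in> T" and i: "i \<le> n" and x: "x \<in> carrier M" and y: "y \<in> carrier M"
  shows "frag_of (ms[i := x \<oplus>\<^bsub>M\<^esub> y]) - (frag_of (ms[i := x]) + frag_of (ms[i := y]))
    \<in> null_chains"
proof -
  have T: "ms[i := x \<oplus>\<^bsub>M\<^esub> y] \<in> T" "ms[i := x] \<in> T" "ms[i := y] \<in> T"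
    using ms x y by (simp_all add: tuples_update)
  have "f (ms[i := x \<oplus>\<^bsub>M\<^esub> y]) = f (ms[i := x]) \<oplus>\<^bsub>A\<^esub> f (ms[i := y])"
    using multilinear ms i x y by (simp add: multilinear_map_def)
  moreover have k: "Poly_Mapping.keys (frag_of (ms[i := x]) + frag_of (ms[i := y])) \<subseteq> T"
    (is "Poly_Mapping.keys ?c \<subseteq> T")
    using T keys_add[of "frag_of (ms[i := x])" "frag_of (ms[i := y])"]
    by (auto simp: keys_frag_of)
  moreover have "f (ms[i := x]) \<oplus>\<^bsub>A\<^esub> f (ms[i := y]) \<in> carrier A"
    using T f_closed by auto
  moreover have "Poly_Mapping.keys (frag_of (ms[i := x \<oplus>\<^bsub>M\<^esub> y]) - ?c) \<subseteq> T"
    using T k keys_diff[of "frag_of (ms[i := x \<oplus>\<^bsub>M\<^esub> y])" ?c] by (auto simp: keys_frag_of)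
  ultimately show ?thesis
    using T by (simp add: null_iff L_diff L_add L_frag_of keys_frag_of A.minus_eq A.r_neg)
qed

lemma null_subtractive:
  assumes ms: "ms \<in> T" and i: "i \<le> n" and x: "x \<in> carrier M" and y: "y \<in> carrier M"
  shows "frag_of (ms[i := x \<ominus>\<^bsub>M\<^esub> y]) - (frag_of (ms[i := x]) - frag_of (ms[i := y]))
    \<in> null_chains"
proof -
  have "x \<ominus>\<^bsub>M\<^esub> y \<oplus>\<^bsub>M\<^esub> y = x"
    using x y by (simp add: Mod.M.minus_eq Mod.M.a_assoc Mod.M.l_neg)
  then show ?thesis
    using null_minus[OF null_additive[OF ms i _ y, of "x \<ominus>\<^bsub>M\<^esub> y"]] x y by (simp add: algebra_simps)
qed

text \<open>A multilinear map vanishes where an argument is \<open>0 = 0 - 0\<close>.\<close>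

lemma null_zero_entry:
  assumes ms: "ms \<in> T" and z: "\<zero>\<^bsub>M\<^esub> \<in> set ms"
  shows "frag_of ms \<in> null_chains"
proof -
  obtain i where i: "i \<le> n" "ms ! i = \<zero>\<^bsub>M\<^esub>"
    using z ms by (auto simp: in_set_conv_nth tuples_def less_Suc_eq_le)
  then have ms': "ms[i := \<zero>\<^bsub>M\<^esub>] = ms"
    by (metis list_update_id)
  have "\<zero>\<^bsub>M\<^esub> \<ominus>\<^bsub>M\<^esub> \<zero>\<^bsub>M\<^esub> = \<zero>\<^bsub>M\<^esub>"
    by (simp add: Mod.M.minus_eq)
  then show ?thesis
    using null_subtractive[OF ms i(1), of "\<zero>\<^bsub>M\<^esub>" "\<zero>\<^bsub>M\<^esub>"] by (simp add: ms')
qed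

lemma map_act_tuples:
  "\<lbrakk>ms \<in> tuples (carrier M) m; g \<in> carrier G\<rbrakk> \<Longrightarrow> map (\<lambda>x. x \<bullet> g) ms \<in> tuples (carrier M) m"
  by (auto simp: tuples_def)

lemma null_invariant:
  "\<lbrakk>ms \<in> T; g \<in> carrier G\<rbrakk> \<Longrightarrow> frag_of (map (\<lambda>x. x \<bullet> g) ms) - frag_of ms \<in> null_chains"
  using invariant by (intro frag_diff_null map_act_tuples) (auto simp: G_invariant_def)

definition omit :: "nat \<Rightarrow> (nat \<Rightarrow> 'm) \<Rightarrow> 'm list"
  where "omit p t = map (\<lambda>j. if j < p then t j else t (Suc j)) [0..<Suc n]"

lemma omit_closed: "(\<And>j. j \<le> Suc n \<Longrightarrow> t j \<in> carrier M) \<Longrightarrow> omit p t \<in> T"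
  by (auto simp: omit_def tuples_def)

text \<open>A merged coordinate is a sum of two, so \<open>f\<close> splits the merged tuple into the two tuples in which
  one of the summands has been left out.\<close>

lemma null_merge:
  assumes i: "1 \<le> i" "i \<le> Suc n" and t: "\<And>j. j \<le> Suc n \<Longrightarrow> t j \<in> carrier M"
  shows "frag_of (map (merge i t) [0..<Suc n]) - (frag_of (omit i t) + frag_of (omit (i - 1) t))
    \<in> null_chains"
proof -
  obtain p where p: "i = Suc p" using i by (cases i) auto
  let ?ms = "omit i t"
  have "map (merge i t) [0..<Suc n] = ?ms[p := t p \<oplus>\<^bsub>M\<^esub> t i]"
    "omit i t = ?ms[p := t p]" "omit (i - 1) t = ?ms[p := t i]"
    unfolding omit_def
    by (rule nth_equalityI; use i p in \<open>auto simp: merge_def nth_list_update less_Suc_eq_le simp del: upt_Suc\<close>)+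
  then show ?thesis
    using null_additive[of ?ms p "t p" "t i"] i p t omit_closed[of t i] by simp
qed

text \<open>Multilinear maps are group cocycles up to outer faces: splitting each inner face by additivity,
  consecutive terms of the alternating sum cancel, and only the first and last omissions survive.\<close>

lemma null_telescope:
  assumes t: "\<And>j. j \<le> Suc n \<Longrightarrow> t j \<in> carrier M"
  shows "(\<Sum>i=1..Suc n. frag_cmul ((-1) ^ i) (frag_of (map (merge i t) [0..<Suc n])))
    - (frag_cmul ((-1) ^ Suc n) (frag_of (omit (Suc n) t)) - frag_of (omit 0 t)) \<in> null_chains"
proof -
  let ?D = "\<lambda>i. frag_of (omit i t)" and ?F = "\<lambda>i. frag_of (map (merge i t) [0..<Suc n])"
  \<comment> \<open>The sum telescopes because \<open>(-1)\<^sup>i\<close> and \<open>(-1)\<^bsup>i+1\<^esup>\<close> cancel on the shared term.\<close>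
  have "(\<Sum>i=1..m. frag_cmul ((-1) ^ i) (?D i + ?D (i - 1))) = frag_cmul ((-1) ^ m) (?D m) - ?D 0" for m
    by (induction m) (simp_all add: frag_cmul_distrib2 flip: minus_frag_cmul)
  moreover have "(\<Sum>i=1..Suc n. frag_cmul ((-1) ^ i) (?F i - (?D i + ?D (i - 1)))) \<in> null_chains"
    by (intro null_sum null_cmul null_merge) (use t in auto)
  ultimately show ?thesis
    by (simp only: frag_cmul_diff_distrib2 sum_subtractf)
qed

lemma vertex_in_T:
  "\<lbrakk>\<And>l. \<lbrakk>1 \<le> l; l \<le> n\<rbrakk> \<Longrightarrow> e l \<in> carrier G; \<And>j. j \<le> n \<Longrightarrow> u j \<in> carrier M\<rbrakk> \<Longrightarrow> vertex n e u \<in> T"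
  by (auto simp: vertex_def tuples_def)

lemma psi_chain_keys:
  assumes "\<And>l. \<lbrakk>1 \<le> l; l \<le> n\<rbrakk> \<Longrightarrow> g l \<in> carrier G" "\<And>j. j \<le> n \<Longrightarrow> u j \<in> carrier M"
  shows "Poly_Mapping.keys (psi_chain n g u) \<subseteq> T"
proof -
  have "frag_cmul z (frag_of (vertex n (\<lambda>l. g l [^]\<^bsub>G\<^esub> k l) u)) \<in> carrier (free_Abelian_group T)"
    for z and k :: "nat \<Rightarrow> nat"
    using keys_cmul[of z "frag_of (vertex n (\<lambda>l. g l [^]\<^bsub>G\<^esub> k l) u)"]
      vertex_in_T[of "\<lambda>l. g l [^]\<^bsub>G\<^esub> k l" u] assms
    by (auto simp: keys_frag_of)
  then have "psi_chain n g u \<in> carrier (free_Abelian_group T)"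
    unfolding psi_chain_def cube_sum_def by (intro sum_closed_free_Abelian_group) blast
  then show ?thesis by simp
qed

text \<open>A zero coordinate stays zero at all vertices of the cube.  Adjacent elements in one group \<open>G\<^sub>m\<close>
  produce such a coordinate, and this is why \<open>\<Phi>\<^sub>f\<close> vanishes on decomposition relations.\<close>

lemma psi_chain_zero_coordinate:
  assumes g: "\<And>l. \<lbrakk>1 \<le> l; l \<le> n\<rbrakk> \<Longrightarrow> g l \<in> carrier G" and u: "\<And>j. j \<le> n \<Longrightarrow> u j \<in> carrier M"
    and j: "j \<le> n" "u j = \<zero>\<^bsub>M\<^esub>"
  shows "psi_chain n g u \<in> null_chains"
  unfolding psi_chain_def
proof (intro null_cube_sum null_zero_entry vertex_in_T)
  fix k :: "nat \<Rightarrow> nat"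
  have w: "vertex_word (\<lambda>l. g l [^]\<^bsub>G\<^esub> k l) n j \<in> carrier G"
    by (rule vertex_word_closed) (use g j in auto)
  have "\<zero>\<^bsub>M\<^esub> = \<zero>\<^bsub>M\<^esub> \<bullet> vertex_word (\<lambda>l. g l [^]\<^bsub>G\<^esub> k l) n j"
    using act_diff[OF _ _ w, of "\<zero>\<^bsub>M\<^esub>" "\<zero>\<^bsub>M\<^esub>"] w by (simp add: Mod.M.minus_eq Mod.M.r_neg)
  then show "\<zero>\<^bsub>M\<^esub> \<in> set (vertex n (\<lambda>l. g l [^]\<^bsub>G\<^esub> k l) u)"
    using j by (auto simp: vertex_def simp del: upt_Suc intro!: image_eqI[of _ _ j])
qed (use g u in auto)

text \<open>The cocycle condition on symbols without longer blocks.  Combining the two faces in each direction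
  gives the alternating sum of the merged tuples over all vertices of the \<open>(n+1)\<close>-cube.  At every vertex
  this telescopes to the tuples without the first and without the last coordinate.  All entries of
  the former carry the factor \<open>\<phi>(g\<^sub>1)\<^bsup>k(1)\<^esup>\<close>, and all entries of the latter end in \<open>g\<^sub>n\<^sub>+\<^sub>1\<^bsup>k(n+1)\<^esup>\<close>, so by
  \<open>G\<close>-invariance they depend on \<open>k(1)\<close>, respectively \<open>k(n+1)\<close>, only through the sign and cancel in pairs.\<close>

lemma psi_chain_cocycle:
  assumes g: "\<And>l. \<lbrakk>1 \<le> l; l \<le> Suc n\<rbrakk> \<Longrightarrow> g l \<in> carrier G"
    and u: "\<And>j. j \<le> Suc n \<Longrightarrow> u j \<in> carrier M"
  shows "(\<Sum>i=1..Suc n. frag_cmul ((-1) ^ i)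
      (psi_chain n (face_group \<one>\<^bsub>G\<^esub> i g) (merge i (scale \<one>\<^bsub>G\<^esub> i u))
       - psi_chain n (face_group (g i) i g) (merge i (scale (g i) i u)))) \<in> null_chains"
proof -
  define t where "t k j = u j \<bullet> vertex_word (\<lambda>l. g l [^]\<^bsub>G\<^esub> k l) (Suc n) j"
    for k :: "nat \<Rightarrow> nat" and j
  have t: "t k j \<in> carrier M" if "j \<le> Suc n" for k j
    unfolding t_def by (intro act_closed vertex_word_closed) (use that g u in auto)
  let ?F = "\<lambda>i k. frag_of (map (merge i (t k)) [0..<Suc n])"
  \<comment> \<open>The exponents \<open>c = 0, 1\<close> give the faces without and with the action of the \<open>i\<close>-th element.\<close>
  have face: "psi_chain n (face_group (g i [^]\<^bsub>G\<^esub> c) i g) (merge i (scale (g i [^]\<^bsub>G\<^esub> c) i u))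
      = cube_sum n (\<lambda>k. ?F i (insert_coord n i c k))" if i: "i \<in> {1..Suc n}" for i c
  proof -
    have w: "(\<lambda>l. if l = i then g i [^]\<^bsub>G\<^esub> c else g l [^]\<^bsub>G\<^esub> insert_coord n i c k l)
        = (\<lambda>l. g l [^]\<^bsub>G\<^esub> insert_coord n i c k l)" for k
      using i by (auto simp: insert_coord_def)
    show ?thesis
      using i g u by (subst psi_chain_face[where c = c]) (auto simp: w t_def[abs_def] simp del: upt_Suc)
  qed
  have "(\<Sum>i=1..Suc n. frag_cmul ((-1) ^ i)
      (psi_chain n (face_group \<one>\<^bsub>G\<^esub> i g) (merge i (scale \<one>\<^bsub>G\<^esub> i u))
       - psi_chain n (face_group (g i) i g) (merge i (scale (g i) i u))))
     = (\<Sum>i=1..Suc n. frag_cmul ((-1) ^ i) (cube_sum (Suc n) (?F i)))"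
  proof (rule sum.cong[OF refl])
    fix i assume i: "i \<in> {1..Suc n}"
    then show "frag_cmul ((-1) ^ i)
        (psi_chain n (face_group \<one>\<^bsub>G\<^esub> i g) (merge i (scale \<one>\<^bsub>G\<^esub> i u))
         - psi_chain n (face_group (g i) i g) (merge i (scale (g i) i u)))
       = frag_cmul ((-1) ^ i) (cube_sum (Suc n) (?F i))"
      using face[OF i, of 0] face[OF i, of 1] g[of i]
      unfolding cube_sum_split[OF i] cube_sum_diff by (simp del: upt_Suc)
  qed
  also have "\<dots> = cube_sum (Suc n) (\<lambda>k. \<Sum>i=1..Suc n. frag_cmul ((-1) ^ i) (?F i k))"
    by (simp only: cube_sum_sum cube_sum_cmul)
  finally have lhs: "(\<Sum>i=1..Suc n. frag_cmul ((-1) ^ i)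
      (psi_chain n (face_group \<one>\<^bsub>G\<^esub> i g) (merge i (scale \<one>\<^bsub>G\<^esub> i u))
       - psi_chain n (face_group (g i) i g) (merge i (scale (g i) i u))))
     = cube_sum (Suc n) (\<lambda>k. \<Sum>i=1..Suc n. frag_cmul ((-1) ^ i) (?F i k))" .
  have "cube_sum (Suc n) (\<lambda>k. (\<Sum>i=1..Suc n. frag_cmul ((-1) ^ i) (?F i k))
      - (frag_cmul ((-1) ^ Suc n) (frag_of (omit (Suc n) (t k))) - frag_of (omit 0 (t k)))) \<in> null_chains"
    by (intro null_cube_sum null_telescope t)
  \<comment> \<open>The facets opposite in direction \<open>1\<close> differ by the action of \<open>\<phi>(g\<^sub>1)\<close>.\<close>
  moreover have "cube_sum (Suc n) (\<lambda>k. frag_of (omit 0 (t k))) \<in> null_chains"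
  proof (subst cube_sum_split[of 1], simp, rule null_cube_sum)
    fix k
    let ?k = "\<lambda>c. insert_coord n 1 c k"
    have "omit 0 (t (?k 1)) = map (\<lambda>x. x \<bullet> \<phi> (g 1)) (omit 0 (t (?k 0)))"
    proof -
      have "t (?k 1) (Suc j) = t (?k 0) (Suc j) \<bullet> \<phi> (g 1)" if j: "j \<le> n" for j
      proof -
        let ?e = "\<lambda>c l. g l [^]\<^bsub>G\<^esub> ?k c l"
        have 0: "vertex_word (?e 0) (Suc n) (Suc j) \<in> carrier G"
          by (rule vertex_word_closed) (use g j in auto)
        have "vertex_word (twist (g 1) 1 (?e 1)) (Suc n) (Suc j) = vertex_word (?e 0) (Suc n) (Suc j)"
          by (rule vertex_word_cong) (use g[of 1] j in \<open>auto simp: twist_def insert_coord_def\<close>)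
        then have "vertex_word (?e 1) (Suc n) (Suc j) = \<phi> (g 1) \<cdot> vertex_word (?e 0) (Suc n) (Suc j)"
          using vertex_word_twist[of 1 "Suc n" "g 1" "Suc j" "?e 1"] g j by simp
        then show ?thesis
          using 0 g[of 1] u[of "Suc j"] j by (simp add: t_def phi_comm act_mult)
      qed
      then show ?thesis by (auto simp: omit_def)
    qed
    then show "frag_of (omit 0 (t (?k 0))) - frag_of (omit 0 (t (?k 1))) \<in> null_chains"
      using null_minus[OF null_invariant[of "omit 0 (t (?k 0))" "\<phi> (g 1)"]] g[of 1] omit_closed t
      by simp
  qed
  \<comment> \<open>The facets opposite in direction \<open>n + 1\<close> differ by the action of \<open>g\<^sub>n\<^sub>+\<^sub>1\<close>.\<close>
  moreover have "cube_sum (Suc n) (\<lambda>k. frag_of (omit (Suc n) (t k))) \<in> null_chains"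
  proof (subst cube_sum_split[of "Suc n"], simp, rule null_cube_sum)
    fix k
    let ?k = "\<lambda>c. insert_coord n (Suc n) c k"
    have "omit (Suc n) (t (?k 1)) = map (\<lambda>x. x \<bullet> g (Suc n)) (omit (Suc n) (t (?k 0)))"
    proof -
      have "t (?k 1) j = t (?k 0) j \<bullet> g (Suc n)" if j: "j \<le> n" for j
      proof -
        let ?e = "\<lambda>c l. g l [^]\<^bsub>G\<^esub> ?k c l"
        have 0: "vertex_word (?e 0) n j \<in> carrier G"
          by (rule vertex_word_closed) (use g j in auto)
        have "vertex_word (?e c) (Suc n) j = vertex_word (?e c) n j \<cdot> ?e c (Suc n)" for c
          using j g by (simp add: vertex_word_def word_snoc G.m_assoc)
        moreover have "vertex_word (?e 1) n j = vertex_word (?e 0) n j"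
          by (rule vertex_word_cong) (use j in \<open>auto simp: insert_coord_def\<close>)
        ultimately show ?thesis
          using 0 g[of "Suc n"] u[of j] j by (simp add: t_def act_mult)
      qed
      then show ?thesis by (auto simp: omit_def)
    qed
    then show "frag_of (omit (Suc n) (t (?k 0))) - frag_of (omit (Suc n) (t (?k 1))) \<in> null_chains"
      using null_minus[OF null_invariant[of "omit (Suc n) (t (?k 0))" "g (Suc n)"]] g[of "Suc n"] omit_closed t
      by simp
  qed
  ultimately show ?thesis
    unfolding lhs cube_sum_diff cube_sum_cmul
    by (metis (no_types, lifting) diff_add_cancel null_add null_cmul null_diff)
qed

end

section \<open>Chains of lists of biquandle elements\<close>

context alexander_mcb
begin

abbreviation biq where "biq \<equiv> mcb_carrier G M"

abbreviation op_under where "op_under \<equiv> mcb_under G M \<phi>"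

abbreviation op_over where "op_over \<equiv> mcb_over M \<phi>"

lemma biq_I: "\<lbrakk>fst x \<in> carrier M; snd x \<in> carrier G\<rbrakk> \<Longrightarrow> x \<in> biq"
  by (cases x) (simp add: mcb_carrier_def)

lemma biq_D [simp]:
  assumes "x \<in> biq"
  shows "fst x \<in> carrier M" "snd x \<in> carrier G"
  using assms by (auto simp: mcb_carrier_def)

lemma fst_under:
  "\<lbrakk>x \<in> biq; y \<in> biq\<rbrakk> \<Longrightarrow> fst (op_under x y)
    = fst x \<bullet> snd y \<oplus>\<^bsub>M\<^esub> (fst y \<bullet> \<phi> (snd y) \<ominus>\<^bsub>M\<^esub> fst y \<bullet> snd y)"
  by (cases x; cases y) (simp add: mcb_under_def mcb_carrier_def act_frag_diff)

lemma snd_under: "snd (op_under x y) = inv\<^bsub>G\<^esub> (snd y) \<cdot> snd x \<cdot> snd y"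
  by (cases x; cases y) (simp add: mcb_under_def)

lemma fst_over: "fst (op_over x y) = fst x \<bullet> \<phi> (snd y)"
  by (cases x; cases y) (simp add: mcb_over_def)

lemma snd_over: "snd (op_over x y) = snd x"
  by (cases x; cases y) (simp add: mcb_over_def)

lemma under_closed [simp]: "\<lbrakk>x \<in> biq; y \<in> biq\<rbrakk> \<Longrightarrow> op_under x y \<in> biq"
  by (rule biq_I) (simp_all add: fst_under snd_under)

lemma over_closed [simp]: "\<lbrakk>x \<in> biq; y \<in> biq\<rbrakk> \<Longrightarrow> op_over x y \<in> biq"
  by (rule biq_I) (simp_all add: fst_over snd_over)

lemma under_one: "\<lbrakk>x \<in> biq; m \<in> carrier M\<rbrakk> \<Longrightarrow> op_under x (m, \<one>\<^bsub>G\<^esub>) = x"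
  using biq_I[of "(m, \<one>\<^bsub>G\<^esub>)"] by (simp add: prod_eq_iff fst_under snd_under Mod.M.minus_eq Mod.M.r_neg)

lemma over_one: "x \<in> biq \<Longrightarrow> op_over x (m, \<one>\<^bsub>G\<^esub>) = x"
  by (simp add: prod_eq_iff fst_over snd_over)

lemma under_diff_under:
  assumes "x \<in> biq" "x' \<in> biq" "y \<in> biq"
  shows "fst (op_under x y) \<ominus>\<^bsub>M\<^esub> fst (op_under x' y) = (fst x \<ominus>\<^bsub>M\<^esub> fst x') \<bullet> snd y"
proof -
  have "(a \<oplus>\<^bsub>M\<^esub> c) \<ominus>\<^bsub>M\<^esub> (b \<oplus>\<^bsub>M\<^esub> c) = a \<ominus>\<^bsub>M\<^esub> b"
    if "a \<in> carrier M" "b \<in> carrier M" "c \<in> carrier M" for a b c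
    using that Mod.M.a_lcomm[of c "\<ominus>\<^bsub>M\<^esub> b" "\<ominus>\<^bsub>M\<^esub> c"]
    by (simp add: Mod.M.minus_eq Mod.M.minus_add Mod.M.a_assoc Mod.M.r_neg)
  then show ?thesis using assms by (simp add: fst_under act_diff)
qed

lemma under_eq:
  assumes "x \<in> biq" "y \<in> biq"
  shows "fst (op_under x y) = (fst x \<ominus>\<^bsub>M\<^esub> fst y) \<bullet> snd y \<oplus>\<^bsub>M\<^esub> fst y \<bullet> \<phi> (snd y)"
  using assms by (simp add: fst_under act_diff) (simp add: Mod.M.minus_eq Mod.M.a_ac)

text \<open>The term \<open>n (\<phi>(h) - h)\<close> in the operation is what splits the difference of the two neighbours of the acting element
  into their differences to this element, each with its own factor.\<close>

lemma under_diff_over: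
  assumes "x \<in> biq" "x' \<in> biq" "y \<in> biq"
  shows "fst (op_under x y) \<ominus>\<^bsub>M\<^esub> fst (op_over x' y)
    = (fst x \<ominus>\<^bsub>M\<^esub> fst y) \<bullet> snd y \<oplus>\<^bsub>M\<^esub> (fst y \<ominus>\<^bsub>M\<^esub> fst x') \<bullet> \<phi> (snd y)"
  using assms by (simp add: under_eq fst_over act_diff) (simp add: Mod.M.minus_eq Mod.M.a_assoc)

lemma over_diff_over:
  assumes "x \<in> biq" "x' \<in> biq" "y \<in> biq"
  shows "fst (op_over x y) \<ominus>\<^bsub>M\<^esub> fst (op_over x' y) = (fst x \<ominus>\<^bsub>M\<^esub> fst x') \<bullet> \<phi> (snd y)"
  using assms by (simp add: fst_over act_diff)

text \<open>The coordinates that \<open>\<gamma>\<^sub>m\<close> assigns to a list of length \<open>m + 1\<close>.\<close>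

definition diffs :: "nat \<Rightarrow> ('m \<times> 'g) list \<Rightarrow> nat \<Rightarrow> 'm"
  where "diffs m xs j = (if j < m then fst (xs ! j) \<ominus>\<^bsub>M\<^esub> fst (xs ! Suc j) else fst (xs ! m))"

definition list_chain :: "nat \<Rightarrow> ('m \<times> 'g) list \<Rightarrow> 'm list \<Rightarrow>\<^sub>0 int"
  where "list_chain m xs = psi_chain m (\<lambda>l. snd (xs ! l)) (diffs m xs)"

lemma nth_in_biq: "\<lbrakk>set xs \<subseteq> biq; j < length xs\<rbrakk> \<Longrightarrow> xs ! j \<in> biq"
  using nth_mem by blast

lemma diffs_closed: "\<lbrakk>set xs \<subseteq> biq; length xs = Suc m; j \<le> m\<rbrakk> \<Longrightarrow> diffs m xs j \<in> carrier M"
  by (simp add: diffs_def nth_in_biq)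

lemma psi_gamma_frag_of:
  assumes xs: "set xs \<subseteq> biq" "length xs = Suc m"
  shows "frag_extend (psi_basis G M \<phi> m) (gamma_BR M m (frag_of xs)) = list_chain m xs"
proof -
  let ?ms = "map (\<lambda>i. fst (xs ! i) \<ominus>\<^bsub>M\<^esub> fst (xs ! Suc i)) [0..<m] @ [fst (xs ! m)]"
  have word: "psi_word G \<phi> m (map snd xs) k j = vertex_word (\<lambda>l. snd (xs ! l) [^]\<^bsub>G\<^esub> k l) m j"
    if j: "j \<le> m" for k j
  proof -
    have pw: "power_word G (map snd xs) k a b = word (\<lambda>l. snd (xs ! l) [^]\<^bsub>G\<^esub> k l) a b"
      if "b \<le> m" for a b
      unfolding power_word_def word_def by (rule foldr_cong) (use that xs in auto)
    have "word (\<lambda>l. snd (xs ! l) [^]\<^bsub>G\<^esub> k l) 1 m \<in> carrier G"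
      by (rule word_closed) (use xs nth_in_biq in auto)
    then show ?thesis
      using j by (auto simp: psi_word_def vertex_word_def pw)
  qed
  have nth: "?ms ! j = diffs m xs j" if "j \<le> m" for j
    using that by (auto simp: nth_append diffs_def)
  show ?thesis
    unfolding gamma_BR_def list_chain_def psi_chain_def cube_sum_def vertex_def
    by (auto simp: psi_basis_def nth word simp del: upt_Suc
        intro!: sum.cong arg_cong[where f = "frag_cmul _"] arg_cong[where f = frag_of])
qed

text \<open>In difference coordinates a face of a list is a scaling followed by a merge.  At the last
  position there is no successor and the coordinate is not a difference, but the value of the operation has
  the same form (\<open>under_eq\<close>), so the formula persists.  Only the module component of \<open>y\<close> is prescribed: the
  group component \<open>snd (xs ! i)\<close> gives the acting face and the identity gives the omission.\<close>

lemma list_chain_face: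
  assumes xs: "set xs \<subseteq> biq" "length xs = Suc (Suc m)" and i: "1 \<le> i" "i \<le> Suc m"
    and y: "fst y = fst (xs ! i)" "snd y \<in> carrier G"
  shows "list_chain m (map (\<lambda>x. op_under x y) (take i xs) @ map (\<lambda>x. op_over x y) (drop (Suc i) xs))
    = psi_chain m (face_group (snd y) i (\<lambda>l. snd (xs ! l)))
        (merge i (scale (snd y) i (diffs (Suc m) xs)))"
proof -
  let ?ys = "map (\<lambda>x. op_under x y) (take i xs) @ map (\<lambda>x. op_over x y) (drop (Suc i) xs)"
  have yc: "y \<in> biq" using y i xs nth_in_biq[of xs i] by (auto intro: biq_I)
  have nth: "?ys ! j = (if j < i then op_under (xs ! j) y else op_over (xs ! Suc j) y)" if "j \<le> m" for j
    using that i xs by (auto simp: nth_append)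
  have x: "xs ! j \<in> biq" if "j \<le> Suc m" for j
    using that xs nth_in_biq by simp
  show ?thesis
    unfolding list_chain_def
  proof (rule psi_chain_cong)
    fix l assume "1 \<le> l" "l \<le> m"
    then show "snd (?ys ! l) = face_group (snd y) i (\<lambda>l. snd (xs ! l)) l"
      by (simp add: nth face_group_def snd_under snd_over)
  next
    fix j assume j: "j \<le> m"
    consider "Suc j < i" | "Suc j = i" "j < m" | "Suc j = i" "j = m" | "i \<le> j" "j < m" | "i \<le> j" "j = m"
      using j by linarith
    then show "diffs m ?ys j = merge i (scale (snd y) i (diffs (Suc m) xs)) j"
    proof cases
      case 1
      then show ?thesis using j i x yc
        by (simp add: diffs_def nth merge_def scale_def under_diff_under)
    next
      case 2
      then show ?thesis using j i x yc y(1)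
        by (auto simp: diffs_def nth merge_def scale_def under_diff_over)
    next
      case 3
      then show ?thesis using j i x yc y(1)
        by (auto simp: diffs_def nth merge_def scale_def under_eq)
    next
      case 4
      then show ?thesis using j i x yc
        by (auto simp: diffs_def nth merge_def scale_def over_diff_over)
    next
      case 5
      then show ?thesis using j i x yc
        by (auto simp: diffs_def nth merge_def scale_def fst_over)
    qed
  qed
qed

text \<open>The element \<open>(m, \<one>)\<close> acts trivially on everything, so omitting an element is a face too.\<close>

lemma list_chain_omit:
  assumes xs: "set xs \<subseteq> biq" "length xs = Suc (Suc m)" and i: "1 \<le> i" "i \<le> Suc m"
  shows "list_chain m (take i xs @ drop (Suc i) xs)
    = psi_chain m (face_group \<one>\<^bsub>G\<^esub> i (\<lambda>l. snd (xs ! l)))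
        (merge i (scale \<one>\<^bsub>G\<^esub> i (diffs (Suc m) xs)))"
proof -
  let ?y = "(fst (xs ! i), \<one>\<^bsub>G\<^esub>)"
  have "map (\<lambda>x. op_under x ?y) (take i xs) = take i xs"
    by (rule map_idI) (use xs i nth_in_biq[of xs i] in \<open>auto intro!: under_one dest: in_set_takeD\<close>)
  moreover have "map (\<lambda>x. op_over x ?y) (drop (Suc i) xs) = drop (Suc i) xs"
    by (rule map_idI) (use xs in \<open>auto intro!: over_one dest: in_set_dropD\<close>)
  ultimately show ?thesis
    using list_chain_face[OF xs i, of ?y] by simp
qed

text \<open>Here the acting element is not lost but replaced by \<open>a\<^sup>-\<^sup>1 b\<close> in the same position, so nothing is merged;
  the difference coordinates of \<open>\<langle>a\<rangle>\<close> and \<open>\<langle>b\<rangle>\<close> agree because both lie in the group \<open>G\<^sub>p\<close>.\<close>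

lemma list_chain_block:
  assumes xs: "set xs \<subseteq> biq" "length xs = Suc m" and i: "1 \<le> i" "i \<le> m"
    and p: "p \<in> carrier M" and a: "a \<in> carrier G" and b: "b \<in> carrier G" and xi: "xs ! i = (p, a)"
  shows "list_chain m (map (\<lambda>x. op_under x (p, a)) (take i xs) @ [(p \<bullet> \<phi> a, inv\<^bsub>G\<^esub> a \<cdot> b)]
      @ map (\<lambda>x. op_over x (p, a)) (drop (Suc i) xs))
    = list_chain m (xs[i := (p, b)]) - list_chain m xs"
proof -
  let ?g = "\<lambda>l. snd (xs ! l)" and ?u = "diffs m xs"
  define ys where "ys = map (\<lambda>x. op_under x (p, a)) (take i xs) @ [(p \<bullet> \<phi> a, inv\<^bsub>G\<^esub> a \<cdot> b)]
      @ map (\<lambda>x. op_over x (p, a)) (drop (Suc i) xs)"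
  have x: "xs ! j \<in> biq" if "j \<le> m" for j
    using that xs nth_in_biq by simp
  have pa: "(p, a) \<in> biq" using p a by (auto intro: biq_I)
  have nth: "ys ! j = (if j < i then op_under (xs ! j) (p, a)
      else if j = i then (p \<bullet> \<phi> a, inv\<^bsub>G\<^esub> a \<cdot> b) else op_over (xs ! j) (p, a))" if "j \<le> m" for j
    using that i xs by (auto simp: ys_def nth_append)
  have "list_chain m ys = psi_chain m (twist a i (?g(i := b))) (scale a i ?u)"
    unfolding list_chain_def
  proof (rule psi_chain_cong)
    fix l assume "1 \<le> l" "l \<le> m"
    then show "snd (ys ! l) = twist a i (?g(i := b)) l"
      by (auto simp: nth twist_def snd_under snd_over)
  next
    fix j assume j: "j \<le> m"
    have fo: "p \<bullet> \<phi> a = fst (op_over (xs ! i) (p, a))"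
      by (simp add: xi fst_over)
    consider "Suc j < i" | "Suc j = i" | "i \<le> j"
      by linarith
    then show "diffs m ys j = scale a i ?u j"
    proof cases
      case 1
      then show ?thesis using j i x pa
        by (simp add: diffs_def nth scale_def under_diff_under)
    next
      case 2
      have "(p \<ominus>\<^bsub>M\<^esub> p) \<bullet> \<phi> a = \<zero>\<^bsub>M\<^esub>"
        using p a by (simp add: act_diff) (simp add: Mod.M.minus_eq Mod.M.r_neg)
      then have "fst (op_under (xs ! j) (p, a)) \<ominus>\<^bsub>M\<^esub> fst (op_over (xs ! i) (p, a))
          = (fst (xs ! j) \<ominus>\<^bsub>M\<^esub> p) \<bullet> a"
        using under_diff_over[of "xs ! j" "xs ! i" "(p, a)"] 2 j i x pa p a by (simp add: xi)
      then show ?thesis using 2 j i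
        by (auto simp: diffs_def nth scale_def fo xi)
    next
      case 3
      have "fst (ys ! l) = fst (op_over (xs ! l) (p, a))" if "i \<le> l" "l \<le> m" for l
        using that by (auto simp: nth fo)
      then show ?thesis using 3 j x pa over_diff_over[of _ _ "(p, a)"]
        by (auto simp: diffs_def scale_def fst_over act_diff)
    qed
  qed
  also have "\<dots> = psi_chain m (?g(i := b)) ?u - psi_chain m (?g(i := a)) ?u"
    by (rule psi_chain_block) (use i a b x xs diffs_closed in auto)
  also have "psi_chain m (?g(i := b)) ?u = list_chain m (xs[i := (p, b)])"
    unfolding list_chain_def
    by (rule psi_chain_cong) (use xi xs i in \<open>auto simp: diffs_def nth_list_update\<close>)
  also have "psi_chain m (?g(i := a)) ?u = list_chain m xs"
    unfolding list_chain_def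
    by (rule psi_chain_cong) (use xi in auto)
  finally show ?thesis by (simp add: ys_def)
qed

end

section \<open>Symbols, the boundary, and the decomposition relations\<close>

context alexander_mcb
begin

text \<open>The condition on a block that \<open>mcb_symbols\<close> imposes besides being nonempty.  The empty list is
  allowed, because faces may produce it before it is omitted.\<close>

definition is_block :: "('m \<times> 'g) list \<Rightarrow> bool"
  where "is_block ys \<longleftrightarrow> (\<exists>m\<in>carrier M. set ys \<subseteq> {m} \<times> carrier G)"

lemma mcb_symbols_iff:
  "(x, xs) \<in> mcb_symbols G M m \<longleftrightarrow> x \<in> biq \<and> (\<forall>ys\<in>set xs. ys \<noteq> [] \<and> is_block ys) \<and>
    sum_list (map length xs) = m"
  by (simp add: mcb_symbols_def is_block_def mcb_fibre_def)

lemma is_block_biq: "is_block ys \<Longrightarrow> set ys \<subseteq> biq"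
  by (auto simp: is_block_def mcb_carrier_def)

lemma is_block_subset: "\<lbrakk>is_block ys; set zs \<subseteq> set ys\<rbrakk> \<Longrightarrow> is_block zs"
  by (auto simp: is_block_def)

lemma is_block_map:
  assumes ys: "is_block ys"
    and F: "\<And>y. y \<in> set ys \<Longrightarrow> F y \<in> biq"
    and c: "\<And>y y'. \<lbrakk>y \<in> set ys; y' \<in> set ys\<rbrakk> \<Longrightarrow> fst (F y) = fst (F y')"
  shows "is_block (map F ys)"
proof (cases "ys = []")
  case False
  then have hd: "hd ys \<in> set ys" by simp
  have "F y \<in> {fst (F (hd ys))} \<times> carrier G" if "y \<in> set ys" for y
    using F[OF that] c[OF that hd] by (simp add: mem_Times_iff)
  then have "set (map F ys) \<subseteq> {fst (F (hd ys))} \<times> carrier G"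
    unfolding set_map by blast
  moreover have "fst (F (hd ys)) \<in> carrier M" using F[OF hd] by simp
  ultimately show ?thesis unfolding is_block_def by blast
qed (use ys in \<open>auto simp: is_block_def\<close>)

lemma is_block_fst: "\<lbrakk>is_block ys; y \<in> set ys; y' \<in> set ys\<rbrakk> \<Longrightarrow> fst y = fst y'"
  unfolding is_block_def by (metis mem_Times_iff singletonD subsetD)

lemma is_block_under:
  assumes ys: "is_block ys" and a: "a \<in> biq"
  shows "is_block (map (\<lambda>y. op_under y a) ys)"
proof (rule is_block_map[OF ys])
  have y: "y \<in> biq" if "y \<in> set ys" for y
    using is_block_biq[OF ys] that by blast
  show "op_under y a \<in> biq" if "y \<in> set ys" for y
    using y[OF that] a by simp
  show "fst (op_under y a) = fst (op_under y' a)" if "y \<in> set ys" "y' \<in> set ys" for y y'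
    using is_block_fst[OF ys that] y[OF that(1)] y[OF that(2)] a by (simp add: fst_under)
qed

lemma is_block_over:
  assumes ys: "is_block ys" and a: "a \<in> biq"
  shows "is_block (map (\<lambda>y. op_over y a) ys)"
proof (rule is_block_map[OF ys])
  show "op_over y a \<in> biq" if "y \<in> set ys" for y
    using is_block_biq[OF ys] that a by (intro over_closed) blast+
  show "fst (op_over y a) = fst (op_over y' a)" if "y \<in> set ys" "y' \<in> set ys" for y y'
    using is_block_fst[OF ys that] by (simp add: fst_over)
qed

lemma inv_fibre:
  assumes g: "g \<in> carrier G"
  shows "inv\<^bsub>mcb_fibre G m\<^esub> (m, g) = (m, inv\<^bsub>G\<^esub> g)"
proof -
  interpret H: monoid "mcb_fibre G m"
    by (rule monoidI) (auto simp: mcb_fibre_def G.m_assoc)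
  show ?thesis
    by (rule H.inv_char) (use g in \<open>auto simp: mcb_fibre_def\<close>)
qed

lemma mcb_tilde_Cons:
  assumes "is_block (a # ys)"
  shows "mcb_tilde G M \<phi> (a # ys)
    = map (\<lambda>y. (fst a \<bullet> \<phi> (snd a), inv\<^bsub>G\<^esub> (snd a) \<cdot> snd y)) ys"
proof -
  have "snd a \<in> carrier G" using is_block_biq[OF assms] by auto
  then have "inv\<^bsub>mcb_fibre G (fst a)\<^esub> a = (fst a, inv\<^bsub>G\<^esub> (snd a))"
    using inv_fibre[of "snd a" "fst a"] by simp
  then show ?thesis
    by (simp add: mcb_tilde_def Let_def) (simp add: mcb_fibre_def mcb_over_def split_def)
qed

lemma is_block_tilde:
  assumes "is_block ys" "ys \<noteq> []"
  shows "is_block (mcb_tilde G M \<phi> ys)" "length (mcb_tilde G M \<phi> ys) = length ys - 1"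
proof -
  obtain a zs where ys: "ys = a # zs" using assms by (cases ys) auto
  have a: "a \<in> biq" "set zs \<subseteq> biq" using is_block_biq[OF assms(1)] ys by auto
  then have "set (mcb_tilde G M \<phi> ys) \<subseteq> {fst a \<bullet> \<phi> (snd a)} \<times> carrier G"
    using assms(1) unfolding ys
    by (subst mcb_tilde_Cons) (auto intro!: G.m_closed dest!: subsetD[OF a(2)] dest: biq_D(2))
  moreover have "fst a \<bullet> \<phi> (snd a) \<in> carrier M" using a by simp
  ultimately show "is_block (mcb_tilde G M \<phi> ys)" unfolding is_block_def by blast
  show "length (mcb_tilde G M \<phi> ys) = length ys - 1"
    using assms(1) unfolding ys by (subst mcb_tilde_Cons) auto
qed

lemma sum_list_filter_nonempty:
  "sum_list (map length (filter (\<lambda>ys. ys \<noteq> []) xs)) = sum_list (map length xs)"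
  by (induction xs) auto

lemma filter_symbol:
  "\<lbrakk>x \<in> biq; \<And>ys. ys \<in> set xs \<Longrightarrow> is_block ys; sum_list (map length xs) = m\<rbrakk>
    \<Longrightarrow> (x, filter (\<lambda>ys. ys \<noteq> []) xs) \<in> mcb_symbols G M m"
  by (simp add: mcb_symbols_iff sum_list_filter_nonempty)

text \<open>The block lists of the faces of a symbol \<open>\<langle>x\<rangle>\<langle>xs\<rangle>\<close> in the direction of its \<open>i\<close>-th block,
  before empty blocks are omitted.\<close>

definition act_face :: "nat \<Rightarrow> ('m \<times> 'g) list list \<Rightarrow> ('m \<times> 'g) list list"
  where "act_face i xs =
    map (map (\<lambda>y. op_under y (hd (xs ! i)))) (take i xs) @ [mcb_tilde G M \<phi> (xs ! i)] @
    map (map (\<lambda>y. op_over y (hd (xs ! i)))) (drop (Suc i) xs)"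

definition omit_face :: "nat \<Rightarrow> nat \<Rightarrow> ('m \<times> 'g) list list \<Rightarrow> ('m \<times> 'g) list list"
  where "omit_face i j xs = xs[i := take j (xs ! i) @ drop (Suc j) (xs ! i)]"

definition block_boundary :: "nat \<Rightarrow> 'm \<times> 'g \<Rightarrow> ('m \<times> 'g) list list \<Rightarrow> ('m \<times> 'g) symb \<Rightarrow>\<^sub>0 int"
  where "block_boundary i x xs = symb_omit (op_under x (hd (xs ! i))) (act_face i xs)
    + (\<Sum>j<length (xs ! i). frag_cmul ((-1) ^ Suc j) (symb_omit x (omit_face i j xs)))"

lemma mcb_boundary_symb_eq:
  "mcb_boundary_symb G M \<phi> (x, xs)
    = (\<Sum>i<length xs. frag_cmul ((-1) ^ sum_list (map length (take i xs))) (block_boundary i x xs))"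
  by (simp add: mcb_boundary_symb_def block_boundary_def act_face_def omit_face_def Let_def)

lemma sum_list_split_nth:
  "i < length xs \<Longrightarrow> sum_list (map length xs)
    = sum_list (map length (take i xs)) + length (xs ! i) + sum_list (map length (drop (Suc i) xs))"
  by (subst id_take_nth_drop[of i xs]) simp_all

lemma act_face_symbol:
  assumes s: "(x, xs) \<in> mcb_symbols G M (Suc m)" and i: "i < length xs"
  shows "(op_under x (hd (xs ! i)), filter (\<lambda>ys. ys \<noteq> []) (act_face i xs)) \<in> mcb_symbols G M m"
proof (rule filter_symbol)
  have b: "is_block ys" "ys \<noteq> []" if "ys \<in> set xs" for ys
    using s that by (auto simp: mcb_symbols_iff)
  have xi: "is_block (xs ! i)" "xs ! i \<noteq> []" using b i by auto
  have a: "hd (xs ! i) \<in> biq"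
    using is_block_biq[OF xi(1)] xi(2) by auto
  then show "op_under x (hd (xs ! i)) \<in> biq" using s by (simp add: mcb_symbols_iff)
  show "is_block ys" if "ys \<in> set (act_face i xs)" for ys
    using that a b xi
    by (auto simp: act_face_def is_block_tilde is_block_under is_block_over dest: in_set_takeD in_set_dropD)
  have l: "map length (map (map F) zs) = map length zs" for F :: "'m \<times> 'g \<Rightarrow> 'm \<times> 'g" and zs
    by (simp add: comp_def)
  have "sum_list (map length (act_face i xs)) = sum_list (map length (take i xs))
      + (length (xs ! i) - 1) + sum_list (map length (drop (Suc i) xs))"
    by (simp add: act_face_def l is_block_tilde(2)[OF xi] del: map_map)
  moreover have "0 < length (xs ! i)" using xi by simp
  moreover have "sum_list (map length xs) = Suc m" using s by (simp add: mcb_symbols_iff)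
  ultimately show "sum_list (map length (act_face i xs)) = m"
    using sum_list_split_nth[OF i] by linarith
qed

lemma omit_face_symbol:
  assumes s: "(x, xs) \<in> mcb_symbols G M (Suc m)" and i: "i < length xs" and j: "j < length (xs ! i)"
  shows "(x, filter (\<lambda>ys. ys \<noteq> []) (omit_face i j xs)) \<in> mcb_symbols G M m"
proof (rule filter_symbol)
  have b: "is_block ys" "ys \<noteq> []" if "ys \<in> set xs" for ys
    using s that by (auto simp: mcb_symbols_iff)
  have "set (take j (xs ! i) @ drop (Suc j) (xs ! i)) \<subseteq> set (xs ! i)"
    by (auto dest: in_set_takeD in_set_dropD)
  then have "is_block (take j (xs ! i) @ drop (Suc j) (xs ! i))"
    using b i is_block_subset nth_mem by blast
  then show "is_block ys" if "ys \<in> set (omit_face i j xs)" for ys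
    using that b set_update_subset_insert[of xs i] unfolding omit_face_def by blast
  show "x \<in> biq" using s by (simp add: mcb_symbols_iff)
  have "sum_list (map length (omit_face i j xs)) = sum_list (map length (take i xs))
      + (length (xs ! i) - 1) + sum_list (map length (drop (Suc i) xs))"
    using i j by (simp add: omit_face_def upd_conv_take_nth_drop)
  moreover have "sum_list (map length xs) = Suc m" using s by (simp add: mcb_symbols_iff)
  ultimately show "sum_list (map length (omit_face i j xs)) = m"
    using sum_list_split_nth[OF i] j by linarith
qed

lemma symb_omit_closed:
  "(x, filter (\<lambda>ys. ys \<noteq> []) zs) \<in> mcb_symbols G M m
    \<Longrightarrow> symb_omit x zs \<in> carrier (free_Abelian_group (mcb_symbols G M m))"
  by (simp add: symb_omit_def keys_frag_of)

lemma cmul_closed: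
  "c \<in> carrier (free_Abelian_group S) \<Longrightarrow> frag_cmul k c \<in> carrier (free_Abelian_group S)"
  using keys_cmul[of k c] by auto

lemma add_closed:
  "\<lbrakk>c \<in> carrier (free_Abelian_group S); d \<in> carrier (free_Abelian_group S)\<rbrakk>
    \<Longrightarrow> c + d \<in> carrier (free_Abelian_group S)"
  using keys_add[of c d] by auto

lemma block_boundary_closed:
  assumes s: "(x, xs) \<in> mcb_symbols G M (Suc m)" and i: "i < length xs"
  shows "block_boundary i x xs \<in> carrier (free_Abelian_group (mcb_symbols G M m))"
proof -
  let ?F = "free_Abelian_group (mcb_symbols G M m)"
  have "symb_omit (op_under x (hd (xs ! i))) (act_face i xs) \<in> carrier ?F"
    by (rule symb_omit_closed[OF act_face_symbol[OF s i]])
  moreover have "(\<Sum>j<length (xs ! i). frag_cmul ((-1) ^ Suc j) (symb_omit x (omit_face i j xs))) \<in> carrier ?F"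
    by (intro sum_closed_free_Abelian_group cmul_closed symb_omit_closed omit_face_symbol[OF s i]) simp
  ultimately show ?thesis
    unfolding block_boundary_def by (rule add_closed)
qed

lemma boundary_closed:
  assumes "c \<in> carrier (mcb_P G M (Suc m))"
  shows "mcb_boundary G M \<phi> c \<in> carrier (mcb_P G M m)"
proof -
  have "mcb_boundary_symb G M \<phi> (x, xs) \<in> carrier (mcb_P G M m)"
    if "(x, xs) \<in> mcb_symbols G M (Suc m)" for x xs
    unfolding mcb_boundary_symb_eq mcb_P_def
    by (intro sum_closed_free_Abelian_group cmul_closed block_boundary_closed[OF that]) simp
  then have "Poly_Mapping.keys (mcb_boundary_symb G M \<phi> s) \<subseteq> mcb_symbols G M m"
    if "s \<in> mcb_symbols G M (Suc m)" for s
    using that by (cases s) (simp add: mcb_P_def)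
  then have "Poly_Mapping.keys (mcb_boundary G M \<phi> c) \<subseteq> mcb_symbols G M m"
    using assms unfolding mcb_boundary_def mcb_P_def
    by (intro keys_frag_extend_subset) auto
  then show ?thesis by (simp add: mcb_P_def)
qed

end

context multilinear_cochain
begin

text \<open>The value of \<open>\<psi>\<^sub>n \<circ> \<gamma>\<^sub>n \<circ> proj\<^sub>n\<close> before the passage to coinvariants; it is additive on all
  chains, and the cochain is recovered as the value of \<open>L\<close>.\<close>

definition Psi :: "(('m \<times> 'g) symb \<Rightarrow>\<^sub>0 int) \<Rightarrow> 'm list \<Rightarrow>\<^sub>0 int"
  where "Psi c = frag_extend (psi_basis G M \<phi> n) (gamma_BR M n (proj_BR n c))"

lemma Psi_0 [simp]: "Psi 0 = 0"
  by (simp add: Psi_def gamma_BR_def proj_BR_def)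

lemma Psi_diff: "Psi (c - d) = Psi c - Psi d"
  by (simp add: Psi_def gamma_BR_def proj_BR_def frag_extend_diff)

lemma Psi_add: "Psi (c + d) = Psi c + Psi d"
  by (simp add: Psi_def gamma_BR_def proj_BR_def frag_extend_add)

lemma Psi_cmul: "Psi (frag_cmul k c) = frag_cmul k (Psi c)"
  by (simp add: Psi_def gamma_BR_def proj_BR_def frag_extend_cmul)

lemma Psi_sum: "finite I \<Longrightarrow> Psi (sum c I) = (\<Sum>i\<in>I. Psi (c i))"
  by (simp add: Psi_def gamma_BR_def proj_BR_def frag_extend_sum)

lemma Psi_frag_of_0: "length xs \<noteq> n \<Longrightarrow> Psi (frag_of (x, xs)) = 0"
  by (simp add: Psi_def gamma_BR_def proj_BR_def)

lemma hd_list_biq: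
  "(x, xs) \<in> mcb_symbols G M m \<Longrightarrow> set (x # map hd xs) \<subseteq> biq"
  using is_block_biq by (fastforce simp: mcb_symbols_iff)

lemma Psi_frag_of:
  assumes "(x, xs) \<in> mcb_symbols G M m" "length xs = n"
  shows "Psi (frag_of (x, xs)) = list_chain n (x # map hd xs)"
  using psi_gamma_frag_of[OF hd_list_biq[OF assms(1)], of n] assms(2)
  by (simp add: Psi_def proj_BR_def)

lemma list_chain_keys:
  "\<lbrakk>set xs \<subseteq> biq; length xs = Suc n\<rbrakk> \<Longrightarrow> Poly_Mapping.keys (list_chain n xs) \<subseteq> T"
  unfolding list_chain_def by (rule psi_chain_keys) (auto simp: nth_in_biq diffs_closed)

lemma Psi_closed:
  assumes "c \<in> carrier (mcb_P G M n)"
  shows "Poly_Mapping.keys (Psi c) \<subseteq> T"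
proof -
  have "Poly_Mapping.keys c \<subseteq> mcb_symbols G M n" using assms by (simp add: mcb_P_def)
  then show ?thesis
  proof (induction c rule: frag_induction)
    case (one s)
    obtain x xs where s: "s = (x, xs)" by (cases s)
    then show ?case
      using one list_chain_keys[OF hd_list_biq[of x xs n]]
      by (cases "length xs = n") (auto simp: Psi_frag_of Psi_frag_of_0)
  next
    case (diff a b)
    then show ?case using keys_diff[of "Psi a" "Psi b"] by (auto simp: Psi_diff)
  qed simp
qed

lemma Psi_symb_omit_0: "length (filter (\<lambda>ys. ys \<noteq> []) zs) \<noteq> n \<Longrightarrow> Psi (symb_omit x zs) = 0"
  by (simp add: symb_omit_def Psi_frag_of_0)

text \<open>All blocks other than the \<open>i\<close>-th one have at least one entry.  Hence the number of blocks limits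
  how long a single block can be, which is what leaves only few cases in the boundary computation.\<close>

lemma nth_length_le:
  assumes "(x, xs) \<in> mcb_symbols G M m" "i < length xs"
  shows "length (xs ! i) + length xs \<le> Suc m"
proof -
  have le: "length zs \<le> sum_list (map length zs)" if "set zs \<subseteq> set xs" for zs
  proof -
    have "\<forall>ys\<in>set zs. ys \<noteq> []" using assms that by (auto simp: mcb_symbols_iff)
    then show ?thesis
    proof (induction zs)
      case (Cons ys zs)
      then have "0 < length ys" by simp
      then show ?case using Cons by (simp add: Suc_le_eq add_less_le_mono del: length_greater_0_conv)
    qed simp
  qed
  then show ?thesis
    using le[of "take i xs"] le[of "drop (Suc i) xs"] sum_list_split_nth[OF assms(2)] assms
    by (auto simp: mcb_symbols_iff set_take_subset set_drop_subset)
qed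

lemma length_filter_nonempty_less:
  "\<lbrakk>i < length zs; zs ! i = []\<rbrakk> \<Longrightarrow> length (filter (\<lambda>ys. ys \<noteq> []) zs) < length zs"
  by (rule length_filter_less[of "[]"]) (use nth_mem in fastforce)+

lemma length_act_face: "i < length xs \<Longrightarrow> length (act_face i xs) = length xs"
  by (simp add: act_face_def)

text \<open>The \<open>i\<close>-th block becomes empty in both faces and is omitted, so each of them is a face of the
  underlying list of elements.\<close>

lemma Psi_boundary_singletons:
  assumes s: "(x, xs) \<in> mcb_symbols G M (Suc n)" and l: "length xs = Suc n" and i: "i < length xs"
  shows "Psi (block_boundary i x xs)
    = psi_chain n (face_group (snd ((x # map hd xs) ! Suc i)) (Suc i) (\<lambda>l. snd ((x # map hd xs) ! l)))
        (merge (Suc i) (scale (snd ((x # map hd xs) ! Suc i)) (Suc i) (diffs (Suc n) (x # map hd xs))))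
      - psi_chain n (face_group \<one>\<^bsub>G\<^esub> (Suc i) (\<lambda>l. snd ((x # map hd xs) ! l)))
        (merge (Suc i) (scale \<one>\<^bsub>G\<^esub> (Suc i) (diffs (Suc n) (x # map hd xs))))"
proof -
  define ys where "ys = x # map hd xs"
  have ys: "set ys \<subseteq> biq" "length ys = Suc (Suc n)"
    using hd_list_biq[OF s] l by (simp_all add: ys_def)
  have ne: "zs \<noteq> []" if "zs \<in> set xs" for zs using s that by (auto simp: mcb_symbols_iff)
  have keep: "filter (\<lambda>ys. ys \<noteq> []) zs = zs"
    "filter (\<lambda>ys. ys \<noteq> []) (map (map F) zs) = map (map F) zs"
    if "set zs \<subseteq> set xs" for zs and F :: "'m \<times> 'g \<Rightarrow> 'm \<times> 'g"
    by (rule filter_True; use that ne in auto)+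
  have "length (xs ! i) = 1"
    using nth_length_le[OF s i] l ne[OF nth_mem[OF i]] by (cases "xs ! i") auto
  then obtain a where a: "xs ! i = [a]" by (auto simp: length_Suc_conv)
  have ya: "ys ! Suc i = a" using i a by (simp add: ys_def)
  have aX: "a \<in> biq" using ya nth_in_biq[OF ys(1), of "Suc i"] i l ys by simp
  have "is_block [a]" using s a i nth_mem[OF i] by (auto simp: mcb_symbols_iff)
  then have "mcb_tilde G M \<phi> [a] = []" by (simp add: mcb_tilde_Cons)
  then have fa: "filter (\<lambda>ys. ys \<noteq> []) (act_face i xs)
      = map (map (\<lambda>y. op_under y a)) (take i xs) @ map (map (\<lambda>y. op_over y a)) (drop (Suc i) xs)"
    by (simp add: act_face_def a keep set_take_subset set_drop_subset)
  have fo: "filter (\<lambda>ys. ys \<noteq> []) (omit_face i 0 xs) = take i xs @ drop (Suc i) xs"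
    using i by (simp add: omit_face_def a upd_conv_take_nth_drop keep set_take_subset set_drop_subset)
  have hdmap: "map (\<lambda>z. hd (map F z)) zs = map (\<lambda>z. F (hd z)) zs" if "set zs \<subseteq> set xs"
    for F :: "'m \<times> 'g \<Rightarrow> 'm \<times> 'g" and zs
    using that ne by (auto simp: hd_map)
  have "Psi (symb_omit (op_under x a) (act_face i xs))
      = list_chain n (map (\<lambda>x. op_under x a) (take (Suc i) ys) @ map (\<lambda>x. op_over x a) (drop (Suc (Suc i)) ys))"
    using act_face_symbol[OF s i] i l
    unfolding symb_omit_def
    by (subst Psi_frag_of[of _ _ n])
       (auto simp: fa a ys_def hdmap set_take_subset set_drop_subset take_map drop_map comp_def)
  also have "\<dots> = psi_chain n (face_group (snd a) (Suc i) (\<lambda>l. snd (ys ! l)))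
        (merge (Suc i) (scale (snd a) (Suc i) (diffs (Suc n) ys)))"
    by (rule list_chain_face) (use ys ya i l aX in auto)
  finally have 1: "Psi (symb_omit (op_under x a) (act_face i xs)) = \<dots>" .
  have "Psi (symb_omit x (omit_face i 0 xs)) = list_chain n (take (Suc i) ys @ drop (Suc (Suc i)) ys)"
    using omit_face_symbol[OF s i, of 0] i l a
    unfolding symb_omit_def
    by (subst Psi_frag_of[of _ _ n]) (auto simp: fo ys_def take_map drop_map)
  also have "\<dots> = psi_chain n (face_group \<one>\<^bsub>G\<^esub> (Suc i) (\<lambda>l. snd (ys ! l)))
        (merge (Suc i) (scale \<one>\<^bsub>G\<^esub> (Suc i) (diffs (Suc n) ys)))"
    by (rule list_chain_omit) (use ys i l in auto)
  finally show ?thesis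
    using 1 unfolding ys_def[symmetric]
    by (simp add: block_boundary_def a Psi_diff ya)
qed

text \<open>The terms \<open>\<langle>b\<rangle>\<close>, \<open>\<langle>a\<rangle>\<close> and the acting face of a block \<open>\<langle>a, b\<rangle>\<close> enter with signs \<open>-\<close>, \<open>+\<close> and \<open>+\<close>,
  which is the combination that vanishes by \<open>list_chain_block\<close>.\<close>

lemma Psi_boundary_pair:
  assumes s: "(x, xs) \<in> mcb_symbols G M (Suc n)" and l: "length xs = n" and i: "i < length xs"
    and two: "xs ! i = [a, b]"
  shows "Psi (block_boundary i x xs) = 0"
proof -
  define ys where "ys = x # map hd xs"
  have ys: "set ys \<subseteq> biq" "length ys = Suc n"
    using hd_list_biq[OF s] l by (simp_all add: ys_def)
  have ne: "zs \<noteq> []" if "zs \<in> set xs" for zs using s that by (auto simp: mcb_symbols_iff)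
  have keep: "filter (\<lambda>ys. ys \<noteq> []) zs = zs"
    "filter (\<lambda>ys. ys \<noteq> []) (map (map F) zs) = map (map F) zs"
    if "set zs \<subseteq> set xs" for zs and F :: "'m \<times> 'g \<Rightarrow> 'm \<times> 'g"
    by (rule filter_True; use that ne in auto)+
  have ya: "ys ! Suc i = a" using i two by (simp add: ys_def)
  have bl: "is_block [a, b]" using s two i nth_mem[OF i] by (auto simp: mcb_symbols_iff)
  then have ab: "a \<in> biq" "b \<in> biq" "fst b = fst a"
    using is_block_biq[OF bl] is_block_fst[OF bl] by auto
  let ?t = "(fst a \<bullet> \<phi> (snd a), inv\<^bsub>G\<^esub> (snd a) \<cdot> snd b)"
  have t: "mcb_tilde G M \<phi> [a, b] = [?t]" using bl by (simp add: mcb_tilde_Cons)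
  have fa: "filter (\<lambda>ys. ys \<noteq> []) (act_face i xs) = act_face i xs"
    by (simp add: act_face_def two t keep set_take_subset set_drop_subset)
  have fo: "filter (\<lambda>ys. ys \<noteq> []) (xs[i := [c]]) = xs[i := [c]]" for c
    using i by (simp add: upd_conv_take_nth_drop keep set_take_subset set_drop_subset)
  have hdmap: "map (\<lambda>z. hd (map F z)) zs = map (\<lambda>z. F (hd z)) zs" if "set zs \<subseteq> set xs"
    for F :: "'m \<times> 'g \<Rightarrow> 'm \<times> 'g" and zs
    using that ne by (auto simp: hd_map)
  have "Psi (symb_omit (op_under x a) (act_face i xs))
      = list_chain n (map (\<lambda>x. op_under x a) (take (Suc i) ys) @ [?t]
          @ map (\<lambda>x. op_over x a) (drop (Suc (Suc i)) ys))"
    using act_face_symbol[OF s i] i l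
    unfolding symb_omit_def fa
    by (subst Psi_frag_of[of _ _ n])
       (auto simp: act_face_def two t ys_def hdmap set_take_subset set_drop_subset take_map drop_map comp_def)
  also have "\<dots> = list_chain n (ys[Suc i := b]) - list_chain n ys"
    using list_chain_block[of ys n "Suc i" "fst a" "snd a" "snd b"] ys i l ya ab
    by (metis One_nat_def Suc_le_eq Suc_le_mono biq_D le0 prod.collapse)
  finally have 1: "Psi (symb_omit (op_under x a) (act_face i xs)) = \<dots>" .
  have om: "Psi (symb_omit x (xs[i := [c]])) = list_chain n (ys[Suc i := c])"
    if "(x, xs[i := [c]]) \<in> mcb_symbols G M n" for c
    using that l unfolding symb_omit_def fo
    by (subst Psi_frag_of[of _ _ n]) (auto simp: ys_def map_update)
  have "omit_face i 0 xs = xs[i := [b]]" "omit_face i 1 xs = xs[i := [a]]"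
    by (simp_all add: omit_face_def two)
  then have "Psi (symb_omit x (omit_face i 0 xs)) = list_chain n (ys[Suc i := b])"
    "Psi (symb_omit x (omit_face i 1 xs)) = list_chain n (ys[Suc i := a])"
    using om[of a] om[of b] omit_face_symbol[OF s i, of 0] omit_face_symbol[OF s i, of 1]
    by (simp_all add: fo two)
  moreover have "ys[Suc i := a] = ys" using ya by (metis list_update_id)
  ultimately show ?thesis
    using 1 by (simp add: block_boundary_def two Psi_add Psi_diff numeral_2_eq_2 lessThan_Suc)
qed

text \<open>The projection only keeps faces with \<open>n\<close> blocks.  A symbol of degree \<open>n + 1\<close> with at most \<open>n\<close> blocks
  has such faces only if it has exactly \<open>n\<close> blocks and the face is taken in a block of two entries.\<close>

lemma Psi_boundary_block:
  assumes s: "(x, xs) \<in> mcb_symbols G M (Suc n)" and l: "length xs \<le> n" and i: "i < length xs"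
  shows "Psi (block_boundary i x xs) = 0"
proof -
  have ne: "xs ! i \<noteq> []" using s i nth_mem[OF i] by (auto simp: mcb_symbols_iff)
  have bl: "is_block (xs ! i)" using s i nth_mem[OF i] by (auto simp: mcb_symbols_iff)
  have lo: "length (omit_face i j xs) = length xs" for j
    by (simp add: omit_face_def)
  have le: "length (filter (\<lambda>ys. ys \<noteq> []) zs) \<le> length zs" for zs :: "('m \<times> 'g) list list"
    by simp
  consider "length (xs ! i) = 1" | "length xs < n" | "length (xs ! i) = 2" "length xs = n"
    using nth_length_le[OF s i] l ne by (cases "length (xs ! i)") (auto, linarith)
  then show ?thesis
  proof cases
    case 1
    have "act_face i xs ! i = []"
      using is_block_tilde(2)[OF bl ne] 1 i by (simp add: act_face_def nth_append)
    then have "length (filter (\<lambda>ys. ys \<noteq> []) (act_face i xs)) < n"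
      using length_filter_nonempty_less[of i "act_face i xs"] i l by (simp add: length_act_face)
    moreover have "length (filter (\<lambda>ys. ys \<noteq> []) (omit_face i 0 xs)) < n"
      using length_filter_nonempty_less[of i "omit_face i 0 xs"] i l 1
      by (simp add: lo) (simp add: omit_face_def)
    ultimately show ?thesis
      using 1 by (simp add: block_boundary_def Psi_add Psi_diff Psi_symb_omit_0)
  next
    case 2
    then have "length (filter (\<lambda>ys. ys \<noteq> []) (act_face i xs)) \<noteq> n"
      "length (filter (\<lambda>ys. ys \<noteq> []) (omit_face i j xs)) \<noteq> n" for j
      using le[of "act_face i xs"] le[of "omit_face i j xs"] lo i by (auto simp: length_act_face)
    then show ?thesis
      by (simp add: block_boundary_def Psi_add Psi_sum Psi_cmul Psi_symb_omit_0)
  next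
    case 3
    then obtain a b where "xs ! i = [a, b]"
      by (auto simp: numeral_2_eq_2 length_Suc_conv)
    then show ?thesis using Psi_boundary_pair[OF s] 3 i by simp
  qed
qed

text \<open>A symbol of degree \<open>n + 1\<close> with more than \<open>n\<close> blocks consists of \<open>n + 1\<close> singletons.\<close>

lemma Psi_boundary_symb_null:
  assumes s: "(x, xs) \<in> mcb_symbols G M (Suc n)"
  shows "Psi (mcb_boundary_symb G M \<phi> (x, xs)) \<in> null_chains"
proof (cases "length xs \<le> n")
  case True
  then show ?thesis
    using Psi_boundary_block[OF s] by (simp add: mcb_boundary_symb_eq Psi_sum Psi_cmul)
next
  case False
  have len: "length ys = 1" if ys: "ys \<in> set xs" for ys
  proof -
    obtain i where i: "i < length xs" "ys = xs ! i" using ys by (metis in_set_conv_nth)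
    have "ys \<noteq> []" using s ys by (auto simp: mcb_symbols_iff)
    then have "0 < length ys" by simp
    then show ?thesis
      using nth_length_le[OF s i(1)] False unfolding i(2)[symmetric] by linarith
  qed
  have "map length xs = replicate (length xs) 1"
    using len by (simp add: list_eq_iff_nth_eq)
  then have l: "length xs = Suc n" using s by (simp add: mcb_symbols_iff sum_list_replicate)
  define ys where "ys = x # map hd xs"
  have ys: "set ys \<subseteq> biq" "length ys = Suc (Suc n)"
    using hd_list_biq[OF s] l by (simp_all add: ys_def)
  have sgn: "sum_list (map length (take i xs)) = i" if "i < length xs" for i
  proof -
    have "map length (take i xs) = replicate i 1"
      using len that by (auto simp: list_eq_iff_nth_eq)
    then show ?thesis by (simp add: sum_list_replicate)
  qed
  let ?g = "\<lambda>l. snd (ys ! l)" and ?u = "diffs (Suc n) ys"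
  let ?p = "\<lambda>z i. psi_chain n (face_group z i ?g) (merge i (scale z i ?u))"
  have "Psi (mcb_boundary_symb G M \<phi> (x, xs))
      = (\<Sum>i<Suc n. frag_cmul ((-1) ^ i) (?p (?g (Suc i)) (Suc i) - ?p \<one>\<^bsub>G\<^esub> (Suc i)))"
    (is "_ = ?S")
  proof -
    have "Psi (mcb_boundary_symb G M \<phi> (x, xs)) = (\<Sum>i<length xs.
        frag_cmul ((-1) ^ sum_list (map length (take i xs))) (Psi (block_boundary i x xs)))"
      by (simp add: mcb_boundary_symb_eq Psi_sum Psi_cmul)
    also have "\<dots> = ?S"
    proof (rule sum.cong)
      fix i assume "i \<in> {..<Suc n}"
      then have i: "i < length xs" by (simp add: l)
      show "frag_cmul ((-1) ^ sum_list (map length (take i xs))) (Psi (block_boundary i x xs))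
          = frag_cmul ((-1) ^ i) (?p (?g (Suc i)) (Suc i) - ?p \<one>\<^bsub>G\<^esub> (Suc i))"
        unfolding sgn[OF i] Psi_boundary_singletons[OF s l i] ys_def ..
    qed (simp add: l)
    finally show ?thesis .
  qed
  \<comment> \<open>Blocks are counted from \<open>0\<close> and list positions from \<open>1\<close>, because \<open>x\<close> comes first; the shift of the sign exchanges the two faces.\<close>
  also have "\<dots> = (\<Sum>i=1..Suc n. frag_cmul ((-1) ^ i) (?p \<one>\<^bsub>G\<^esub> i - ?p (?g i) i))"
    by (rule sum.reindex_bij_witness[where i = "\<lambda>i. i - 1" and j = Suc])
       (auto simp: frag_cmul_diff_distrib2 simp flip: minus_frag_cmul)
  also have "\<dots> \<in> null_chains"
    by (rule psi_chain_cocycle) (use ys nth_in_biq diffs_closed in auto)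
  finally show ?thesis .
qed

lemma Psi_boundary_null:
  assumes "c \<in> carrier (mcb_P G M (Suc n))"
  shows "Psi (mcb_boundary G M \<phi> c) \<in> null_chains"
proof -
  have "Poly_Mapping.keys c \<subseteq> mcb_symbols G M (Suc n)" using assms by (simp add: mcb_P_def)
  then show ?thesis
  proof (induction c rule: frag_induction)
    case (one s)
    then show ?case using Psi_boundary_symb_null by (cases s) (simp add: mcb_boundary_def)
  next
    case (diff a b)
    then show ?case by (simp add: mcb_boundary_def frag_extend_diff Psi_diff null_diff)
  qed (simp add: mcb_boundary_def)
qed

end

section \<open>The cochain on the quotient complex\<close>

text \<open>The strictly increasing \<open>\<mu>\<close> sends the \<open>l\<close> with \<open>\<mu>(l) > j\<close> injectively into \<open>{j + 1..s + t}\<close>, so at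
  most \<open>s + t - j\<close> of them exist.  This keeps both indices in a shuffled block within range.\<close>

lemma shuffle_floor_bounds:
  assumes mu: "\<mu> \<in> shuffle_maps s t" and j: "j \<le> s + t"
  shows "shuffle_floor s \<mu> j \<le> s" "j - shuffle_floor s \<mu> j \<le> t"
proof -
  let ?A = "{l \<in> {1..s}. \<mu> l \<le> j}" and ?B = "{l \<in> {1..s}. j < \<mu> l}"
  have "card ?A + card ?B = card (?A \<union> ?B)"
    by (rule card_Un_disjoint[symmetric]) auto
  also have "?A \<union> ?B = {1..s}" by auto
  finally have AB: "card ?A + card ?B = s" by simp
  have "strict_mono_on {1..s} \<mu>" using mu by (simp add: shuffle_maps_def)
  then have "inj_on \<mu> ?B"
    by (rule strict_mono_on_imp_inj_on[THEN inj_on_subset]) auto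
  moreover have "\<mu> ` ?B \<subseteq> {Suc j..s + t}"
    using mu by (auto simp: shuffle_maps_def PiE_iff)
  ultimately have "card ?B \<le> card {Suc j..s + t}"
    by (intro card_inj_on_le) auto
  then show "shuffle_floor s \<mu> j \<le> s" "j - shuffle_floor s \<mu> j \<le> t"
    using AB j unfolding shuffle_floor_def by simp_all
qed

lemma length_shuffle_block [simp]: "length (shuffle_block H as bs \<mu>) = length as + length bs"
  unfolding shuffle_block_def length_map length_upt by simp

context alexander_mcb
begin

lemma set_shuffle_block:
  assumes as: "set as \<subseteq> {m} \<times> carrier G" and bs: "set bs \<subseteq> {m} \<times> carrier G"
    and mu: "\<mu> \<in> shuffle_maps (length as) (length bs)"
  shows "set (shuffle_block (mcb_fibre G m) as bs \<mu>) \<subseteq> {m} \<times> carrier G"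
proof -
  let ?H = "mcb_fibre G m"
  have entry: "snd ((\<one>\<^bsub>?H\<^esub> # zs) ! p) \<in> carrier G"
    if "set zs \<subseteq> {m} \<times> carrier G" "p \<le> length zs" for zs p
  proof -
    have "(\<one>\<^bsub>?H\<^esub> # zs) ! p \<in> set (\<one>\<^bsub>?H\<^esub> # zs)"
      using that(2) by (intro nth_mem) simp
    moreover have "set (\<one>\<^bsub>?H\<^esub> # zs) \<subseteq> {m} \<times> carrier G"
      using that(1) by (simp add: mcb_fibre_def)
    ultimately show ?thesis by (metis mem_Times_iff subsetD)
  qed
  show ?thesis
    unfolding shuffle_block_def
    using entry[OF as] entry[OF bs] shuffle_floor_bounds[OF mu]
    by (auto simp: mcb_fibre_def simp del: upt_Suc)
qed

definition D_generators :: "nat \<Rightarrow> (('m \<times> 'g) symb \<Rightarrow>\<^sub>0 int) set"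
  where "D_generators k =
    {frag_of (x, us @ [as, bs] @ vs) - shuffle_chain (mcb_fibre G m) x us as bs vs
     | x us as bs vs m. m \<in> carrier M \<and>
       set as \<subseteq> carrier (mcb_fibre G m) \<and> set bs \<subseteq> carrier (mcb_fibre G m) \<and>
       (x, us @ [as, bs] @ vs) \<in> mcb_symbols G M k}"

lemma mcb_D_eq: "2 \<le> k \<Longrightarrow> mcb_D G M k = generate (mcb_P G M k) (D_generators k)"
  by (simp add: mcb_D_def D_generators_def)

lemma shuffle_symbol:
  assumes m: "m \<in> carrier M"
    and as: "set as \<subseteq> carrier (mcb_fibre G m)" and bs: "set bs \<subseteq> carrier (mcb_fibre G m)"
    and s: "(x, us @ [as, bs] @ vs) \<in> mcb_symbols G M k"
    and mu: "\<mu> \<in> shuffle_maps (length as) (length bs)"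
  shows "(x, us @ [shuffle_block (mcb_fibre G m) as bs \<mu>] @ vs) \<in> mcb_symbols G M k"
proof -
  let ?b = "shuffle_block (mcb_fibre G m) as bs \<mu>"
  have "set ?b \<subseteq> {m} \<times> carrier G"
    by (rule set_shuffle_block[OF _ _ mu]) (use as bs in \<open>simp_all add: mcb_fibre_def\<close>)
  then have "is_block ?b"
    using m unfolding is_block_def by blast
  moreover have "as \<noteq> []"
    using s by (simp add: mcb_symbols_iff)
  then have "?b \<noteq> []"
    by (metis add_is_0 length_0_conv length_shuffle_block)
  ultimately show ?thesis
    using s by (simp add: mcb_symbols_iff ball_Un)
qed

lemma D_generators_closed: "D_generators k \<subseteq> carrier (mcb_P G M k)"
proof
  fix c assume "c \<in> D_generators k"
  then obtain x us as bs vs m where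
    c: "c = frag_of (x, us @ [as, bs] @ vs) - shuffle_chain (mcb_fibre G m) x us as bs vs"
    and *: "m \<in> carrier M" "set as \<subseteq> carrier (mcb_fibre G m)" "set bs \<subseteq> carrier (mcb_fibre G m)"
    and s: "(x, us @ [as, bs] @ vs) \<in> mcb_symbols G M k"
    unfolding D_generators_def by blast
  have "shuffle_chain (mcb_fibre G m) x us as bs vs \<in> carrier (free_Abelian_group (mcb_symbols G M k))"
    unfolding shuffle_chain_def
    by (intro sum_closed_free_Abelian_group cmul_closed)
       (use shuffle_symbol[OF * s] in \<open>simp add: keys_frag_of\<close>)
  moreover have "frag_of (x, us @ [as, bs] @ vs) \<in> carrier (free_Abelian_group (mcb_symbols G M k))"
    using s by (simp add: keys_frag_of)
  ultimately show "c \<in> carrier (mcb_P G M k)"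
    using keys_diff[of "frag_of (x, us @ [as, bs] @ vs)" "shuffle_chain (mcb_fibre G m) x us as bs vs"]
    unfolding c mcb_P_def by auto
qed

end

context multilinear_cochain
begin

text \<open>Shuffled symbols have fewer than \<open>n\<close> blocks and are killed by the projection.  The unshuffled one
  survives only if all blocks are singletons, and then \<open>\<langle>a\<rangle>\<langle>b\<rangle>\<close> with \<open>a\<close>, \<open>b\<close> in one \<open>G\<^sub>m\<close> gives the coordinate
  \<open>m - m = 0\<close>.\<close>

lemma Psi_D_generator_null:
  assumes c: "c \<in> D_generators n"
  shows "Psi c \<in> null_chains"
proof -
  from c obtain x us as bs vs m where
    c: "c = frag_of (x, us @ [as, bs] @ vs) - shuffle_chain (mcb_fibre G m) x us as bs vs"
    and ab: "set as \<subseteq> carrier (mcb_fibre G m)" "set bs \<subseteq> carrier (mcb_fibre G m)"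
    and s: "(x, us @ [as, bs] @ vs) \<in> mcb_symbols G M n"
    unfolding D_generators_def by blast
  let ?xs = "us @ [as, bs] @ vs"
  have "?xs ! 0 \<noteq> []"
    using s nth_mem[of 0 ?xs] by (auto simp: mcb_symbols_iff)
  then have "0 < length (?xs ! 0)" by simp
  then have le: "length ?xs \<le> n"
    using nth_length_le[OF s, of 0] by linarith
  have "Psi (shuffle_chain (mcb_fibre G m) x us as bs vs) = 0"
  proof (cases "finite (shuffle_maps (length as) (length bs))")
    case True
    have "Psi (frag_of (x, us @ [b] @ vs)) = 0" for b
      by (rule Psi_frag_of_0) (use le in simp)
    then show ?thesis
      unfolding shuffle_chain_def by (simp add: Psi_sum[OF True] Psi_cmul)
  next
    case False
    then show ?thesis by (simp add: shuffle_chain_def)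
  qed
  moreover have "Psi (frag_of (x, ?xs)) \<in> null_chains"
  proof (cases "length ?xs = n")
    case True
    define ys where "ys = x # map hd ?xs"
    let ?p = "Suc (length us)"
    have ys: "set ys \<subseteq> biq" "length ys = Suc n"
      using hd_list_biq[OF s] True by (simp_all add: ys_def)
    have ne: "as \<noteq> []" "bs \<noteq> []" using s by (auto simp: mcb_symbols_iff)
    have "fst (hd as) = m" "fst (hd bs) = m"
      using ab hd_in_set[OF ne(1)] hd_in_set[OF ne(2)] by (auto simp: mcb_fibre_def)
    then have fst: "fst (ys ! ?p) = m" "fst (ys ! Suc ?p) = m"
      by (simp_all add: ys_def nth_append)
    have p: "?p < n" using True by simp
    have m: "m \<in> carrier M"
      using nth_in_biq[OF ys(1), of ?p] p ys(2) fst(1) biq_D(1) by fastforce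
    have "psi_chain n (\<lambda>l. snd (ys ! l)) (diffs n ys) \<in> null_chains"
    proof (rule psi_chain_zero_coordinate[where j = ?p])
      show "diffs n ys ?p = \<zero>\<^bsub>M\<^esub>"
        using p fst m by (simp add: diffs_def Mod.M.minus_eq Mod.M.r_neg)
    qed (use p ys nth_in_biq diffs_closed in auto)
    then show ?thesis
      unfolding Psi_frag_of[OF s True] list_chain_def ys_def .
  qed (simp add: Psi_frag_of_0)
  ultimately show ?thesis by (simp add: c Psi_diff)
qed

lemma gp_relators:
  fixes R
  defines "R \<equiv> {frag_of (map (\<lambda>m. m \<bullet> g) ms) - frag_of ms | g ms. g \<in> carrier G \<and> ms \<in> T}"
  shows "R \<subseteq> carrier (free_Abelian_group T)" "c \<in> R \<Longrightarrow> L c = \<zero>\<^bsub>A\<^esub>"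
  using null_invariant unfolding R_def null_iff by auto

lemma Phi_chain_eq:
  assumes c: "c \<in> carrier (mcb_P G M n)"
  shows "Phi_chain G M \<phi> A n f c = L (Psi c)"
proof -
  have "on_quotient L (gp_rel G M (Suc n) #>\<^bsub>gp_chains M (Suc n)\<^esub> Psi c) = L (Psi c)"
    unfolding gp_rel_def gp_chains_def
    by (rule comm_group.on_quotient_coset[OF abelian_free_Abelian_group gp_relators(1) A.a_group L_hom])
       (use gp_relators(2) Psi_closed[OF c] in auto)
  then show ?thesis
    by (simp add: Phi_chain_def psi_BR_def Psi_def)
qed

lemma Phi_chain_hom: "Phi_chain G M \<phi> A n f \<in> hom (mcb_P G M n) (add_monoid A)"
proof (rule homI)
  fix c d assume c: "c \<in> carrier (mcb_P G M n)" and d: "d \<in> carrier (mcb_P G M n)"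
  then have "c + d \<in> carrier (mcb_P G M n)"
    unfolding mcb_P_def by (rule add_closed)
  then show "Phi_chain G M \<phi> A n f (c \<otimes>\<^bsub>mcb_P G M n\<^esub> d)
      = Phi_chain G M \<phi> A n f c \<otimes>\<^bsub>add_monoid A\<^esub> Phi_chain G M \<phi> A n f d"
    using c d Psi_closed[OF c] Psi_closed[OF d]
    by (simp add: Phi_chain_eq Psi_add L_add) (simp add: mcb_P_def Phi_chain_eq[unfolded mcb_P_def] Psi_add L_add)
qed (simp add: Phi_chain_eq L_closed Psi_closed)

lemma Phi_chain_D_generator: "c \<in> D_generators n \<Longrightarrow> Phi_chain G M \<phi> A n f c = \<zero>\<^bsub>A\<^esub>"
  using Psi_D_generator_null[of c] D_generators_closed[of n]
  by (simp add: Phi_chain_eq null_iff subset_iff)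

lemma
  assumes n: "2 \<le> n"
  shows Phi_class: "c \<in> carrier (mcb_P G M n)
      \<Longrightarrow> Phi G M \<phi> A n f (mcb_class G M n c) = Phi_chain G M \<phi> A n f c"
    and Phi_hom: "Phi G M \<phi> A n f \<in> hom (mcb_C G M n) (add_monoid A)"
proof -
  have P: "comm_group (mcb_P G M n)"
    unfolding mcb_P_def by (rule abelian_free_Abelian_group)
  note q = D_generators_closed A.a_group Phi_chain_hom
  show "c \<in> carrier (mcb_P G M n)
      \<Longrightarrow> Phi G M \<phi> A n f (mcb_class G M n c) = Phi_chain G M \<phi> A n f c"
    unfolding Phi_def mcb_class_def mcb_D_eq[OF n]
    by (rule comm_group.on_quotient_coset[OF P q]) (auto simp: Phi_chain_D_generator)
  show "Phi G M \<phi> A n f \<in> hom (mcb_C G M n) (add_monoid A)"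
    unfolding Phi_def mcb_C_def mcb_D_eq[OF n]
    by (rule comm_group.on_quotient_hom[OF P q]) (auto simp: Phi_chain_D_generator)
qed

theorem Phi_cocycle:
  assumes n: "2 \<le> n"
  shows "mcb_cocycle G M \<phi> n A (Phi G M \<phi> A n f)"
  unfolding mcb_cocycle_def
proof (intro conjI ballI Phi_hom[OF n])
  fix c assume c: "c \<in> carrier (mcb_P G M (n + 1))"
  then have "mcb_boundary G M \<phi> c \<in> carrier (mcb_P G M n)"
    by (intro boundary_closed) simp
  then show "Phi G M \<phi> A n f (mcb_class G M n (mcb_boundary G M \<phi> c)) = \<zero>\<^bsub>A\<^esub>"
    using Psi_boundary_null[of c] c by (simp add: Phi_class[OF n] Phi_chain_eq null_iff)
qed

lemma Phi_singletons:
  assumes n: "2 \<le> n" and xs: "set (x # xs) \<subseteq> biq" "length xs = n"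
  shows "Phi G M \<phi> A n f (mcb_class G M n (frag_of (x, map (\<lambda>y. [y]) xs)))
    = L (psi_chain n (\<lambda>l. snd ((x # xs) ! l)) (diffs n (x # xs)))"
proof -
  have "is_block [y]" if "y \<in> set xs" for y
  proof -
    have "y \<in> biq" using xs that by auto
    then show ?thesis by (auto simp: is_block_def mcb_carrier_def)
  qed
  moreover have "sum_list (map length (map (\<lambda>y. [y]) xs)) = n"
    using xs(2) by (simp add: comp_def sum_list_triv)
  ultimately have s: "(x, map (\<lambda>y. [y]) xs) \<in> mcb_symbols G M n"
    using xs(1) by (auto simp: mcb_symbols_iff)
  then have "frag_of (x, map (\<lambda>y. [y]) xs) \<in> carrier (mcb_P G M n)"
    by (simp add: mcb_P_def keys_frag_of)
  then show ?thesis
    using Psi_frag_of[OF s] xs(2)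
    by (simp add: Phi_class[OF n] Phi_chain_eq list_chain_def comp_def)
qed

end

section \<open>Closed formulas in degrees two and three\<close>

context multilinear_cochain
begin

text \<open>The closed formulas have one difference at each end; expanding both gives the signed sum over a square.\<close>

lemma null_bilinear:
  assumes ms: "ms \<in> T" and pq: "p \<le> n" "q \<le> n" "p \<noteq> q"
    and abcd: "a \<in> carrier M" "b \<in> carrier M" "c \<in> carrier M" "d \<in> carrier M"
  shows "frag_of (ms[p := a \<ominus>\<^bsub>M\<^esub> b, q := c \<ominus>\<^bsub>M\<^esub> d])
    - (frag_of (ms[p := a, q := c]) - frag_of (ms[p := b, q := c])
       - frag_of (ms[p := a, q := d]) + frag_of (ms[p := b, q := d])) \<in> null_chains"
proof -
  let ?w = "\<lambda>x y. frag_of (ms[p := x, q := y])"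
  have 1: "?w (a \<ominus>\<^bsub>M\<^esub> b) (c \<ominus>\<^bsub>M\<^esub> d) - (?w (a \<ominus>\<^bsub>M\<^esub> b) c - ?w (a \<ominus>\<^bsub>M\<^esub> b) d) \<in> null_chains"
    using null_subtractive[of "ms[p := a \<ominus>\<^bsub>M\<^esub> b]" q c d] ms pq abcd by (simp add: tuples_update)
  have 2: "?w (a \<ominus>\<^bsub>M\<^esub> b) y - (?w a y - ?w b y) \<in> null_chains" if "y \<in> carrier M" for y
    using null_subtractive[of "ms[q := y]" p a b] ms pq abcd that
    by (simp add: tuples_update list_update_swap[OF pq(3)])
  show ?thesis
    using null_diff[OF null_add[OF 1 2[OF abcd(3)]] 2[OF abcd(4)]] by (simp add: algebra_simps)
qed

lemma act_one_minus:
  "\<lbrakk>m \<in> carrier M; g \<in> carrier G\<rbrakk> \<Longrightarrow> m \<triangleleft>\<^bsub>M\<^esub> (frag_of \<one>\<^bsub>G\<^esub> - frag_of g) = m \<ominus>\<^bsub>M\<^esub> m \<bullet> g"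
  by (simp add: act_frag_diff)

lemma phi_left_commute:
  "\<lbrakk>g \<in> carrier G; a \<in> carrier G; b \<in> carrier G\<rbrakk> \<Longrightarrow> a \<cdot> (\<phi> g \<cdot> b) = \<phi> g \<cdot> (a \<cdot> b)"
  by (simp add: phi_comm[of g a] flip: G.m_assoc)

lemma inv_mult_cancel:
  "\<lbrakk>a \<in> carrier G; b \<in> carrier G\<rbrakk> \<Longrightarrow> inv\<^bsub>G\<^esub> a \<cdot> (a \<cdot> b) = b"
  "\<lbrakk>a \<in> carrier G; b \<in> carrier G\<rbrakk> \<Longrightarrow> a \<cdot> (inv\<^bsub>G\<^esub> a \<cdot> b) = b"
  by (simp_all flip: G.m_assoc)

lemma L_eqI:
  assumes c: "Poly_Mapping.keys c \<subseteq> T" and d: "Poly_Mapping.keys d \<subseteq> T" and cd: "c - d \<in> null_chains"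
  shows "L c = L d"
proof -
  have "L (c - d) = \<zero>\<^bsub>A\<^esub>" "Poly_Mapping.keys (c - d) \<subseteq> T" using cd by (simp_all add: null_iff)
  then show ?thesis
    using L_add[of "c - d" d] L_closed[OF d] d by simp
qed

lemma psi_chain_2:
  assumes n: "n = 2" and g: "\<And>l. \<lbrakk>1 \<le> l; l \<le> n\<rbrakk> \<Longrightarrow> g l \<in> carrier G"
    and v: "\<And>a b. v a b = frag_of (vertex n (\<lambda>l. if l = 1 then a else b) u)"
  shows "psi_chain n g u
    = v \<one>\<^bsub>G\<^esub> \<one>\<^bsub>G\<^esub> - v (g 1) \<one>\<^bsub>G\<^esub> - v \<one>\<^bsub>G\<^esub> (g 2) + v (g 1) (g 2)"
proof -
  have n': "n = Suc (Suc 0)" using n by simp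
  let ?h = "\<lambda>k :: nat \<Rightarrow> nat. frag_of (vertex n (\<lambda>l. g l [^]\<^bsub>G\<^esub> k l) u)"
  have "?h (insert_coord (Suc 0) (Suc (Suc 0)) c (insert_coord 0 (Suc 0) b k))
      = v (g 1 [^]\<^bsub>G\<^esub> b) (g 2 [^]\<^bsub>G\<^esub> c)" for b c k
    unfolding v n'
    by (intro arg_cong[where f = frag_of] vertex_cong)
       (auto simp: insert_coord_def numeral_2_eq_2 le_Suc_eq)
  moreover have "psi_chain n g u = cube_sum (Suc (Suc 0)) ?h"
    by (simp add: psi_chain_def n')
  ultimately show ?thesis
    using g[of 1] g[of 2] n
    by (simp add: cube_sum_split[of "Suc (Suc 0)" "Suc 0"] cube_sum_split[of "Suc 0" 0] cube_sum_0)
qed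

lemma psi_chain_3:
  assumes n: "n = 3" and g: "\<And>l. \<lbrakk>1 \<le> l; l \<le> n\<rbrakk> \<Longrightarrow> g l \<in> carrier G"
    and v: "\<And>a b c. v a b c = frag_of (vertex n (\<lambda>l. if l = 1 then a else if l = 2 then b else c) u)"
  shows "psi_chain n g u
    = (v \<one>\<^bsub>G\<^esub> \<one>\<^bsub>G\<^esub> \<one>\<^bsub>G\<^esub> - v (g 1) \<one>\<^bsub>G\<^esub> \<one>\<^bsub>G\<^esub> - v \<one>\<^bsub>G\<^esub> \<one>\<^bsub>G\<^esub> (g 3) + v (g 1) \<one>\<^bsub>G\<^esub> (g 3))
    - (v \<one>\<^bsub>G\<^esub> (g 2) \<one>\<^bsub>G\<^esub> - v (g 1) (g 2) \<one>\<^bsub>G\<^esub> - v \<one>\<^bsub>G\<^esub> (g 2) (g 3) + v (g 1) (g 2) (g 3))"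
proof -
  have n': "n = Suc (Suc (Suc 0))" using n by simp
  let ?h = "\<lambda>k :: nat \<Rightarrow> nat. frag_of (vertex n (\<lambda>l. g l [^]\<^bsub>G\<^esub> k l) u)"
  have "?h (insert_coord (Suc (Suc 0)) (Suc (Suc (Suc 0))) d
      (insert_coord (Suc 0) (Suc (Suc 0)) c (insert_coord 0 (Suc 0) b k)))
      = v (g 1 [^]\<^bsub>G\<^esub> b) (g 2 [^]\<^bsub>G\<^esub> c) (g 3 [^]\<^bsub>G\<^esub> d)" for b c d k
    unfolding v n'
    by (intro arg_cong[where f = frag_of] vertex_cong)
       (auto simp: insert_coord_def numeral_2_eq_2 numeral_3_eq_3 le_Suc_eq)
  moreover have "psi_chain n g u = cube_sum (Suc (Suc (Suc 0))) ?h"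
    by (simp add: psi_chain_def n')
  ultimately show ?thesis
    using g[of 1] g[of 2] g[of 3] n
    by (simp add: cube_sum_split[of "Suc (Suc (Suc 0))" "Suc (Suc 0)"]
        cube_sum_split[of "Suc (Suc 0)" "Suc 0"] cube_sum_split[of "Suc 0" 0] cube_sum_0 algebra_simps)
qed

text \<open>By \<open>G\<close>-invariance the common factor \<open>\<phi>(a) b\<close> can be removed; what remains depends on \<open>a\<close> only in the first
  and on \<open>b\<close> only in the last entry.\<close>

lemma vertex_2_normalized:
  assumes n: "n = 2" and a: "a \<in> carrier G" and b: "b \<in> carrier G"
    and u: "\<And>j. j \<le> n \<Longrightarrow> u j \<in> carrier M"
  shows "frag_of (vertex n (\<lambda>l. if l = 1 then a else b) u)
    - frag_of [u 0 \<bullet> (inv\<^bsub>G\<^esub> (\<phi> a) \<cdot> a), u 1, u 2 \<bullet> (\<phi> b \<cdot> inv\<^bsub>G\<^esub> b)] \<in> null_chains"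
proof -
  let ?ms = "[u 0 \<bullet> (inv\<^bsub>G\<^esub> (\<phi> a) \<cdot> a), u 1, u 2 \<bullet> (\<phi> b \<cdot> inv\<^bsub>G\<^esub> b)]"
  have u': "u 0 \<in> carrier M" "u (Suc 0) \<in> carrier M" "u (Suc (Suc 0)) \<in> carrier M"
    using u n by simp_all
  have ms: "?ms \<in> T" using a b u' by (simp add: tuples_def n numeral_2_eq_2)
  have 0: "inv\<^bsub>G\<^esub> (\<phi> a) \<cdot> a \<cdot> (\<phi> a \<cdot> b) = a \<cdot> b"
    using a b by (simp add: G.m_assoc phi_left_commute inv_mult_cancel)
  have 2: "\<phi> b \<cdot> inv\<^bsub>G\<^esub> b \<cdot> (\<phi> a \<cdot> b) = \<phi> (a \<cdot> b)"
    using a b by (simp add: G.m_assoc phi_left_commute phi_mult phi_comm[of b] inv_mult_cancel)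
  have "vertex n (\<lambda>l. if l = 1 then a else b) u
      = [u 0 \<bullet> (a \<cdot> b), u 1 \<bullet> (\<phi> a \<cdot> b), u 2 \<bullet> \<phi> (a \<cdot> b)]"
    using a b by (simp add: n numeral_2_eq_2 vertex_def vertex_word_def word_Cons)
  also have "\<dots> = map (\<lambda>x. x \<bullet> (\<phi> a \<cdot> b)) ?ms"
    using a b u' 0 2 by (simp add: numeral_2_eq_2 flip: act_mult)
  finally show ?thesis
    using null_invariant[OF ms, of "\<phi> a \<cdot> b"] a b by simp
qed

text \<open>By \<open>G\<close>-invariance the common factor \<open>\<phi>(a) c\<close> can be removed; then \<open>a\<close> and \<open>c\<close> each occur in one outer entry
  only, whereas the middle letter \<open>b\<close> acts on all entries and stays.\<close>

lemma vertex_3_normalized: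
  assumes n: "n = 3" and a: "a \<in> carrier G" and b: "b \<in> carrier G" and c: "c \<in> carrier G"
    and u: "\<And>j. j \<le> n \<Longrightarrow> u j \<in> carrier M"
  shows "frag_of (vertex n (\<lambda>l. if l = 1 then a else if l = 2 then b else c) u)
    - frag_of [u 0 \<bullet> (inv\<^bsub>G\<^esub> (\<phi> a) \<cdot> a) \<bullet> b, u 1 \<bullet> b, u 2 \<bullet> \<phi> b,
        u 3 \<bullet> (\<phi> c \<cdot> inv\<^bsub>G\<^esub> c) \<bullet> \<phi> b] \<in> null_chains"
proof -
  let ?ms = "[u 0 \<bullet> (inv\<^bsub>G\<^esub> (\<phi> a) \<cdot> a) \<bullet> b, u 1 \<bullet> b, u 2 \<bullet> \<phi> b, u 3 \<bullet> (\<phi> c \<cdot> inv\<^bsub>G\<^esub> c) \<bullet> \<phi> b]"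
  have u': "u 0 \<in> carrier M" "u (Suc 0) \<in> carrier M" "u (Suc (Suc 0)) \<in> carrier M"
    "u (Suc (Suc (Suc 0))) \<in> carrier M"
    using u n by simp_all
  have ms: "?ms \<in> T" using a b c u' by (simp add: tuples_def n numeral_2_eq_2 numeral_3_eq_3)
  have 0: "inv\<^bsub>G\<^esub> (\<phi> a) \<cdot> a \<cdot> b \<cdot> (\<phi> a \<cdot> c) = a \<cdot> (b \<cdot> c)"
    using a b c by (simp add: G.m_assoc phi_left_commute inv_mult_cancel)
  have 1: "b \<cdot> (\<phi> a \<cdot> c) = \<phi> a \<cdot> (b \<cdot> c)"
    using a b c by (simp add: phi_left_commute)
  have 2: "\<phi> b \<cdot> (\<phi> a \<cdot> c) = \<phi> (a \<cdot> b) \<cdot> c"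
    using a b c by (simp add: phi_mult phi_left_commute[of a] G.m_assoc)
  have 3: "\<phi> c \<cdot> inv\<^bsub>G\<^esub> c \<cdot> \<phi> b \<cdot> (\<phi> a \<cdot> c) = \<phi> (a \<cdot> (b \<cdot> c))"
  proof -
    have "\<phi> c \<cdot> inv\<^bsub>G\<^esub> c \<cdot> \<phi> b \<cdot> (\<phi> a \<cdot> c) = \<phi> c \<cdot> (\<phi> b \<cdot> (\<phi> a \<cdot> (inv\<^bsub>G\<^esub> c \<cdot> c)))"
      using a b c by (simp only: G.m_assoc phi_left_commute[of b "inv\<^bsub>G\<^esub> c"]
          phi_left_commute[of a "inv\<^bsub>G\<^esub> c"] phi_closed G.m_closed G.inv_closed)
    also have "\<dots> = \<phi> c \<cdot> (\<phi> a \<cdot> \<phi> b)"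
      using a b c by (simp add: phi_comm[of b "\<phi> a"])
    also have "\<dots> = \<phi> (a \<cdot> (b \<cdot> c))"
      using a b c by (simp add: phi_mult phi_comm[of c] G.m_assoc)
    finally show ?thesis .
  qed
  have "vertex n (\<lambda>l. if l = 1 then a else if l = 2 then b else c) u
      = [u 0 \<bullet> (a \<cdot> (b \<cdot> c)), u 1 \<bullet> (\<phi> a \<cdot> (b \<cdot> c)), u 2 \<bullet> (\<phi> (a \<cdot> b) \<cdot> c), u 3 \<bullet> \<phi> (a \<cdot> (b \<cdot> c))]"
    using a b c by (simp add: n numeral_2_eq_2 numeral_3_eq_3 vertex_def vertex_word_def word_Cons)
  also have "\<dots> = map (\<lambda>x. x \<bullet> (\<phi> a \<cdot> c)) ?ms"
    using a b c u' 0 1 2 3 by (simp add: numeral_2_eq_2 numeral_3_eq_3 flip: act_mult)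
  finally show ?thesis
    using null_invariant[OF ms, of "\<phi> a \<cdot> c"] a c by simp
qed

lemma L_psi_chain_2:
  assumes n: "n = 2" and g: "\<And>l. \<lbrakk>1 \<le> l; l \<le> n\<rbrakk> \<Longrightarrow> g l \<in> carrier G"
    and u: "\<And>j. j \<le> n \<Longrightarrow> u j \<in> carrier M"
  shows "L (psi_chain n g u) =
    f [u 0 \<triangleleft>\<^bsub>M\<^esub> (frag_of \<one>\<^bsub>G\<^esub> - frag_of (inv\<^bsub>G\<^esub> (\<phi> (g 1)) \<cdot> g 1)), u 1,
       u 2 \<triangleleft>\<^bsub>M\<^esub> (frag_of \<one>\<^bsub>G\<^esub> - frag_of (\<phi> (g 2) \<cdot> inv\<^bsub>G\<^esub> (g 2)))]"
proof -
  let ?P = "\<lambda>a. inv\<^bsub>G\<^esub> (\<phi> a) \<cdot> a" and ?Q = "\<lambda>b. \<phi> b \<cdot> inv\<^bsub>G\<^esub> b"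
  let ?w = "\<lambda>x y. frag_of [x, u 1, y]"
  let ?v = "\<lambda>a b. frag_of (vertex n (\<lambda>l. if l = 1 then a else b) u)"
  have g': "g 1 \<in> carrier G" "g 2 \<in> carrier G" using g n by simp_all
  have u': "u 0 \<in> carrier M" "u 1 \<in> carrier M" "u 2 \<in> carrier M" using u n by simp_all
  let ?x = "u 0 \<bullet> ?P (g 1)" and ?y = "u 2 \<bullet> ?Q (g 2)"
  have xy: "?x \<in> carrier M" "?y \<in> carrier M" using g' u' by simp_all
  have tT: "[p, u 1, q] \<in> T" if "p \<in> carrier M" "q \<in> carrier M" for p q
    using that u' by (simp add: tuples_def n)
  have V: "?v a b - ?w (u 0 \<bullet> ?P a) (u 2 \<bullet> ?Q b) \<in> null_chains"
    if "a \<in> carrier G" "b \<in> carrier G" for a b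
    by (rule vertex_2_normalized[OF n that u])
  have V': "?v \<one>\<^bsub>G\<^esub> \<one>\<^bsub>G\<^esub> - ?w (u 0) (u 2) \<in> null_chains" "?v (g 1) \<one>\<^bsub>G\<^esub> - ?w ?x (u 2) \<in> null_chains"
    "?v \<one>\<^bsub>G\<^esub> (g 2) - ?w (u 0) ?y \<in> null_chains" "?v (g 1) (g 2) - ?w ?x ?y \<in> null_chains"
    using V[of "\<one>\<^bsub>G\<^esub>" "\<one>\<^bsub>G\<^esub>"] V[of "g 1" "\<one>\<^bsub>G\<^esub>"] V[of "\<one>\<^bsub>G\<^esub>" "g 2"] V[of "g 1" "g 2"] g' u'
    by simp_all
  have B: "?w (u 0 \<ominus>\<^bsub>M\<^esub> ?x) (u 2 \<ominus>\<^bsub>M\<^esub> ?y)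
      - (?w (u 0) (u 2) - ?w ?x (u 2) - ?w (u 0) ?y + ?w ?x ?y) \<in> null_chains"
    using null_bilinear[of "[u 0, u 1, u 2]" 0 2 "u 0" ?x "u 2" ?y] tT u' xy n by simp
  have N: "psi_chain n g u - ?w (u 0 \<ominus>\<^bsub>M\<^esub> ?x) (u 2 \<ominus>\<^bsub>M\<^esub> ?y) \<in> null_chains"
    by (subst psi_chain_2[OF n g, where v = ?v], assumption, assumption, rule refl, rule back_subst[of "\<lambda>c. c \<in> null_chains",
          OF null_diff[OF null_add[OF null_diff[OF null_diff[OF V'(1,2)] V'(3)] V'(4)] B]]) simp
  have t: "[u 0 \<ominus>\<^bsub>M\<^esub> ?x, u 1, u 2 \<ominus>\<^bsub>M\<^esub> ?y] \<in> T" using tT u' xy by simp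
  have "L (psi_chain n g u) = L (?w (u 0 \<ominus>\<^bsub>M\<^esub> ?x) (u 2 \<ominus>\<^bsub>M\<^esub> ?y))"
    by (rule L_eqI[OF psi_chain_keys[OF g u] _ N]) (use t in \<open>auto simp: keys_frag_of\<close>)
  then show ?thesis
    using L_frag_of[OF t] g' u' by (simp add: act_one_minus)
qed

text \<open>For each value of the middle exponent the other two directions form a square, which is contracted as in
  degree two; the middle direction leaves the difference of the two terms.\<close>

lemma L_psi_chain_3:
  assumes n: "n = 3" and g: "\<And>l. \<lbrakk>1 \<le> l; l \<le> n\<rbrakk> \<Longrightarrow> g l \<in> carrier G"
    and u: "\<And>j. j \<le> n \<Longrightarrow> u j \<in> carrier M"
  shows "L (psi_chain n g u) =
    f [u 0 \<triangleleft>\<^bsub>M\<^esub> (frag_of \<one>\<^bsub>G\<^esub> - frag_of (inv\<^bsub>G\<^esub> (\<phi> (g 1)) \<cdot> g 1)), u 1, u 2,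
       u 3 \<triangleleft>\<^bsub>M\<^esub> (frag_of \<one>\<^bsub>G\<^esub> - frag_of (\<phi> (g 3) \<cdot> inv\<^bsub>G\<^esub> (g 3)))]
    \<ominus>\<^bsub>A\<^esub>
    f [(u 0 \<triangleleft>\<^bsub>M\<^esub> (frag_of \<one>\<^bsub>G\<^esub> - frag_of (inv\<^bsub>G\<^esub> (\<phi> (g 1)) \<cdot> g 1))) \<bullet> g 2, u 1 \<bullet> g 2,
       u 2 \<bullet> \<phi> (g 2),
       (u 3 \<triangleleft>\<^bsub>M\<^esub> (frag_of \<one>\<^bsub>G\<^esub> - frag_of (\<phi> (g 3) \<cdot> inv\<^bsub>G\<^esub> (g 3)))) \<bullet> \<phi> (g 2)]"
proof -
  let ?P = "\<lambda>a. inv\<^bsub>G\<^esub> (\<phi> a) \<cdot> a" and ?Q = "\<lambda>b. \<phi> b \<cdot> inv\<^bsub>G\<^esub> b"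
  let ?w = "\<lambda>b x y. frag_of [x \<bullet> b, u 1 \<bullet> b, u 2 \<bullet> \<phi> b, y \<bullet> \<phi> b]"
  let ?v = "\<lambda>a b c. frag_of (vertex n (\<lambda>l. if l = 1 then a else if l = 2 then b else c) u)"
  have g': "g 1 \<in> carrier G" "g 2 \<in> carrier G" "g 3 \<in> carrier G" using g n by simp_all
  have u': "u 0 \<in> carrier M" "u 1 \<in> carrier M" "u 2 \<in> carrier M" "u 3 \<in> carrier M"
    using u n by simp_all
  let ?x = "u 0 \<bullet> ?P (g 1)" and ?y = "u 3 \<bullet> ?Q (g 3)"
  have xy: "?x \<in> carrier M" "?y \<in> carrier M" using g' u' by simp_all
  have tT: "[p \<bullet> b, u 1 \<bullet> b, u 2 \<bullet> \<phi> b, q \<bullet> \<phi> b] \<in> T"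
    if "p \<in> carrier M" "q \<in> carrier M" "b \<in> carrier G" for p q b
    using that u' by (simp add: tuples_def n)
  have V: "?v a b c - ?w b (u 0 \<bullet> ?P a) (u 3 \<bullet> ?Q c) \<in> null_chains"
    if "a \<in> carrier G" "b \<in> carrier G" "c \<in> carrier G" for a b c
    by (rule vertex_3_normalized[OF n that u])
  let ?S = "\<lambda>b. ?v \<one>\<^bsub>G\<^esub> b \<one>\<^bsub>G\<^esub> - ?v (g 1) b \<one>\<^bsub>G\<^esub> - ?v \<one>\<^bsub>G\<^esub> b (g 3) + ?v (g 1) b (g 3)"
  have S: "?S b - ?w b (u 0 \<ominus>\<^bsub>M\<^esub> ?x) (u 3 \<ominus>\<^bsub>M\<^esub> ?y) \<in> null_chains" if b: "b \<in> carrier G" for b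
  proof -
    have V': "?v \<one>\<^bsub>G\<^esub> b \<one>\<^bsub>G\<^esub> - ?w b (u 0) (u 3) \<in> null_chains"
      "?v (g 1) b \<one>\<^bsub>G\<^esub> - ?w b ?x (u 3) \<in> null_chains"
      "?v \<one>\<^bsub>G\<^esub> b (g 3) - ?w b (u 0) ?y \<in> null_chains" "?v (g 1) b (g 3) - ?w b ?x ?y \<in> null_chains"
      using V[of "\<one>\<^bsub>G\<^esub>" b "\<one>\<^bsub>G\<^esub>"] V[of "g 1" b "\<one>\<^bsub>G\<^esub>"] V[of "\<one>\<^bsub>G\<^esub>" b "g 3"] V[of "g 1" b "g 3"] g' u' b
      by simp_all
    have B: "?w b (u 0 \<ominus>\<^bsub>M\<^esub> ?x) (u 3 \<ominus>\<^bsub>M\<^esub> ?y)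
        - (?w b (u 0) (u 3) - ?w b ?x (u 3) - ?w b (u 0) ?y + ?w b ?x ?y) \<in> null_chains"
      using null_bilinear[of "[u 0 \<bullet> b, u 1 \<bullet> b, u 2 \<bullet> \<phi> b, u 3 \<bullet> \<phi> b]" 0 3
          "u 0 \<bullet> b" "?x \<bullet> b" "u 3 \<bullet> \<phi> b" "?y \<bullet> \<phi> b"] tT u' xy n b
      by (simp add: act_diff)
    show ?thesis
      by (rule back_subst[of "\<lambda>c. c \<in> null_chains",
            OF null_diff[OF null_add[OF null_diff[OF null_diff[OF V'(1,2)] V'(3)] V'(4)] B]]) simp
  qed
  let ?e = "\<lambda>b. [(u 0 \<ominus>\<^bsub>M\<^esub> ?x) \<bullet> b, u 1 \<bullet> b, u 2 \<bullet> \<phi> b, (u 3 \<ominus>\<^bsub>M\<^esub> ?y) \<bullet> \<phi> b]"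
  have N: "psi_chain n g u - (frag_of (?e \<one>\<^bsub>G\<^esub>) - frag_of (?e (g 2))) \<in> null_chains"
    by (subst psi_chain_3[OF n g, where v = ?v], assumption, assumption, rule refl, rule back_subst[of "\<lambda>c. c \<in> null_chains", OF null_diff[OF S[OF G.one_closed] S[OF g'(2)]]]) simp
  have t: "?e b \<in> T" if "b \<in> carrier G" for b using tT u' xy that by simp
  have k: "Poly_Mapping.keys (frag_of (?e b)) \<subseteq> T" if "b \<in> carrier G" for b
    using t[OF that] by (simp add: keys_frag_of)
  have "L (psi_chain n g u) = L (frag_of (?e \<one>\<^bsub>G\<^esub>) - frag_of (?e (g 2)))"
    by (rule L_eqI[OF psi_chain_keys[OF g u] _ N])
       (use k[of "\<one>\<^bsub>G\<^esub>"] k[of "g 2"] g' keys_diff[of "frag_of (?e \<one>\<^bsub>G\<^esub>)" "frag_of (?e (g 2))"] in auto)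
  also have "\<dots> = f (?e \<one>\<^bsub>G\<^esub>) \<ominus>\<^bsub>A\<^esub> f (?e (g 2))"
    unfolding L_diff[OF k[OF G.one_closed] k[OF g'(2)]]
      L_frag_of[OF t[OF G.one_closed]] L_frag_of[OF t[OF g'(2)]] ..
  finally show ?thesis
    using g' u' xy by (simp add: act_one_minus)
qed

end

theorem theorem6p10:
  fixes G :: "('g, 'e) monoid_scheme"
    and M :: "('g \<Rightarrow>\<^sub>0 int, 'm, 'f) right_mod_scheme"
    and \<phi> :: "'g \<Rightarrow> 'g"
    and A :: "('a, 'h) ring_scheme"
  assumes "Group.group G"
    and "right_module (int_group_ring G) M"
    and "\<phi> \<in> hom G (G\<lparr>carrier := group_center G\<rparr>)"
    and "abelian_group A"
  shows
    "(\<forall>f. multilinear_map 3 M A f \<and> G_invariant 3 G M f \<longrightarrow>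
       (\<forall>c\<in>carrier (mcb_P G M 2).
          Phi G M \<phi> A 2 f (mcb_class G M 2 c) = Phi_chain G M \<phi> A 2 f c) \<and>
       mcb_cocycle G M \<phi> 2 A (Phi G M \<phi> A 2 f) \<and>
       (\<forall>m0 g0 m1 g1 m2 g2.
          (m0, g0) \<in> mcb_carrier G M \<and> (m1, g1) \<in> mcb_carrier G M \<and>
          (m2, g2) \<in> mcb_carrier G M \<longrightarrow>
          Phi G M \<phi> A 2 f (mcb_class G M 2
            (frag_of ((m0, g0), [[(m1, g1)], [(m2, g2)]]))) =
          f [(m0 \<ominus>\<^bsub>M\<^esub> m1) \<triangleleft>\<^bsub>M\<^esub> (frag_of \<one>\<^bsub>G\<^esub> - frag_of (inv\<^bsub>G\<^esub> (\<phi> g1) \<otimes>\<^bsub>G\<^esub> g1)),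
             m1 \<ominus>\<^bsub>M\<^esub> m2,
             m2 \<triangleleft>\<^bsub>M\<^esub> (frag_of \<one>\<^bsub>G\<^esub> - frag_of (\<phi> g2 \<otimes>\<^bsub>G\<^esub> inv\<^bsub>G\<^esub> g2))]))
     \<and>
     (\<forall>f. multilinear_map 4 M A f \<and> G_invariant 4 G M f \<longrightarrow>
       (\<forall>c\<in>carrier (mcb_P G M 3).
          Phi G M \<phi> A 3 f (mcb_class G M 3 c) = Phi_chain G M \<phi> A 3 f c) \<and>
       mcb_cocycle G M \<phi> 3 A (Phi G M \<phi> A 3 f) \<and>
       (\<forall>m0 g0 m1 g1 m2 g2 m3 g3.
          (m0, g0) \<in> mcb_carrier G M \<and> (m1, g1) \<in> mcb_carrier G M \<and>
          (m2, g2) \<in> mcb_carrier G M \<and> (m3, g3) \<in> mcb_carrier G M \<longrightarrow>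
          Phi G M \<phi> A 3 f (mcb_class G M 3
            (frag_of ((m0, g0), [[(m1, g1)], [(m2, g2)], [(m3, g3)]]))) =
          f [(m0 \<ominus>\<^bsub>M\<^esub> m1) \<triangleleft>\<^bsub>M\<^esub> (frag_of \<one>\<^bsub>G\<^esub> - frag_of (inv\<^bsub>G\<^esub> (\<phi> g1) \<otimes>\<^bsub>G\<^esub> g1)),
             m1 \<ominus>\<^bsub>M\<^esub> m2,
             m2 \<ominus>\<^bsub>M\<^esub> m3,
             m3 \<triangleleft>\<^bsub>M\<^esub> (frag_of \<one>\<^bsub>G\<^esub> - frag_of (\<phi> g3 \<otimes>\<^bsub>G\<^esub> inv\<^bsub>G\<^esub> g3))]
          \<ominus>\<^bsub>A\<^esub>
          f [(m0 \<ominus>\<^bsub>M\<^esub> m1) \<triangleleft>\<^bsub>M\<^esub> (frag_of \<one>\<^bsub>G\<^esub> - frag_of (inv\<^bsub>G\<^esub> (\<phi> g1) \<otimes>\<^bsub>G\<^esub> g1))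
               \<triangleleft>\<^bsub>M\<^esub> frag_of g2,
             (m1 \<ominus>\<^bsub>M\<^esub> m2) \<triangleleft>\<^bsub>M\<^esub> frag_of g2,
             (m2 \<ominus>\<^bsub>M\<^esub> m3) \<triangleleft>\<^bsub>M\<^esub> frag_of (\<phi> g2),
             m3 \<triangleleft>\<^bsub>M\<^esub> (frag_of \<one>\<^bsub>G\<^esub> - frag_of (\<phi> g3 \<otimes>\<^bsub>G\<^esub> inv\<^bsub>G\<^esub> g3))
               \<triangleleft>\<^bsub>M\<^esub> frag_of (\<phi> g2)]))"

proof (intro conjI allI impI)
  have loc: "alexander_mcb G M \<phi>"
    using assms by (simp add: alexander_mcb_def alexander_mcb_axioms_def)
  {
    fix f assume f: "multilinear_map 3 M A f \<and> G_invariant 3 G M f"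
    interpret multilinear_cochain G M \<phi> A 2 f
      using f by (intro multilinear_cochain.intro[OF loc assms(4)] multilinear_cochain_axioms.intro) simp_all
    show "\<forall>c\<in>carrier (mcb_P G M 2). Phi G M \<phi> A 2 f (mcb_class G M 2 c) = Phi_chain G M \<phi> A 2 f c"
      by (simp add: Phi_class)
    show "mcb_cocycle G M \<phi> 2 A (Phi G M \<phi> A 2 f)"
      by (rule Phi_cocycle) simp
    fix m0 g0 m1 g1 m2 g2
    assume x: "(m0, g0) \<in> mcb_carrier G M \<and> (m1, g1) \<in> mcb_carrier G M \<and> (m2, g2) \<in> mcb_carrier G M"
    let ?xs = "[(m0, g0), (m1, g1), (m2, g2)]"
    have xs: "set ?xs \<subseteq> mcb_carrier G M" using x by simp
    have g: "snd (?xs ! l) \<in> carrier G" if "1 \<le> l" "l \<le> 2" for l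
      by (rule biq_D(2)[OF nth_in_biq[OF xs]]) (use that in simp)
    have u: "diffs 2 ?xs j \<in> carrier M" if "j \<le> 2" for j
      by (rule diffs_closed[OF xs _ that]) simp
    show "Phi G M \<phi> A 2 f (mcb_class G M 2 (frag_of ((m0, g0), [[(m1, g1)], [(m2, g2)]])))
        = f [(m0 \<ominus>\<^bsub>M\<^esub> m1) \<triangleleft>\<^bsub>M\<^esub> (frag_of \<one>\<^bsub>G\<^esub> - frag_of (inv\<^bsub>G\<^esub> (\<phi> g1) \<otimes>\<^bsub>G\<^esub> g1)), m1 \<ominus>\<^bsub>M\<^esub> m2,
             m2 \<triangleleft>\<^bsub>M\<^esub> (frag_of \<one>\<^bsub>G\<^esub> - frag_of (\<phi> g2 \<otimes>\<^bsub>G\<^esub> inv\<^bsub>G\<^esub> g2))]"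
      using Phi_singletons[OF _ xs] L_psi_chain_2[OF refl g u] by (simp add: diffs_def)
  }
  {
    fix f assume f: "multilinear_map 4 M A f \<and> G_invariant 4 G M f"
    interpret multilinear_cochain G M \<phi> A 3 f
      using f by (intro multilinear_cochain.intro[OF loc assms(4)] multilinear_cochain_axioms.intro) simp_all
    show "\<forall>c\<in>carrier (mcb_P G M 3). Phi G M \<phi> A 3 f (mcb_class G M 3 c) = Phi_chain G M \<phi> A 3 f c"
      by (simp add: Phi_class)
    show "mcb_cocycle G M \<phi> 3 A (Phi G M \<phi> A 3 f)"
      by (rule Phi_cocycle) simp
    fix m0 g0 m1 g1 m2 g2 m3 g3
    assume x: "(m0, g0) \<in> mcb_carrier G M \<and> (m1, g1) \<in> mcb_carrier G M \<and>
      (m2, g2) \<in> mcb_carrier G M \<and> (m3, g3) \<in> mcb_carrier G M"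
    let ?xs = "[(m0, g0), (m1, g1), (m2, g2), (m3, g3)]"
    let ?p = "(m0 \<ominus>\<^bsub>M\<^esub> m1) \<triangleleft>\<^bsub>M\<^esub> (frag_of \<one>\<^bsub>G\<^esub> - frag_of (inv\<^bsub>G\<^esub> (\<phi> g1) \<otimes>\<^bsub>G\<^esub> g1))"
    let ?q = "m3 \<triangleleft>\<^bsub>M\<^esub> (frag_of \<one>\<^bsub>G\<^esub> - frag_of (\<phi> g3 \<otimes>\<^bsub>G\<^esub> inv\<^bsub>G\<^esub> g3))"
    have xs: "set ?xs \<subseteq> mcb_carrier G M" using x by simp
    have g: "snd (?xs ! l) \<in> carrier G" if "1 \<le> l" "l \<le> 3" for l
      by (rule biq_D(2)[OF nth_in_biq[OF xs]]) (use that in simp)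
    have u: "diffs 3 ?xs j \<in> carrier M" if "j \<le> 3" for j
      by (rule diffs_closed[OF xs _ that]) simp
    show "Phi G M \<phi> A 3 f (mcb_class G M 3 (frag_of ((m0, g0), [[(m1, g1)], [(m2, g2)], [(m3, g3)]])))
        = f [?p, m1 \<ominus>\<^bsub>M\<^esub> m2, m2 \<ominus>\<^bsub>M\<^esub> m3, ?q]
          \<ominus>\<^bsub>A\<^esub> f [?p \<triangleleft>\<^bsub>M\<^esub> frag_of g2, (m1 \<ominus>\<^bsub>M\<^esub> m2) \<triangleleft>\<^bsub>M\<^esub> frag_of g2,
               (m2 \<ominus>\<^bsub>M\<^esub> m3) \<triangleleft>\<^bsub>M\<^esub> frag_of (\<phi> g2), ?q \<triangleleft>\<^bsub>M\<^esub> frag_of (\<phi> g2)]"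
      using Phi_singletons[OF _ xs] L_psi_chain_3[OF refl g u] by (simp add: diffs_def)
  }
qed

end
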